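(* Let $\mathcal{B}$ be the algebra of the quantum projective space, $\Omega$ its Heckenberger–Kolb first-order calculus, $\Omega^\bullet$ the universal differential calculus of $\Omega$, and $\nabla:\Omega\to\Omega\otimes_{\mathcal{B}}\Omega$ the quantum Levi-Civita connection. Then the Riemann tensor $R_\nabla:\Omega\to\Omega^2\otimes_{\mathcal{B}}\Omega$ is a $\mathcal{B}$-bimodule map.
   Context: **Quantum group data.** Fix an integer $r\ge 1$, a real number $0<q<1$ and $s\in\{1,r\}$. $U_q(\mathfrak{sl}_{r+1})$ is the quantized enveloping algebra with generators $K_i^{\pm1},E_i,F_i$, $1\le i\le r$ (Klimyk–Schmüdgen conventions: $\Delta(K_i)=K_i\otimes K_i$, $\Delta(E_i)=E_i\otimes K_i+1\otimes E_i$, $\Delta(F_i)=F_i\otimes 1+K_i^{-1}\otimes F_i$; $K_i$ acts on a vector of weight $\mu$ by $q^{(\alpha_i,\mu)}$). Here $\alpha_i$ are the simple roots, $\omega_i$ the fundamental weights, $\rho=\sum_i\omega_i$, $w_0$ the longest Weyl group element, $(\cdot,\cdot)$ the invariant form with $(\alpha_i,\alpha_i)=2$. Put $a=(\alpha_s,\alpha_s)=2$, $w=(\omega_s,\omega_s)$, $m=(\omega_s,2\rho)=r$. $V(\lambda)$ is the simple type 1 module of highest weight $\lambda$, $V=V(\omega_s)$, and $V^*$ is its dual with $(Xf)(v)=f(S(X)v)$, $S$ the antipode. $\hat{R}_{X,Y}:X\otimes Y\to Y\otimes X$ is the braiding on finite-dimensional type 1 modules determined by being a module map with $\hat{R}_{V(\lambda),V(\mu)}(v\otimes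 u)=q^{(\lambda,w_0\mu)}u\otimes v$ for $v$ a highest weight vector of $V(\lambda)$ and $u$ a lowest weight vector of $V(\mu)$. Let $(v_i)$ be a weight basis of $V$ with weights $\lambda_i$ and dual basis $(f^i)$ of $V^*$. Define $\mathsf{E}:V^*\otimes V\to\mathbb{C}$, $\mathsf{E}(f^i\otimes v_j)=\delta_{ij}$, and $\mathsf{E}':V\otimes V^*\to\mathbb{C}$, $\mathsf{E}'(v_i\otimes f^j)=q^{(\lambda_i,2\rho)}\delta_{ij}$. Subscripts indicate the tensor legs on which a map acts; products of maps are compositions (rightmost first), legs being renumbered after each contraction. Put $$\mathsf{S}_{123}=(\hat{R}_{V,V^*})_{23}(\hat{R}_{V,V})_{12}(\hat{R}_{V,V^*}^{-1})_{23},\quad \tilde{\mathsf{S}}_{234}=(\hat{R}_{V,V^*})_{23}(\hat{R}_{V^*,V^*}^{-1})_{34}(\hat{R}_{V,V^*}^{-1})_{23},\quad \mathsf{T}_{1234}=\mathsf{S}_{123}\tilde{\mathsf{S}}_{234}=\tilde{\mathsf{S}}_{234}\mathsf{S}_{123}$$ (acting on $V\otimes V^*\otimes V$, $V^*\otimes V\otimes V^*$, $V\otimes V^*\otimes V\otimes V^*$ at the indicated legs). **Index-free notation.** A family $x=(x^{ij})_{1\le i,j\le r+1}$ is identified with $\sum_{i,j}v_i\otimes f^j\otimes x^{ij}$; products of families $xy$ (also $x\otimes y$, $x\wedge y$) denote $\sum v_i\otimes f^j\otimes v_k\otimes f^l\otimes x^{ij}y^{kl}$ (resp. with $\otimes_{\mathcal{B}}$,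 $\wedge$), and similarly for more factors. The maps above act on the $V,V^*$ legs; other maps act on components. Elements such as $g_{+-}$ below carry no legs. **Algebra and first-order calculus.** $\mathcal{B}$ is the unital algebra generated by $p^{ij}$, $1\le i,j\le r+1$, with relations $\mathsf{S}_{123}pp=q^{w}pp$, $\tilde{\mathsf{S}}_{234}pp=q^{-w}pp$, $\mathsf{E}'_{12}p=q^{m}$. The Heckenberger–Kolb first-order differential calculus (FODC) is $\Omega=\Omega_+\oplus\Omega_-$, with $\Omega_+,\Omega_-$ generated as left $\mathcal{B}$-modules by $\partial p^{ij}$, resp. $\bar\partial p^{ij}$, with relations $$\tilde{\mathsf{S}}_{234}p\,\partial p=q^{-w}p\,\partial p,\quad \mathsf{E}'_{12}\partial p=0,\qquad \mathsf{S}_{123}p\,\bar\partial p=q^{w}p\,\bar\partial p,\quad \mathsf{E}'_{12}\bar\partial p=0,$$ right module structure $\partial p\,p=q^{a}\mathsf{T}_{1234}p\,\partial p$, $\bar\partial p\,p=q^{-a}\mathsf{T}_{1234}p\,\bar\partial p$, and differential $\mathrm{d}=\partial+\bar\partial$, where $\partial,\bar\partial:\mathcal{B}\to\Omega_\pm$ are the derivations with $p^{ij}\mapsto\partial p^{ij},\bar\partial p^{ij}$. **Universal calculus.** $\Omega^\bullet$ is the quotient of the tensor algebra $T_{\mathcal{B}}(\Omega)$ by the two-sided ideal generated by $\{\sum_i\mathrm{d}a_i\otimes\mathrm{d}b_i:\sum_i a_i\mathrm{d}b_i=0\}\subset\Omega\otimes_{\mathcal{B}}\Omega$; its product is $\wedge$,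 and $\mathrm{d}(a\,\mathrm{d}b)=\mathrm{d}a\wedge\mathrm{d}b$. **Metric components.** $g_{+-}=\mathsf{E}'_{12}\mathsf{E}_{23}\,\partial p\otimes\bar\partial p$ and $g_{-+}=\mathsf{E}'_{12}\mathsf{E}_{23}\,\bar\partial p\otimes\partial p$ in $\Omega\otimes_{\mathcal{B}}\Omega$ (central elements). **Connection.** The quantum Levi-Civita connection is the (well-defined) linear map $\nabla:\Omega\to\Omega\otimes_{\mathcal{B}}\Omega$ with $\nabla(b\omega)=\mathrm{d}b\otimes\omega+b\nabla(\omega)$ for $b\in\mathcal{B}$, $\omega\in\Omega$, and $$\nabla(\partial p)=q^{a}\mathsf{E}_{23}\mathsf{T}_{1234}\,\bar\partial p\otimes\partial p-q^{a}q^{-m}\,p\,g_{-+},\qquad \nabla(\bar\partial p)=\mathsf{E}_{23}\,\partial p\otimes\bar\partial p-q^{-m}\,p\,g_{+-}.$$ **Riemann tensor.** $R_\nabla:=(\mathrm{d}\otimes\mathrm{id}-(\wedge\otimes\mathrm{id})\circ(\mathrm{id}\otimes\nabla))\circ\nabla:\Omega\to\Omega^2\otimes_{\mathcal{B}}\Omega$. *)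

theory Defs
  imports "HOL-Analysis.Analysis" "HOL-Library.Poly_Mapping"
begin

section \<open>Complex vector spaces and algebras\<close>

class complex_vector = ab_group_add +
  fixes scaleC :: "complex \<Rightarrow> 'a \<Rightarrow> 'a"  (infixr \<open>*\<^sub>C\<close> 75)
  assumes scaleC_add_right: "c *\<^sub>C (x + y) = c *\<^sub>C x + c *\<^sub>C y"
    and scaleC_add_left: "(c + c') *\<^sub>C x = c *\<^sub>C x + c' *\<^sub>C x"
    and scaleC_scaleC: "c *\<^sub>C c' *\<^sub>C x = (c * c') *\<^sub>C x"
    and scaleC_one: "1 *\<^sub>C x = x"

class complex_algebra_1 = complex_vector + ring_1 +
  assumes mult_scaleC_left: "(c *\<^sub>C x) * y = c *\<^sub>C (x * y)"
    and mult_scaleC_right: "x * (c *\<^sub>C y) = c *\<^sub>C (x * y)"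

global_interpretation cvec: vector_space "scaleC :: complex \<Rightarrow> 'a \<Rightarrow> 'a::complex_vector"
  by unfold_locales
    (simp_all add: scaleC_add_right scaleC_add_left scaleC_scaleC scaleC_one)

abbreviation clinear :: "('a::complex_vector \<Rightarrow> 'b::complex_vector) \<Rightarrow> bool"
  where "clinear \<equiv> Vector_Spaces.linear scaleC scaleC"

instantiation complex :: complex_algebra_1
begin
definition scaleC_complex :: "complex \<Rightarrow> complex \<Rightarrow> complex"
  where "scaleC_complex = (*)"
instance by standard (simp_all add: scaleC_complex_def algebra_simps)
end

instantiation prod :: (complex_vector, complex_vector) complex_vector
begin
definition scaleC_prod :: "complex \<Rightarrow> 'a \<times> 'b \<Rightarrow> 'a \<times> 'b"
  where "scaleC_prod c x = (c *\<^sub>C fst x, c *\<^sub>C snd x)"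
instance
  by standard (simp_all add: scaleC_prod_def prod_eq_iff
      scaleC_add_right scaleC_add_left scaleC_scaleC scaleC_one)
end

instantiation poly_mapping :: (type, complex_vector) complex_vector
begin
definition scaleC_poly_mapping :: "complex \<Rightarrow> ('a \<Rightarrow>\<^sub>0 'b) \<Rightarrow> 'a \<Rightarrow>\<^sub>0 'b"
  where "scaleC_poly_mapping c f = Poly_Mapping.map (scaleC c) f"
instance
proof -
  have "Poly_Mapping.lookup (c *\<^sub>C f) k = c *\<^sub>C Poly_Mapping.lookup f k"
    for c and f :: "'a \<Rightarrow>\<^sub>0 'b" and k
    by (simp add: scaleC_poly_mapping_def Poly_Mapping.map.rep_eq when_def)
  then show "OFCLASS('a \<Rightarrow>\<^sub>0 'b, complex_vector_class)"
    by intro_classes (auto intro!: poly_mapping_eqI simp: lookup_add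
      scaleC_add_right scaleC_add_left scaleC_scaleC scaleC_one)
qed
end


section \<open>The root system of type A\<close>

text \<open>
  Weights of \<open>sl(r+1)\<close> are represented by their coordinates \<open>1, \<dots>, r+1\<close> in the standard
  realization of the root system inside the hyperplane of sum zero, on which the invariant
  form is the standard inner product and the Weyl group permutes the coordinates.
  Coordinates outside that range vanish.
\<close>

type_synonym weight = "nat \<Rightarrow> real"

definition alpha :: "nat \<Rightarrow> weight"
  where "alpha i = (\<lambda>k. if k = i then 1 else if k = i + 1 then -1 else 0)"

definition omega :: "nat \<Rightarrow> nat \<Rightarrow> weight"
  where "omega r i = (\<lambda>k. if k \<in> {1..r+1} then (if k \<le> i then 1 else 0) - real i / real (r + 1) else 0)"

definition two_rho :: "nat \<Rightarrow> weight"
  where "two_rho r = (\<lambda>k. 2 * (\<Sum>i=1..r. omega r i k))"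

definition wform :: "nat \<Rightarrow> weight \<Rightarrow> weight \<Rightarrow> real"
  where "wform r \<mu> \<nu> = (\<Sum>k=1..r+1. \<mu> k * \<nu> k)"

text \<open>The longest element of the symmetric group reverses the order of the coordinates.\<close>

definition weyl_w0 :: "nat \<Rightarrow> weight \<Rightarrow> weight"
  where "weyl_w0 r \<mu> = (\<lambda>k. if k \<in> {1..r+1} then \<mu> (r + 2 - k) else 0)"

definition weight_lattice :: "nat \<Rightarrow> weight set"
  where "weight_lattice r = {\<mu>. \<exists>n :: nat \<Rightarrow> int. \<mu> = (\<lambda>k. \<Sum>i=1..r. of_int (n i) * omega r i k)}"

definition const_a :: "nat \<Rightarrow> nat \<Rightarrow> real"
  where "const_a r s = wform r (alpha s) (alpha s)"

definition const_w :: "nat \<Rightarrow> nat \<Rightarrow> real"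
  where "const_w r s = wform r (omega r s) (omega r s)"

definition const_m :: "nat \<Rightarrow> nat \<Rightarrow> real"
  where "const_m r s = wform r (omega r s) (two_rho r)"


section \<open>Finite-dimensional modules over the quantized enveloping algebra\<close>

datatype uq_gen = GK nat | GKinv nat | GE nat | GF nat

text \<open>A module on \<^typ>\<open>complex^'i\<close> is given by the matrices of the generators.\<close>

type_synonym 'i rep = "uq_gen \<Rightarrow> complex^'i^'i"

definition gens :: "nat \<Rightarrow> uq_gen set"
  where "gens r = (\<Union>i\<in>{1..r}. {GK i, GKinv i, GE i, GF i})"

definition uq_module :: "nat \<Rightarrow> real \<Rightarrow> ('i::finite) rep \<Rightarrow> bool"
  where "uq_module r q X \<longleftrightarrow>
    (\<forall>i\<in>{1..r}. X (GK i) ** X (GKinv i) = mat 1 \<and> X (GKinv i) ** X (GK i) = mat 1) \<and>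
    (\<forall>i\<in>{1..r}. \<forall>j\<in>{1..r}.
      X (GK i) ** X (GK j) = X (GK j) ** X (GK i) \<and>
      X (GK i) ** X (GE j) ** X (GKinv i) = (q powr wform r (alpha i) (alpha j)) *\<^sub>R X (GE j) \<and>
      X (GK i) ** X (GF j) ** X (GKinv i) = (q powr - wform r (alpha i) (alpha j)) *\<^sub>R X (GF j) \<and>
      X (GE i) ** X (GF j) - X (GF j) ** X (GE i) =
        (if i = j then (1 / (q - 1 / q)) *\<^sub>R (X (GK i) - X (GKinv i)) else 0)) \<and>
    (\<forall>i\<in>{1..r}. \<forall>j\<in>{1..r}. i + 1 < j \<or> j + 1 < i \<longrightarrow>
      X (GE i) ** X (GE j) = X (GE j) ** X (GE i) \<and>
      X (GF i) ** X (GF j) = X (GF j) ** X (GF i)) \<and>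
    (\<forall>i\<in>{1..r}. \<forall>j\<in>{1..r}. j = i + 1 \<or> i = j + 1 \<longrightarrow>
      X (GE i) ** X (GE i) ** X (GE j) - (q + 1 / q) *\<^sub>R (X (GE i) ** X (GE j) ** X (GE i))
        + X (GE j) ** X (GE i) ** X (GE i) = 0 \<and>
      X (GF i) ** X (GF i) ** X (GF j) - (q + 1 / q) *\<^sub>R (X (GF i) ** X (GF j) ** X (GF i))
        + X (GF j) ** X (GF i) ** X (GF i) = 0)"

definition weight_vector :: "nat \<Rightarrow> real \<Rightarrow> ('i::finite) rep \<Rightarrow> weight \<Rightarrow> complex^'i \<Rightarrow> bool"
  where "weight_vector r q X \<mu> v \<longleftrightarrow> \<mu> \<in> weight_lattice r \<and> v \<noteq> 0 \<and>
    (\<forall>i\<in>{1..r}. X (GK i) *v v = (q powr wform r (alpha i) \<mu>) *\<^sub>R v)"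

definition highest_weight_vector :: "nat \<Rightarrow> real \<Rightarrow> ('i::finite) rep \<Rightarrow> weight \<Rightarrow> complex^'i \<Rightarrow> bool"
  where "highest_weight_vector r q X \<mu> v \<longleftrightarrow>
    weight_vector r q X \<mu> v \<and> (\<forall>i\<in>{1..r}. X (GE i) *v v = 0)"

definition lowest_weight_vector :: "nat \<Rightarrow> real \<Rightarrow> ('i::finite) rep \<Rightarrow> weight \<Rightarrow> complex^'i \<Rightarrow> bool"
  where "lowest_weight_vector r q X \<mu> v \<longleftrightarrow>
    weight_vector r q X \<mu> v \<and> (\<forall>i\<in>{1..r}. X (GF i) *v v = 0)"

definition type1 :: "nat \<Rightarrow> real \<Rightarrow> ('i::finite) rep \<Rightarrow> bool"
  where "type1 r q X \<longleftrightarrow> vec.span {v. \<exists>\<mu>. weight_vector r q X \<mu> v} = UNIV"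

definition simple_rep :: "nat \<Rightarrow> ('i::finite) rep \<Rightarrow> bool"
  where "simple_rep r X \<longleftrightarrow>
    (\<forall>U. vec.subspace U \<and> (\<forall>g\<in>gens r. \<forall>v\<in>U. X g *v v \<in> U) \<longrightarrow> U = {0} \<or> U = UNIV)"

definition simple_module :: "nat \<Rightarrow> real \<Rightarrow> ('i::finite) rep \<Rightarrow> weight \<Rightarrow> bool"
  where "simple_module r q X \<mu> \<longleftrightarrow> uq_module r q X \<and> type1 r q X \<and> simple_rep r X \<and>
    (\<exists>v. highest_weight_vector r q X \<mu> v)"

definition weight_basis :: "nat \<Rightarrow> real \<Rightarrow> ('i::finite) rep \<Rightarrow> ('i \<Rightarrow> weight) \<Rightarrow> bool"
  where "weight_basis r q X wt \<longleftrightarrow> (\<forall>i. weight_vector r q X (wt i) (axis i 1))"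

definition kron :: "complex^('a::finite)^('c::finite) \<Rightarrow> complex^('b::finite)^('d::finite)
    \<Rightarrow> complex^('a \<times> 'b)^('c \<times> 'd)"
  where "kron A B = (\<chi> x y. A $ fst x $ fst y * B $ snd x $ snd y)"

definition tensor_vec :: "complex^('a::finite) \<Rightarrow> complex^('b::finite) \<Rightarrow> complex^('a \<times> 'b)"
  where "tensor_vec v u = (\<chi> x. v $ fst x * u $ snd x)"

text \<open>Coproduct: \<open>E \<mapsto> E \<otimes> K + 1 \<otimes> E\<close>, \<open>F \<mapsto> F \<otimes> 1 + K\<^sup>-\<^sup>1 \<otimes> F\<close>.\<close>

fun tensor_rep :: "('a::finite) rep \<Rightarrow> ('b::finite) rep \<Rightarrow> ('a \<times> 'b) rep"
  where
    "tensor_rep X Y (GK i) = kron (X (GK i)) (Y (GK i))"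
  | "tensor_rep X Y (GKinv i) = kron (X (GKinv i)) (Y (GKinv i))"
  | "tensor_rep X Y (GE i) = kron (X (GE i)) (Y (GK i)) + kron (mat 1) (Y (GE i))"
  | "tensor_rep X Y (GF i) = kron (X (GF i)) (mat 1) + kron (X (GKinv i)) (Y (GF i))"

text \<open>
  The coproduct forces the antipode \<open>S(E) = - E K\<^sup>-\<^sup>1\<close>, \<open>S(F) = - K F\<close>; in the dual basis
  the generator \<open>g\<close> acts by the transpose of the matrix of \<open>S(g)\<close>.
\<close>

fun dual_rep :: "('a::finite) rep \<Rightarrow> 'a rep"
  where
    "dual_rep X (GK i) = transpose (X (GKinv i))"
  | "dual_rep X (GKinv i) = transpose (X (GK i))"
  | "dual_rep X (GE i) = transpose (- (X (GE i) ** X (GKinv i)))"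
  | "dual_rep X (GF i) = transpose (- (X (GK i) ** X (GF i)))"

text \<open>
  The braiding of two simple type 1 modules, as a matrix from \<open>X \<otimes> Y\<close> to \<open>Y \<otimes> X\<close>.
  Being a module map, it is determined by its value on the vector \<open>v \<otimes> u\<close> below.
\<close>

definition is_braiding :: "nat \<Rightarrow> real \<Rightarrow> ('a::finite) rep \<Rightarrow> ('b::finite) rep
    \<Rightarrow> complex^('a \<times> 'b)^('b \<times> 'a) \<Rightarrow> bool"
  where "is_braiding r q X Y R \<longleftrightarrow>
    (\<forall>g\<in>gens r. R ** tensor_rep X Y g = tensor_rep Y X g ** R) \<and>
    (\<forall>\<mu> \<nu> \<nu>' v u u'. highest_weight_vector r q X \<mu> v \<and> highest_weight_vector r q Y \<nu> u' \<and>
        lowest_weight_vector r q Y \<nu>' u \<longrightarrow>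
      R *v tensor_vec v u = (q powr wform r \<mu> (weyl_w0 r \<nu>)) *\<^sub>R tensor_vec u v)"


section \<open>Families and maps acting on tensor legs\<close>

text \<open>
  A family with \<open>n\<close> legs is a function on index lists of length \<open>n\<close>; its value at
  \<open>[i, j, k, l]\<close> is the coefficient of \<open>v\<^sub>i \<otimes> f\<^sup>j \<otimes> v\<^sub>k \<otimes> f\<^sup>l\<close>. Values at lists of other
  lengths are irrelevant. Legs are numbered from 1, whereas list positions start at 0.
\<close>

type_synonym ('n, 'm) family = "'n list \<Rightarrow> 'm"

definition fam :: "('n \<Rightarrow> 'n \<Rightarrow> 'm) \<Rightarrow> ('n, 'm) family"
  where "fam x I = x (I ! 0) (I ! 1)"

definition fprod :: "('a \<Rightarrow> 'b \<Rightarrow> 'c) \<Rightarrow> ('n, 'a) family \<Rightarrow> ('n, 'b) family \<Rightarrow> ('n, 'c) family"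
  where "fprod f x y I = f (x (take 2 I)) (y (drop 2 I))"

text \<open>The map with matrix \<open>A\<close> acting on the legs \<open>k\<close>, \<open>k + 1\<close>.\<close>

definition leg :: "nat \<Rightarrow> complex^('n \<times> 'n)^('n \<times> 'n) \<Rightarrow> ('n::finite, 'm::complex_vector) family
    \<Rightarrow> ('n, 'm) family"
  where "leg k A x I =
    (\<Sum>(i, j)\<in>UNIV. (A $ (I ! (k - 1), I ! k) $ (i, j)) *\<^sub>C x (I[k - 1 := i, k := j]))"

definition qc :: "real \<Rightarrow> real \<Rightarrow> complex"
  where "qc q x = complex_of_real (q powr x)"

text \<open>Contraction of the legs \<open>k\<close>, \<open>k + 1\<close> by \<open>E\<close> and by \<open>E'\<close>.\<close>

definition contr :: "nat \<Rightarrow> ('n::finite, 'm::complex_vector) family \<Rightarrow> ('n, 'm) family"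
  where "contr k x I = (\<Sum>i\<in>UNIV. x (take (k - 1) I @ [i, i] @ drop (k - 1) I))"

definition contr' :: "nat \<Rightarrow> real \<Rightarrow> ('n \<Rightarrow> weight) \<Rightarrow> nat
    \<Rightarrow> ('n::finite, 'm::complex_vector) family \<Rightarrow> ('n, 'm) family"
  where "contr' r q wt k x I =
    (\<Sum>i\<in>UNIV. qc q (wform r (wt i) (two_rho r)) *\<^sub>C x (take (k - 1) I @ [i, i] @ drop (k - 1) I))"

text \<open>
  In the following \<open>Rvv\<close>, \<open>Rvd\<close>, \<open>Rdd\<close> are the braidings of \<open>V \<otimes> V\<close>, \<open>V \<otimes> V\<^sup>*\<close>, \<open>V\<^sup>* \<otimes> V\<^sup>*\<close>.
\<close>

definition S123 :: "complex^('n \<times> 'n)^('n \<times> 'n) \<Rightarrow> complex^('n \<times> 'n)^('n \<times> 'n)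
    \<Rightarrow> ('n::finite, 'm::complex_vector) family \<Rightarrow> ('n, 'm) family"
  where "S123 Rvv Rvd = leg 2 Rvd \<circ> leg 1 Rvv \<circ> leg 2 (matrix_inv Rvd)"

definition St234 :: "complex^('n \<times> 'n)^('n \<times> 'n) \<Rightarrow> complex^('n \<times> 'n)^('n \<times> 'n)
    \<Rightarrow> ('n::finite, 'm::complex_vector) family \<Rightarrow> ('n, 'm) family"
  where "St234 Rvd Rdd = leg 2 Rvd \<circ> leg 3 (matrix_inv Rdd) \<circ> leg 2 (matrix_inv Rvd)"

definition T1234 :: "complex^('n \<times> 'n)^('n \<times> 'n) \<Rightarrow> complex^('n \<times> 'n)^('n \<times> 'n)
    \<Rightarrow> complex^('n \<times> 'n)^('n \<times> 'n) \<Rightarrow> ('n::finite, 'm::complex_vector) family \<Rightarrow> ('n, 'm) family"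
  where "T1234 Rvv Rvd Rdd = S123 Rvv Rvd \<circ> St234 Rvd Rdd"


section \<open>Bimodules and presentations\<close>

record ('b, 'm) bimod =
  lact :: "'b \<Rightarrow> 'm \<Rightarrow> 'm"
  ract :: "'m \<Rightarrow> 'b \<Rightarrow> 'm"

locale bimodule =
  fixes M :: "('b::complex_algebra_1, 'm::complex_vector) bimod"
  assumes lact_add_left: "lact M (a + b) x = lact M a x + lact M b x"
    and lact_add_right: "lact M a (x + y) = lact M a x + lact M a y"
    and lact_scaleC_left: "lact M (c *\<^sub>C a) x = c *\<^sub>C lact M a x"
    and lact_scaleC_right: "lact M a (c *\<^sub>C x) = c *\<^sub>C lact M a x"
    and lact_mult: "lact M (a * b) x = lact M a (lact M b x)"
    and lact_one: "lact M 1 x = x"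
    and ract_add_left: "ract M (x + y) a = ract M x a + ract M y a"
    and ract_add_right: "ract M x (a + b) = ract M x a + ract M x b"
    and ract_scaleC_left: "ract M (c *\<^sub>C x) a = c *\<^sub>C ract M x a"
    and ract_scaleC_right: "ract M x (c *\<^sub>C a) = c *\<^sub>C ract M x a"
    and ract_mult: "ract M x (a * b) = ract M (ract M x a) b"
    and ract_one: "ract M x 1 = x"
    and lact_ract: "ract M (lact M a x) b = lact M a (ract M x b)"

definition direct_sum :: "('b, 'x) bimod \<Rightarrow> ('b, 'y) bimod \<Rightarrow> ('b, 'x \<times> 'y) bimod"
  where "direct_sum M N = \<lparr>lact = (\<lambda>b z. (lact M b (fst z), lact N b (snd z))),
    ract = (\<lambda>z b. (ract M (fst z) b, ract N (snd z) b))\<rparr>"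

definition bimodule_map :: "('b, 'm::complex_vector) bimod \<Rightarrow> ('b, 'n::complex_vector) bimod
    \<Rightarrow> ('m \<Rightarrow> 'n) \<Rightarrow> bool"
  where "bimodule_map M N f \<longleftrightarrow> clinear f \<and>
    (\<forall>b x. f (lact M b x) = lact N b (f x)) \<and> (\<forall>b x. f (ract M x b) = ract N (f x) b)"

text \<open>
  The linear map \<open>f\<close> exhibits its codomain as the quotient of its domain by \<open>N\<close>.
  The submodules \<open>N\<close> used below are generated by relators, by means of \<^const>\<open>hull\<close>.
\<close>

definition is_quotient :: "('a::zero \<Rightarrow> 'b::zero) \<Rightarrow> 'a set \<Rightarrow> bool"
  where "is_quotient f N \<longleftrightarrow> surj f \<and> {x. f x = 0} = N"

definition two_sided_ideal :: "('a::ring_1) set \<Rightarrow> bool"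
  where "two_sided_ideal N \<longleftrightarrow> 0 \<in> N \<and> (\<forall>x\<in>N. \<forall>y\<in>N. x + y \<in> N) \<and>
    (\<forall>a. \<forall>x\<in>N. a * x \<in> N \<and> x * a \<in> N)"

definition left_submodule :: "('b \<Rightarrow> 'm \<Rightarrow> 'm::ab_group_add) \<Rightarrow> 'm set \<Rightarrow> bool"
  where "left_submodule act N \<longleftrightarrow> 0 \<in> N \<and> (\<forall>x\<in>N. \<forall>y\<in>N. x + y \<in> N) \<and> (\<forall>b. \<forall>x\<in>N. act b x \<in> N)"

definition sub_bimodule :: "('b, 'm::ab_group_add) bimod \<Rightarrow> 'm set \<Rightarrow> bool"
  where "sub_bimodule M N \<longleftrightarrow> 0 \<in> N \<and> (\<forall>x\<in>N. \<forall>y\<in>N. x + y \<in> N) \<and>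
    (\<forall>b. \<forall>x\<in>N. lact M b x \<in> N \<and> ract M x b \<in> N)"

text \<open>
  The free algebra on a set of generators is the monoid algebra of the free monoid, i.e. of
  \<open>'g word\<close> with concatenation written additively as required by \<^type>\<open>poly_mapping\<close>.
\<close>

datatype 'g word = Word (letters: "'g list")

instantiation word :: (type) monoid_add
begin
definition zero_word :: "'a word" where "zero_word = Word []"
definition plus_word :: "'a word \<Rightarrow> 'a word \<Rightarrow> 'a word"
  where "plus_word x y = Word (letters x @ letters y)"
instance by standard (simp_all add: zero_word_def plus_word_def)
end

type_synonym 'g free_algebra = "'g word \<Rightarrow>\<^sub>0 complex"

definition free_gen :: "'g \<Rightarrow> 'g free_algebra"
  where "free_gen g = Poly_Mapping.single (Word [g]) 1"

definition eval_free :: "('g \<Rightarrow> 'b::complex_algebra_1) \<Rightarrow> 'g free_algebra \<Rightarrow> 'b"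
  where "eval_free \<phi> f =
    (\<Sum>w\<in>Poly_Mapping.keys f. Poly_Mapping.lookup f w *\<^sub>C prod_list (map \<phi> (letters w)))"

definition algebra_presentation :: "('g \<Rightarrow> 'b::complex_algebra_1) \<Rightarrow> 'g free_algebra set \<Rightarrow> bool"
  where "algebra_presentation \<phi> Rel \<longleftrightarrow> is_quotient (eval_free \<phi>) (two_sided_ideal hull Rel)"

text \<open>The free left module on \<open>'g\<close> is \<^typ>\<open>'g \<Rightarrow>\<^sub>0 'b\<close>.\<close>

definition free_lact :: "'b::ring_1 \<Rightarrow> ('g \<Rightarrow>\<^sub>0 'b) \<Rightarrow> 'g \<Rightarrow>\<^sub>0 'b"
  where "free_lact b = Poly_Mapping.map ((*) b)"

definition eval_free_module :: "('b::ring_1 \<Rightarrow> 'm \<Rightarrow> 'm::ab_group_add) \<Rightarrow> ('g \<Rightarrow> 'm) \<Rightarrow> ('g \<Rightarrow>\<^sub>0 'b) \<Rightarrow> 'm"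
  where "eval_free_module act \<phi> f = (\<Sum>g\<in>Poly_Mapping.keys f. act (Poly_Mapping.lookup f g) (\<phi> g))"

definition left_module_presentation :: "('b::ring_1 \<Rightarrow> 'm \<Rightarrow> 'm::ab_group_add) \<Rightarrow> ('g \<Rightarrow> 'm)
    \<Rightarrow> ('g \<Rightarrow>\<^sub>0 'b) set \<Rightarrow> bool"
  where "left_module_presentation act \<phi> Rel \<longleftrightarrow>
    is_quotient (eval_free_module act \<phi>) (left_submodule free_lact hull Rel)"

text \<open>
  The tensor product over the algebra, as the quotient of the complex vector space freely
  spanned by the symbols \<open>(x, y)\<close>.
\<close>

definition tensor_relators :: "('b::complex_algebra_1, 'm::complex_vector) bimod \<Rightarrow> ('b, 'n::complex_vector) bimod
    \<Rightarrow> ('m \<times> 'n \<Rightarrow>\<^sub>0 complex) set"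
  where "tensor_relators M N = (let e = (\<lambda>x y. Poly_Mapping.single (x, y) 1) in
    {e (x + x') y - e x y - e x' y | x x' y. True} \<union>
    {e x (y + y') - e x y - e x y' | x y y'. True} \<union>
    {e (c *\<^sub>C x) y - c *\<^sub>C e x y | c x y. True} \<union>
    {e x (c *\<^sub>C y) - c *\<^sub>C e x y | c x y. True} \<union>
    {e (ract M x b) y - e x (lact N b y) | x b y. True})"

definition is_tensor_product :: "('b::complex_algebra_1, 'm::complex_vector) bimod
    \<Rightarrow> ('b, 'n::complex_vector) bimod \<Rightarrow> ('b, 't::complex_vector) bimod \<Rightarrow> ('m \<Rightarrow> 'n \<Rightarrow> 't) \<Rightarrow> bool"
  where "is_tensor_product M N T tens \<longleftrightarrow> bimodule T \<and>
    is_quotient (eval_free_module scaleC (\<lambda>z. tens (fst z) (snd z)))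
      (cvec.subspace hull tensor_relators M N) \<and>
    (\<forall>b x y. lact T b (tens x y) = tens (lact M b x) y) \<and>
    (\<forall>b x y. ract T (tens x y) b = tens x (ract N y b))"

text \<open>The linear map on the tensor product induced by a balanced bilinear map.\<close>

definition tensor_lift :: "('m \<Rightarrow> 'n \<Rightarrow> 't::complex_vector) \<Rightarrow> ('m \<Rightarrow> 'n \<Rightarrow> 'u::complex_vector) \<Rightarrow> 't \<Rightarrow> 'u"
  where "tensor_lift tens \<beta> = (THE f. clinear f \<and> (\<forall>x y. f (tens x y) = \<beta> x y))"


section \<open>Quantum projective space and its calculus\<close>

text \<open>
  The family relations below are between families with the four legs \<open>V, V\<^sup>*, V, V\<^sup>*\<close> (index
  lists of length 4) or, after a contraction, without legs (the empty index list).
\<close>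

definition algebra_relators :: "nat \<Rightarrow> nat \<Rightarrow> real \<Rightarrow> ('n \<Rightarrow> weight)
    \<Rightarrow> complex^('n \<times> 'n)^('n \<times> 'n) \<Rightarrow> complex^('n \<times> 'n)^('n \<times> 'n) \<Rightarrow> complex^('n \<times> 'n)^('n \<times> 'n)
    \<Rightarrow> ('n::finite \<times> 'n) free_algebra set"
  where "algebra_relators r s q wt Rvv Rvd Rdd = (let p = fam (\<lambda>i j. free_gen (i, j)); pp = fprod (*) p p in
    {S123 Rvv Rvd pp I - qc q (const_w r s) *\<^sub>C pp I | I. length I = 4} \<union>
    {St234 Rvd Rdd pp I - qc q (- const_w r s) *\<^sub>C pp I | I. length I = 4} \<union>
    {contr' r q wt 1 p [] - qc q (const_m r s) *\<^sub>C 1})"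

definition projective_space_algebra :: "nat \<Rightarrow> nat \<Rightarrow> real \<Rightarrow> ('n \<Rightarrow> weight)
    \<Rightarrow> complex^('n \<times> 'n)^('n \<times> 'n) \<Rightarrow> complex^('n \<times> 'n)^('n \<times> 'n) \<Rightarrow> complex^('n \<times> 'n)^('n \<times> 'n)
    \<Rightarrow> ('n::finite \<Rightarrow> 'n \<Rightarrow> 'b::complex_algebra_1) \<Rightarrow> bool"
  where "projective_space_algebra r s q wt Rvv Rvd Rdd p \<longleftrightarrow>
    algebra_presentation (\<lambda>(i, j). p i j) (algebra_relators r s q wt Rvv Rvd Rdd)"

definition derivation :: "('b::complex_algebra_1, 'm::complex_vector) bimod \<Rightarrow> ('b \<Rightarrow> 'm) \<Rightarrow> bool"
  where "derivation M D \<longleftrightarrow> clinear D \<and> (\<forall>a b. D (a * b) = ract M (D a) b + lact M a (D b))"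

definition del_relators :: "nat \<Rightarrow> nat \<Rightarrow> real \<Rightarrow> ('n \<Rightarrow> weight)
    \<Rightarrow> complex^('n \<times> 'n)^('n \<times> 'n) \<Rightarrow> complex^('n \<times> 'n)^('n \<times> 'n)
    \<Rightarrow> ('n::finite \<Rightarrow> 'n \<Rightarrow> 'b::complex_algebra_1) \<Rightarrow> ('n \<times> 'n \<Rightarrow>\<^sub>0 'b) set"
  where "del_relators r s q wt Rvd Rdd p =
    (let e = fam (\<lambda>i j. Poly_Mapping.single (i, j) 1); pe = fprod free_lact (fam p) e in
    {St234 Rvd Rdd pe I - qc q (- const_w r s) *\<^sub>C pe I | I. length I = 4} \<union>
    {contr' r q wt 1 e []})"

definition delbar_relators :: "nat \<Rightarrow> nat \<Rightarrow> real \<Rightarrow> ('n \<Rightarrow> weight)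
    \<Rightarrow> complex^('n \<times> 'n)^('n \<times> 'n) \<Rightarrow> complex^('n \<times> 'n)^('n \<times> 'n)
    \<Rightarrow> ('n::finite \<Rightarrow> 'n \<Rightarrow> 'b::complex_algebra_1) \<Rightarrow> ('n \<times> 'n \<Rightarrow>\<^sub>0 'b) set"
  where "delbar_relators r s q wt Rvv Rvd p =
    (let e = fam (\<lambda>i j. Poly_Mapping.single (i, j) 1); pe = fprod free_lact (fam p) e in
    {S123 Rvv Rvd pe I - qc q (const_w r s) *\<^sub>C pe I | I. length I = 4} \<union>
    {contr' r q wt 1 e []})"

text \<open>
  The Heckenberger--Kolb calculus: bimodules \<open>Op\<close>, \<open>Om\<close> (holomorphic and antiholomorphic
  one-forms) with derivations \<open>del\<close>, \<open>delbar\<close>. The left modules are presented on the generators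
  \<open>del (p i j)\<close>, \<open>delbar (p i j)\<close>; the right module structures are then determined by the
  stated commutation rules.
\<close>

definition hk_calculus :: "nat \<Rightarrow> nat \<Rightarrow> real \<Rightarrow> ('n \<Rightarrow> weight)
    \<Rightarrow> complex^('n \<times> 'n)^('n \<times> 'n) \<Rightarrow> complex^('n \<times> 'n)^('n \<times> 'n) \<Rightarrow> complex^('n \<times> 'n)^('n \<times> 'n)
    \<Rightarrow> ('n::finite \<Rightarrow> 'n \<Rightarrow> 'b::complex_algebra_1)
    \<Rightarrow> ('b, 'x::complex_vector) bimod \<Rightarrow> ('b, 'y::complex_vector) bimod
    \<Rightarrow> ('b \<Rightarrow> 'x) \<Rightarrow> ('b \<Rightarrow> 'y) \<Rightarrow> bool"
  where "hk_calculus r s q wt Rvv Rvd Rdd p Op Om del delbar \<longleftrightarrow>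
    bimodule Op \<and> bimodule Om \<and> derivation Op del \<and> derivation Om delbar \<and>
    left_module_presentation (lact Op) (\<lambda>(i, j). del (p i j)) (del_relators r s q wt Rvd Rdd p) \<and>
    left_module_presentation (lact Om) (\<lambda>(i, j). delbar (p i j)) (delbar_relators r s q wt Rvv Rvd p) \<and>
    (\<forall>I. length I = 4 \<longrightarrow>
      fprod (ract Op) (fam (\<lambda>i j. del (p i j))) (fam p) I =
        qc q (const_a r s) *\<^sub>C
          T1234 Rvv Rvd Rdd (fprod (lact Op) (fam p) (fam (\<lambda>i j. del (p i j)))) I) \<and>
    (\<forall>I. length I = 4 \<longrightarrow>
      fprod (ract Om) (fam (\<lambda>i j. delbar (p i j))) (fam p) I =
        qc q (- const_a r s) *\<^sub>C
          T1234 Rvv Rvd Rdd (fprod (lact Om) (fam p) (fam (\<lambda>i j. delbar (p i j)))) I)"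

definition total_diff :: "('b \<Rightarrow> 'x) \<Rightarrow> ('b \<Rightarrow> 'y) \<Rightarrow> 'b \<Rightarrow> 'x \<times> 'y"
  where "total_diff del delbar b = (del b, delbar b)"

text \<open>
  The part of degree two of the universal differential calculus. Its relations are generated
  in degree two, so it is the quotient of \<open>T = \<Omega> \<otimes> \<Omega>\<close> (the degree two part of the tensor
  algebra) by the sub-bimodule generated by the relators. The quotient map
  \<open>wedge\<close> sends \<open>x \<otimes> y\<close> to the product of \<open>x\<close> and \<open>y\<close>; \<open>d2\<close> is the differential on \<open>\<Omega>\<close>.
\<close>

definition universal_two_forms :: "('b::complex_algebra_1, 'o::complex_vector) bimod \<Rightarrow> ('b \<Rightarrow> 'o)
    \<Rightarrow> ('b, 't::complex_vector) bimod \<Rightarrow> ('o \<Rightarrow> 'o \<Rightarrow> 't)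
    \<Rightarrow> ('b, 'w::complex_vector) bimod \<Rightarrow> ('t \<Rightarrow> 'w) \<Rightarrow> ('o \<Rightarrow> 'w) \<Rightarrow> bool"
  where "universal_two_forms Om1 d T tens W wedge d2 \<longleftrightarrow>
    bimodule W \<and> bimodule_map T W wedge \<and>
    is_quotient wedge (sub_bimodule T hull
      {\<Sum>k<n. tens (d (a k)) (d (b k)) | (n::nat) a b. (\<Sum>k<n. lact Om1 (a k) (d (b k))) = 0}) \<and>
    clinear d2 \<and> (\<forall>a b. d2 (lact Om1 a (d b)) = wedge (tens (d a) (d b)))"

text \<open>
  In the following \<open>dp\<close>, \<open>dbp\<close> stand for the families of the forms \<open>del (p i j)\<close>, \<open>delbar (p i j)\<close>,
  embedded in the direct sum.
\<close>

definition metric_pm :: "nat \<Rightarrow> real \<Rightarrow> ('n \<Rightarrow> weight) \<Rightarrow> ('o \<Rightarrow> 'o \<Rightarrow> 't::complex_vector)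
    \<Rightarrow> ('n::finite, 'o) family \<Rightarrow> ('n, 'o) family \<Rightarrow> 't"
  where "metric_pm r q wt tens dp dbp = contr' r q wt 1 (contr 2 (fprod tens dp dbp)) []"

definition metric_mp :: "nat \<Rightarrow> real \<Rightarrow> ('n \<Rightarrow> weight) \<Rightarrow> ('o \<Rightarrow> 'o \<Rightarrow> 't::complex_vector)
    \<Rightarrow> ('n::finite, 'o) family \<Rightarrow> ('n, 'o) family \<Rightarrow> 't"
  where "metric_mp r q wt tens dp dbp = contr' r q wt 1 (contr 2 (fprod tens dbp dp)) []"

definition levi_civita :: "nat \<Rightarrow> nat \<Rightarrow> real \<Rightarrow> ('n \<Rightarrow> weight)
    \<Rightarrow> complex^('n \<times> 'n)^('n \<times> 'n) \<Rightarrow> complex^('n \<times> 'n)^('n \<times> 'n) \<Rightarrow> complex^('n \<times> 'n)^('n \<times> 'n)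
    \<Rightarrow> ('n::finite \<Rightarrow> 'n \<Rightarrow> 'b::complex_algebra_1)
    \<Rightarrow> ('b, 'x::complex_vector) bimod \<Rightarrow> ('b, 'y::complex_vector) bimod
    \<Rightarrow> ('b \<Rightarrow> 'x) \<Rightarrow> ('b \<Rightarrow> 'y)
    \<Rightarrow> ('b, 't::complex_vector) bimod \<Rightarrow> ('x \<times> 'y \<Rightarrow> 'x \<times> 'y \<Rightarrow> 't) \<Rightarrow> ('x \<times> 'y \<Rightarrow> 't) \<Rightarrow> bool"
  where "levi_civita r s q wt Rvv Rvd Rdd p Op Om del delbar T tens nabla \<longleftrightarrow>
    (let dp = fam (\<lambda>i j. (del (p i j), 0)); dbp = fam (\<lambda>i j. (0, delbar (p i j))) in
    clinear nabla \<and>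
    (\<forall>b x. nabla (lact (direct_sum Op Om) b x) = tens (total_diff del delbar b) x + lact T b (nabla x)) \<and>
    (\<forall>i j. nabla (dp [i, j]) =
      qc q (const_a r s) *\<^sub>C contr 2 (T1234 Rvv Rvd Rdd (fprod tens dbp dp)) [i, j]
      - (qc q (const_a r s) * qc q (- const_m r s)) *\<^sub>C lact T (p i j) (metric_mp r q wt tens dp dbp)) \<and>
    (\<forall>i j. nabla (dbp [i, j]) =
      contr 2 (fprod tens dp dbp) [i, j]
      - qc q (- const_m r s) *\<^sub>C lact T (p i j) (metric_pm r q wt tens dp dbp)))"

text \<open>
  The summands \<open>d \<otimes> id\<close> and \<open>(\<and> \<otimes> id) (id \<otimes> \<nabla>)\<close> are not balanced separately, only their
  difference descends to \<open>\<Omega> \<otimes> \<Omega>\<close>. The inner lift is the map \<open>y \<otimes> z \<mapsto> (x \<and> y) \<otimes> z\<close>.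
\<close>

definition riemann :: "('o \<Rightarrow> 'o \<Rightarrow> 't::complex_vector) \<Rightarrow> ('t \<Rightarrow> 'w) \<Rightarrow> ('o \<Rightarrow> 'w)
    \<Rightarrow> ('w \<Rightarrow> 'o \<Rightarrow> 'u::complex_vector) \<Rightarrow> ('o \<Rightarrow> 't) \<Rightarrow> 'o \<Rightarrow> 'u"
  where "riemann tens wedge d2 tens2 nabla = (\<lambda>\<omega>.
    tensor_lift tens (\<lambda>x \<eta>. tens2 (d2 x) \<eta>
      - tensor_lift tens (\<lambda>y z. tens2 (wedge (tens x y)) z) (nabla \<eta>)) (nabla \<omega>))"

end

theory Submission
  imports Defs
begin

text \<open>
The Riemann tensor \<open>R\<close> of any connection of this kind is left linear, so it is enough to show
\<open>R(A p) = R(A) p\<close> for the two families \<open>A\<close> of generating forms, \<open>\<partial>p\<close> and \<open>\<partial>'p\<close>. Here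
\<open>\<partial>\<close> and \<open>\<partial>'\<close> are the two parts of the differential, with values in the two summands of the one-forms.

Say that a family \<open>A = (A\<^sup>i\<^sup>j)\<close> of elements of a bimodule has weight \<open>\<alpha>\<close> if \<open>A p = \<alpha> T p A\<close>. The relations say that
\<open>p\<close>, \<open>\<partial>p\<close> and \<open>\<partial>'p\<close> have the weights \<open>1\<close>, \<open>q\<^sup>a\<close> and \<open>q\<^sup>-\<^sup>a\<close>. If \<open>A\<close> has weight \<open>\<alpha>\<close>, then left linearity gives
\<open>R(A p) = \<alpha> T p R(A)\<close>, so what has to be shown is that \<open>R(A)\<close> has the same weight as \<open>A\<close> (\<open>Riem_ract_family\<close>).

Weights are easy to compute with. The map \<open>T\<close> moves a pair of legs past another pair, satisfies the braid relation
(\<open>T_braid\<close>) and is compatible with the evaluations (\<open>E_T_T\<close>, \<open>E'_T\<close>). Therefore weights multiply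
under the matrix product \<open>E\<^sub>2\<^sub>3\<close> and under its braided version \<open>E\<^sub>2\<^sub>3 T\<close> (\<open>wt_mprod\<close>, \<open>wt_bprod\<close>). Since the q-trace of \<open>p\<close>
is a nonzero scalar, the q-trace of a family of weight other than \<open>1\<close> vanishes (\<open>swt_eq_0\<close>), and families of different weights
are linearly independent (\<open>wt_split\<close>).

The relations of the calculus imply \<open>p\<^sup>2 = p\<close>, \<open>p \<partial>p = 0\<close> and \<open>p \<partial>'p = \<partial>'p\<close>. Hence \<open>\<partial>p = dp - p dp\<close>, whose differential is
\<open>- (\<partial>p \<and> \<partial>'p + \<partial>'p \<and> \<partial>p)\<close>, of weight \<open>1\<close>. In the curvature, the contributions of the metric components are q-traces
of families of weights \<open>q\<^sup>a\<close> and \<open>q\<^sup>-\<^sup>a\<close> and vanish, apart from those where the coefficient \<open>p\<close> in front of them is differentiated.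
What is left shows that \<open>R(\<partial>'p)\<close> has weight \<open>q\<^sup>-\<^sup>a\<close>, and that \<open>R(\<partial>p)\<close> is a sum
of a family \<open>G\<close> of weight \<open>q\<^sup>a\<close> and a family \<open>U\<close> of weight \<open>q\<^sup>-\<^sup>a\<close>. But \<open>\<partial>p = \<partial>p p = q\<^sup>a E\<^sub>2\<^sub>3 T p \<partial>p\<close>, and left linearity
of \<open>R\<close> transports this relation to \<open>R(\<partial>p)\<close>; comparing the parts of weight \<open>q\<^sup>-\<^sup>a\<close> shows that \<open>U p\<close> is a multiple of \<open>U\<close>
by a number other than \<open>0\<close> and \<open>1\<close>, whence \<open>U = 0\<close> as \<open>p\<close> is idempotent (\<open>U_eq_0\<close>).

What this needs of the quantum group is that the braidings of \<open>V\<close> and \<open>V\<^sup>*\<close> satisfy the braid relation and arise from each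
other by rotation along the evaluations (\<open>braiding_data\<close>). A general theory of the braiding is avoided by computing it. The
module with highest weight \<open>\<omega>\<^sub>s\<close> is recognised from its weights as the vector representation (\<open>vector_module_exists\<close>).
A module map on a tensor product is determined by its value at a highest weight vector tensored with a lowest weight vector. So the
braiding of \<open>V\<close> with itself is the explicit Hecke matrix, and the braidings that involve \<open>V\<^sup>*\<close> are its rotations, because
rotations of module maps are module maps (\<open>braidings_of_vector_module\<close>).
\<close>

section \<open>Maps acting on tensor legs\<close>

text \<open>The components of a tensor with values in \<open>'m\<close> are a function of the indices of its legs. Numbering
the legs by all natural numbers makes maps on different legs act on one and the same space, so
that they can be composed and commuted without counting legs; legs that are not there are legs on which
nothing depends.\<close>
definition on_legs :: "nat \<Rightarrow> complex^('n \<times> 'n)^('n \<times> 'n) \<Rightarrow> ((nat \<Rightarrow> 'n::finite) \<Rightarrow> 'm::complex_vector)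
    \<Rightarrow> (nat \<Rightarrow> 'n) \<Rightarrow> 'm"
  where "on_legs k A x f =
    (\<Sum>i\<in>UNIV. \<Sum>j\<in>UNIV. (A $ (f k, f (Suc k)) $ (i, j)) *\<^sub>C x (f(k := i, Suc k := j)))"

text \<open>Contracting two neighbouring legs means summing over tensors in which both carry the same index \<open>i\<close>:
these are the legs that \<open>graft\<close> inserts. With weight \<open>1\<close> the contraction is \<open>E\<close>, with weight
\<open>q\<close> to the power \<open>(\<lambda>\<^sub>i, 2\<rho>)\<close> it is \<open>E'\<close>.\<close>
definition graft :: "nat \<Rightarrow> 'n \<Rightarrow> (nat \<Rightarrow> 'n) \<Rightarrow> nat \<Rightarrow> 'n"
  where "graft k i f = (\<lambda>n. if n < k then f n else if n < k + 2 then i else f (n - 2))"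

definition cap :: "('n \<Rightarrow> complex) \<Rightarrow> nat \<Rightarrow> ((nat \<Rightarrow> 'n::finite) \<Rightarrow> 'm::complex_vector) \<Rightarrow> (nat \<Rightarrow> 'n) \<Rightarrow> 'm"
  where "cap \<kappa> k x f = (\<Sum>i\<in>UNIV. \<kappa> i *\<^sub>C x (graft k i f))"

lemma scaleC_sum_right: "c *\<^sub>C (\<Sum>i\<in>I. g i) = (\<Sum>i\<in>I. c *\<^sub>C g i)"
  by (rule cvec.scale_sum_right)

lemma sum_delta_scaleC:
  "(\<Sum>i\<in>(UNIV::'n::finite set). (if i = a then 1 else 0) *\<^sub>C (x i :: 'm::complex_vector)) = x a"
  "(\<Sum>i\<in>(UNIV::'n::finite set). (if a = i then 1 else 0) *\<^sub>C (x i :: 'm::complex_vector)) = x a"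
proof -
  have "(\<Sum>i\<in>UNIV. (if i = a then 1 else 0) *\<^sub>C x i) = (\<Sum>i\<in>UNIV. if i = a then x i else 0)"
    by (rule sum.cong) (auto simp: scaleC_one)
  then show "(\<Sum>i\<in>(UNIV::'n::finite set). (if i = a then 1 else 0) *\<^sub>C (x i :: 'm::complex_vector)) = x a"
    by simp
  then show "(\<Sum>i\<in>(UNIV::'n::finite set). (if a = i then 1 else 0) *\<^sub>C (x i :: 'm::complex_vector)) = x a"
    by (simp add: eq_commute)
qed

lemma sum_UNIV_prod: "(\<Sum>z\<in>UNIV. g z) = (\<Sum>i\<in>UNIV. \<Sum>j\<in>UNIV. g (i, j))"
  by (simp add: sum.cartesian_product flip: UNIV_Times_UNIV)

lemma on_legs_mat_1: "on_legs k (mat 1) x = (x :: (nat \<Rightarrow> 'n::finite) \<Rightarrow> 'm::complex_vector)"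
proof (rule ext)
  fix f :: "nat \<Rightarrow> 'n"
  have "on_legs k (mat 1) x f = (\<Sum>i\<in>UNIV. \<Sum>j\<in>UNIV. (if f (Suc k) = j then 1 else 0) *\<^sub>C
      ((if f k = i then 1 else 0) *\<^sub>C x (f(k := i, Suc k := j))))"
    unfolding on_legs_def mat_def by (intro sum.cong refl) (auto simp: scaleC_one)
  then show "on_legs k (mat 1) x f = x f" by (simp add: sum_delta_scaleC del: cvec.scale_scale)
qed

lemma on_legs_on_legs: "on_legs k A (on_legs k B x) = on_legs k (A ** B) x"
proof (rule ext)
  fix f :: "nat \<Rightarrow> 'a"
  have "on_legs k A (on_legs k B x) f
    = (\<Sum>i\<in>UNIV. \<Sum>j\<in>UNIV. \<Sum>i'\<in>UNIV. \<Sum>j'\<in>UNIV.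
        (A $ (f k, f (Suc k)) $ (i, j) * B $ (i, j) $ (i', j')) *\<^sub>C x (f(k := i', Suc k := j')))"
    by (simp add: on_legs_def scaleC_sum_right scaleC_scaleC fun_upd_twist)
  also have "\<dots> = (\<Sum>z\<in>UNIV. \<Sum>z'\<in>UNIV.
        (A $ (f k, f (Suc k)) $ z * B $ z $ z') *\<^sub>C x (f(k := fst z', Suc k := snd z')))"
    by (simp add: sum_UNIV_prod)
  also have "\<dots> = (\<Sum>z'\<in>UNIV. (A ** B) $ (f k, f (Suc k)) $ z' *\<^sub>C x (f(k := fst z', Suc k := snd z')))"
    by (subst sum.swap) (simp add: matrix_matrix_mult_def cvec.scale_sum_left)
  also have "\<dots> = on_legs k (A ** B) x f"
    by (simp add: on_legs_def sum_UNIV_prod)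
  finally show "on_legs k A (on_legs k B x) f = on_legs k (A ** B) x f" .
qed

lemma on_legs_inverse:
  assumes "A ** B = mat 1"
  shows "on_legs k A (on_legs k B x) = x"
  by (simp add: on_legs_on_legs assms on_legs_mat_1)

lemma on_legs_commute:
  assumes "k + 2 \<le> l"
  shows "on_legs l A (on_legs k B x) = on_legs k B (on_legs l A x)"
proof (rule ext)
  fix f :: "nat \<Rightarrow> 'a"
  have u: "f(l := i, Suc l := j, k := i', Suc k := j') = f(k := i', Suc k := j', l := i, Suc l := j)" for i j i' j'
    using assms by (auto simp: fun_eq_iff)
  have "on_legs l A (on_legs k B x) f = (\<Sum>i\<in>UNIV. \<Sum>j\<in>UNIV. \<Sum>i'\<in>UNIV. \<Sum>j'\<in>UNIV.
      (A $ (f l, f (Suc l)) $ (i, j) * B $ (f k, f (Suc k)) $ (i', j')) *\<^sub>C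
        x (f(k := i', Suc k := j', l := i, Suc l := j)))"
    using assms by (simp add: on_legs_def scaleC_sum_right scaleC_scaleC u)
  also have "\<dots> = (\<Sum>i\<in>UNIV. \<Sum>i'\<in>UNIV. \<Sum>j\<in>UNIV. \<Sum>j'\<in>UNIV.
      (A $ (f l, f (Suc l)) $ (i, j) * B $ (f k, f (Suc k)) $ (i', j')) *\<^sub>C
        x (f(k := i', Suc k := j', l := i, Suc l := j)))"
    by (intro sum.cong refl sum.swap)
  also have "\<dots> = (\<Sum>i'\<in>UNIV. \<Sum>i\<in>UNIV. \<Sum>j'\<in>UNIV. \<Sum>j\<in>UNIV.
      (A $ (f l, f (Suc l)) $ (i, j) * B $ (f k, f (Suc k)) $ (i', j')) *\<^sub>C
        x (f(k := i', Suc k := j', l := i, Suc l := j)))"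
    by (subst sum.swap, intro sum.cong refl sum.swap)
  also have "\<dots> = (\<Sum>i'\<in>UNIV. \<Sum>j'\<in>UNIV. \<Sum>i\<in>UNIV. \<Sum>j\<in>UNIV.
      (A $ (f l, f (Suc l)) $ (i, j) * B $ (f k, f (Suc k)) $ (i', j')) *\<^sub>C
        x (f(k := i', Suc k := j', l := i, Suc l := j)))"
    by (intro sum.cong refl sum.swap)
  also have "\<dots> = on_legs k B (on_legs l A x) f"
    using assms by (simp add: on_legs_def scaleC_sum_right scaleC_scaleC mult.commute)
  finally show "on_legs l A (on_legs k B x) f = on_legs k B (on_legs l A x) f" .
qed

lemma cap_on_legs_below:
  assumes "l + 2 \<le> k"
  shows "cap \<kappa> k (on_legs l A x) = on_legs l A (cap \<kappa> k x)"
proof (rule ext)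
  fix f :: "nat \<Rightarrow> 'a"
  have u: "(graft k i f)(l := a, Suc l := b) = graft k i (f(l := a, Suc l := b))" for i a b
    using assms by (auto simp: fun_eq_iff graft_def)
  have v: "graft k i f l = f l" "graft k i f (Suc l) = f (Suc l)" for i
    using assms by (auto simp: graft_def)
  have "cap \<kappa> k (on_legs l A x) f = (\<Sum>i\<in>UNIV. \<Sum>a\<in>UNIV. \<Sum>b\<in>UNIV.
      (A $ (f l, f (Suc l)) $ (a, b) * \<kappa> i) *\<^sub>C x (graft k i (f(l := a, Suc l := b))))"
    by (simp add: cap_def on_legs_def scaleC_sum_right scaleC_scaleC u v mult.commute)
  also have "\<dots> = (\<Sum>a\<in>UNIV. \<Sum>i\<in>UNIV. \<Sum>b\<in>UNIV.
      (A $ (f l, f (Suc l)) $ (a, b) * \<kappa> i) *\<^sub>C x (graft k i (f(l := a, Suc l := b))))"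
    by (rule sum.swap)
  also have "\<dots> = (\<Sum>a\<in>UNIV. \<Sum>b\<in>UNIV. \<Sum>i\<in>UNIV.
      (A $ (f l, f (Suc l)) $ (a, b) * \<kappa> i) *\<^sub>C x (graft k i (f(l := a, Suc l := b))))"
    by (intro sum.cong refl sum.swap)
  also have "\<dots> = on_legs l A (cap \<kappa> k x) f"
    by (simp add: cap_def on_legs_def scaleC_sum_right scaleC_scaleC)
  finally show "cap \<kappa> k (on_legs l A x) f = on_legs l A (cap \<kappa> k x) f" .
qed

lemma cap_on_legs_above:
  assumes "k \<le> l"
  shows "cap \<kappa> k (on_legs (l + 2) A x) = on_legs l A (cap \<kappa> k x)"
proof (rule ext)
  fix f :: "nat \<Rightarrow> 'a"
  have u: "(graft k i f)(l + 2 := a, Suc (l + 2) := b) = graft k i (f(l := a, Suc l := b))" for i a b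
    using assms by (auto simp: fun_eq_iff graft_def)
  have v: "graft k i f (l + 2) = f l" "graft k i f (Suc (l + 2)) = f (Suc l)" for i
    using assms by (auto simp: graft_def)
  have "cap \<kappa> k (on_legs (l + 2) A x) f = (\<Sum>i\<in>UNIV. \<Sum>a\<in>UNIV. \<Sum>b\<in>UNIV.
      (A $ (f l, f (Suc l)) $ (a, b) * \<kappa> i) *\<^sub>C x (graft k i (f(l := a, Suc l := b))))"
    unfolding cap_def on_legs_def u v by (simp add: scaleC_sum_right scaleC_scaleC mult.commute)
  also have "\<dots> = (\<Sum>a\<in>UNIV. \<Sum>i\<in>UNIV. \<Sum>b\<in>UNIV.
      (A $ (f l, f (Suc l)) $ (a, b) * \<kappa> i) *\<^sub>C x (graft k i (f(l := a, Suc l := b))))"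
    by (rule sum.swap)
  also have "\<dots> = (\<Sum>a\<in>UNIV. \<Sum>b\<in>UNIV. \<Sum>i\<in>UNIV.
      (A $ (f l, f (Suc l)) $ (a, b) * \<kappa> i) *\<^sub>C x (graft k i (f(l := a, Suc l := b))))"
    by (intro sum.cong refl sum.swap)
  also have "\<dots> = on_legs l A (cap \<kappa> k x) f"
    by (simp add: cap_def on_legs_def scaleC_sum_right scaleC_scaleC)
  finally show "cap \<kappa> k (on_legs (l + 2) A x) f = on_legs l A (cap \<kappa> k x) f" .
qed

text \<open>The assumption says that \<open>B\<close> is \<open>A\<close> rotated by a quarter turn around the cap. A crossing to the right of
a cap may be pulled over it and becomes the rotated crossing to its left.\<close>
lemma cap_slide:
  assumes "\<And>a b c e. \<kappa> a * A $ (a, e) $ (b, c) = \<kappa> c * B $ (e, c) $ (a, b)"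
  shows "cap \<kappa> k (on_legs (Suc k) A x) = cap \<kappa> (Suc k) (on_legs k B x)"
proof (rule ext)
  fix f :: "nat \<Rightarrow> 'a"
  define y where "y a b c = x (\<lambda>n. if n < k then f n else if n = k then a else if n = Suc k then b
    else if n = Suc (Suc k) then c else f (n - 2))" for a b c
  have u: "x ((graft k a f)(Suc k := b, Suc (Suc k) := c)) = y a b c" for a b c
    unfolding y_def by (rule arg_cong[where f = x]) (auto simp: fun_eq_iff graft_def)
  have v: "x ((graft (Suc k) c f)(k := a, Suc k := b)) = y a b c" for a b c
    unfolding y_def by (rule arg_cong[where f = x]) (auto simp: fun_eq_iff graft_def)
  have "cap \<kappa> k (on_legs (Suc k) A x) f
      = (\<Sum>a\<in>UNIV. \<Sum>b\<in>UNIV. \<Sum>c\<in>UNIV. (\<kappa> a * A $ (a, f k) $ (b, c)) *\<^sub>C y a b c)"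
    unfolding cap_def on_legs_def u by (simp add: scaleC_sum_right scaleC_scaleC graft_def)
  also have "\<dots> = (\<Sum>a\<in>UNIV. \<Sum>b\<in>UNIV. \<Sum>c\<in>UNIV. (\<kappa> c * B $ (f k, c) $ (a, b)) *\<^sub>C y a b c)"
    by (simp add: assms)
  also have "\<dots> = (\<Sum>a\<in>UNIV. \<Sum>c\<in>UNIV. \<Sum>b\<in>UNIV. (\<kappa> c * B $ (f k, c) $ (a, b)) *\<^sub>C y a b c)"
    by (intro sum.cong refl sum.swap)
  also have "\<dots> = (\<Sum>c\<in>UNIV. \<Sum>a\<in>UNIV. \<Sum>b\<in>UNIV. (\<kappa> c * B $ (f k, c) $ (a, b)) *\<^sub>C y a b c)"
    by (rule sum.swap)
  also have "\<dots> = cap \<kappa> (Suc k) (on_legs k B x) f"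
    unfolding cap_def on_legs_def v by (simp add: scaleC_sum_right scaleC_scaleC graft_def)
  finally show "cap \<kappa> k (on_legs (Suc k) A x) f = cap \<kappa> (Suc k) (on_legs k B x) f" .
qed

text \<open>A crossing whose two outgoing legs are joined is a curl; straightening a curl costs a scalar and turns one
kind of cap into the other.\<close>
lemma cap_twist:
  assumes "\<And>a b. (\<Sum>i\<in>UNIV. A $ (i, i) $ (a, b)) = (if a = b then z * \<kappa> b else 0)"
  shows "cap (\<lambda>_. 1) k (on_legs k A x) = (\<lambda>f. z *\<^sub>C cap \<kappa> k x f)"
proof (rule ext)
  fix f :: "nat \<Rightarrow> 'a"
  define y where "y a b = x (\<lambda>n. if n < k then f n else if n = k then a else if n = Suc k then b
    else f (n - 2))" for a b
  have u: "x ((graft k i f)(k := a, Suc k := b)) = y a b" for a b i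
    unfolding y_def by (rule arg_cong[where f = x]) (auto simp: fun_eq_iff graft_def)
  have v: "x (graft k c f) = y c c" for c
    unfolding y_def by (rule arg_cong[where f = x]) (auto simp: fun_eq_iff graft_def)
  have "cap (\<lambda>_. 1) k (on_legs k A x) f = (\<Sum>i\<in>UNIV. \<Sum>a\<in>UNIV. \<Sum>b\<in>UNIV. A $ (i, i) $ (a, b) *\<^sub>C y a b)"
    unfolding cap_def on_legs_def u by (simp add: scaleC_one graft_def)
  also have "\<dots> = (\<Sum>a\<in>UNIV. \<Sum>i\<in>UNIV. \<Sum>b\<in>UNIV. A $ (i, i) $ (a, b) *\<^sub>C y a b)"
    by (rule sum.swap)
  also have "\<dots> = (\<Sum>a\<in>UNIV. \<Sum>b\<in>UNIV. \<Sum>i\<in>UNIV. A $ (i, i) $ (a, b) *\<^sub>C y a b)"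
    by (intro sum.cong refl sum.swap)
  also have "\<dots> = (\<Sum>a\<in>UNIV. \<Sum>b\<in>UNIV. (if a = b then z * \<kappa> b else 0) *\<^sub>C y a b)"
    by (simp add: assms flip: cvec.scale_sum_left)
  also have "\<dots> = (\<Sum>a\<in>UNIV. \<Sum>b\<in>UNIV. (if a = b then 1 else 0) *\<^sub>C ((z * \<kappa> b) *\<^sub>C y a b))"
    by (intro sum.cong refl) (auto simp: scaleC_one)
  also have "\<dots> = (\<Sum>a\<in>UNIV. (z * \<kappa> a) *\<^sub>C y a a)"
    by (simp add: sum_delta_scaleC del: cvec.scale_scale)
  also have "\<dots> = z *\<^sub>C cap \<kappa> k x f"
    unfolding cap_def v by (simp add: scaleC_sum_right scaleC_scaleC)
  finally show "cap (\<lambda>_. 1) k (on_legs k A x) f = z *\<^sub>C cap \<kappa> k x f" .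
qed

text \<open>The braid relation on three legs, written in matrix entries. Six matrices are needed, since the three
strands may be of type \<open>V\<close> or of type \<open>V\<^sup>*\<close>, and a crossing may be positive or negative.\<close>
definition braid_kernels where
  "braid_kernels A B C A' B' C' \<longleftrightarrow> (\<forall>a b c d e f.
    (\<Sum>m\<in>UNIV. \<Sum>n\<in>UNIV. \<Sum>k\<in>UNIV. A $ (a, b) $ (n, m) * B $ (m, c) $ (k, f) * C $ (n, k) $ (d, e)) =
    (\<Sum>m\<in>UNIV. \<Sum>n\<in>UNIV. \<Sum>k\<in>UNIV. A' $ (b, c) $ (n, k) * B' $ (a, n) $ (d, m) * C' $ (m, k) $ (e, f)))"

lemma sum_rotate3:
  "(\<Sum>a\<in>A. \<Sum>b\<in>B. \<Sum>c\<in>C. g a b c) = (\<Sum>c\<in>C. \<Sum>a\<in>A. \<Sum>b\<in>B. g a b c)"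
proof -
  have "(\<Sum>a\<in>A. \<Sum>b\<in>B. \<Sum>c\<in>C. g a b c) = (\<Sum>a\<in>A. \<Sum>c\<in>C. \<Sum>b\<in>B. g a b c)"
    by (intro sum.cong refl sum.swap)
  also have "\<dots> = (\<Sum>c\<in>C. \<Sum>a\<in>A. \<Sum>b\<in>B. g a b c)" by (rule sum.swap)
  finally show ?thesis .
qed

lemma sum_rotate4:
  "(\<Sum>a\<in>A. \<Sum>b\<in>B. \<Sum>c\<in>C. \<Sum>d\<in>D. g a b c d) = (\<Sum>d\<in>D. \<Sum>a\<in>A. \<Sum>b\<in>B. \<Sum>c\<in>C. g a b c d)"
proof -
  have "(\<Sum>a\<in>A. \<Sum>b\<in>B. \<Sum>c\<in>C. \<Sum>d\<in>D. g a b c d) = (\<Sum>a\<in>A. \<Sum>d\<in>D. \<Sum>b\<in>B. \<Sum>c\<in>C. g a b c d)"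
    by (rule sum.cong[OF refl], rule sum_rotate3)
  also have "\<dots> = (\<Sum>d\<in>D. \<Sum>a\<in>A. \<Sum>b\<in>B. \<Sum>c\<in>C. g a b c d)" by (rule sum.swap)
  finally show ?thesis .
qed

definition set3 where
  "set3 k a b c f = (\<lambda>n. if n = k then a else if n = Suc k then b else if n = Suc (Suc k) then c else f n)"

text \<open>The braid relation passes from matrix entries to maps on legs by collecting the coefficient of each
component.\<close>
lemma on_legs_121:
  "on_legs k A (on_legs (Suc k) B (on_legs k C x)) g =
    (\<Sum>d\<in>UNIV. \<Sum>e\<in>UNIV. \<Sum>f\<in>UNIV. 
    (\<Sum>m\<in>UNIV. \<Sum>n\<in>UNIV. \<Sum>l\<in>UNIV. A $ (g k, g (Suc k)) $ (n, m) * B $ (m, g (Suc (Suc k))) $ (l, f) * C $ (n, l) $ (d, e))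
      *\<^sub>C x (set3 k d e f g))"
proof -
  let ?t = "\<lambda>n m l f d e. (A $ (g k, g (Suc k)) $ (n, m) * B $ (m, g (Suc (Suc k))) $ (l, f) * C $ (n, l) $ (d, e)) *\<^sub>C x (set3 k d e f g)"
  have u: "g(k := n, Suc k := m, Suc k := l, Suc (Suc k) := f, k := d, Suc k := e) = set3 k d e f g" for n m l f d e
    by (auto simp: fun_eq_iff set3_def)
  have "on_legs k A (on_legs (Suc k) B (on_legs k C x)) g
    = (\<Sum>n\<in>UNIV. \<Sum>m\<in>UNIV. \<Sum>l\<in>UNIV. \<Sum>f\<in>UNIV. \<Sum>d\<in>UNIV. \<Sum>e\<in>UNIV. ?t n m l f d e)"
    unfolding on_legs_def u by (simp add: scaleC_sum_right scaleC_scaleC mult.assoc)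
  also have "\<dots> = (\<Sum>n\<in>UNIV. \<Sum>m\<in>UNIV. \<Sum>l\<in>UNIV. \<Sum>d\<in>UNIV. \<Sum>e\<in>UNIV. \<Sum>f\<in>UNIV. ?t n m l f d e)"
    by (rule sum.cong[OF refl], rule sum.cong[OF refl], rule sum.cong[OF refl], rule sum_rotate3[symmetric])
  also have "\<dots> = (\<Sum>m\<in>UNIV. \<Sum>n\<in>UNIV. \<Sum>l\<in>UNIV. \<Sum>d\<in>UNIV. \<Sum>e\<in>UNIV. \<Sum>f\<in>UNIV. ?t n m l f d e)"
    by (rule sum.swap)
  also have "\<dots> = (\<Sum>d\<in>UNIV. \<Sum>m\<in>UNIV. \<Sum>n\<in>UNIV. \<Sum>l\<in>UNIV. \<Sum>e\<in>UNIV. \<Sum>f\<in>UNIV. ?t n m l f d e)"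
    by (rule sum_rotate4)
  also have "\<dots> = (\<Sum>d\<in>UNIV. \<Sum>e\<in>UNIV. \<Sum>m\<in>UNIV. \<Sum>n\<in>UNIV. \<Sum>l\<in>UNIV. \<Sum>f\<in>UNIV. ?t n m l f d e)"
    by (rule sum.cong[OF refl], rule sum_rotate4)
  also have "\<dots> = (\<Sum>d\<in>UNIV. \<Sum>e\<in>UNIV. \<Sum>f\<in>UNIV. \<Sum>m\<in>UNIV. \<Sum>n\<in>UNIV. \<Sum>l\<in>UNIV. ?t n m l f d e)"
    by (rule sum.cong[OF refl], rule sum.cong[OF refl], rule sum_rotate4)
  finally show ?thesis
    by (simp add: cvec.scale_sum_left)
qed

lemma on_legs_212:
  "on_legs (Suc k) A (on_legs k B (on_legs (Suc k) C x)) g =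
    (\<Sum>d\<in>UNIV. \<Sum>e\<in>UNIV. \<Sum>f\<in>UNIV. 
    (\<Sum>m\<in>UNIV. \<Sum>n\<in>UNIV. \<Sum>l\<in>UNIV. A $ (g (Suc k), g (Suc (Suc k))) $ (n, l) * B $ (g k, n) $ (d, m) * C $ (m, l) $ (e, f))
      *\<^sub>C x (set3 k d e f g))"
proof -
  let ?t = "\<lambda>n l d m e f. (A $ (g (Suc k), g (Suc (Suc k))) $ (n, l) * B $ (g k, n) $ (d, m) * C $ (m, l) $ (e, f)) *\<^sub>C x (set3 k d e f g)"
  have u: "g(Suc k := n, Suc (Suc k) := l, k := d, Suc k := m, Suc k := e, Suc (Suc k) := f) = set3 k d e f g" for n m l f d e
    by (auto simp: fun_eq_iff set3_def)
  have "on_legs (Suc k) A (on_legs k B (on_legs (Suc k) C x)) g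
    = (\<Sum>n\<in>UNIV. \<Sum>l\<in>UNIV. \<Sum>d\<in>UNIV. \<Sum>m\<in>UNIV. \<Sum>e\<in>UNIV. \<Sum>f\<in>UNIV. ?t n l d m e f)"
    unfolding on_legs_def u by (simp add: scaleC_sum_right scaleC_scaleC mult.assoc)
  also have "\<dots> = (\<Sum>n\<in>UNIV. \<Sum>l\<in>UNIV. \<Sum>m\<in>UNIV. \<Sum>d\<in>UNIV. \<Sum>e\<in>UNIV. \<Sum>f\<in>UNIV. ?t n l d m e f)"
    by (rule sum.cong[OF refl], rule sum.cong[OF refl], rule sum.swap)
  also have "\<dots> = (\<Sum>m\<in>UNIV. \<Sum>n\<in>UNIV. \<Sum>l\<in>UNIV. \<Sum>d\<in>UNIV. \<Sum>e\<in>UNIV. \<Sum>f\<in>UNIV. ?t n l d m e f)"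
    by (rule sum_rotate3)
  also have "\<dots> = (\<Sum>d\<in>UNIV. \<Sum>m\<in>UNIV. \<Sum>n\<in>UNIV. \<Sum>l\<in>UNIV. \<Sum>e\<in>UNIV. \<Sum>f\<in>UNIV. ?t n l d m e f)"
    by (rule sum_rotate4)
  also have "\<dots> = (\<Sum>d\<in>UNIV. \<Sum>e\<in>UNIV. \<Sum>m\<in>UNIV. \<Sum>n\<in>UNIV. \<Sum>l\<in>UNIV. \<Sum>f\<in>UNIV. ?t n l d m e f)"
    by (rule sum.cong[OF refl], rule sum_rotate4)
  also have "\<dots> = (\<Sum>d\<in>UNIV. \<Sum>e\<in>UNIV. \<Sum>f\<in>UNIV. \<Sum>m\<in>UNIV. \<Sum>n\<in>UNIV. \<Sum>l\<in>UNIV. ?t n l d m e f)"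
    by (rule sum.cong[OF refl], rule sum.cong[OF refl], rule sum_rotate4)
  finally show ?thesis
    by (simp add: cvec.scale_sum_left)
qed

lemma on_legs_braid:
  assumes "braid_kernels A B C A' B' C'"
  shows "on_legs k A (on_legs (Suc k) B (on_legs k C x)) = on_legs (Suc k) A' (on_legs k B' (on_legs (Suc k) C' x))"
  using assms by (intro ext) (simp add: on_legs_121 on_legs_212 braid_kernels_def)

section \<open>Moving a pair of legs past another pair\<close>

text \<open>All that the proof uses about the quantum group. Here \<open>R\<close>, \<open>D\<close>, \<open>Q\<close> are the braidings of \<open>V\<close> with \<open>V\<close>,
of \<open>V\<close> with \<open>V\<^sup>*\<close> and of \<open>V\<^sup>*\<close> with \<open>V\<^sup>*\<close>, and \<open>Rb\<close>, \<open>Di\<close>, \<open>Qi\<close> are their inverses. The rotation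
conditions express naturality of the braiding with respect to the two evaluations, and \<open>twist\<close> says how a curl is
straightened.\<close>
locale braiding_data =
  fixes R Rb D Di Q Qi :: "complex^('n::finite \<times> 'n)^('n \<times> 'n)"
    and \<kappa> :: "'n \<Rightarrow> complex" and z :: complex
  assumes R_inv: "Rb ** R = mat 1" "R ** Rb = mat 1"
    and D_inv: "D ** Di = mat 1" "Di ** D = mat 1"
    and Q_inv: "Q ** Qi = mat 1" "Qi ** Q = mat 1"
    and R_braid: "braid_kernels R R R R R R"
    and rotate_R: "R $ (a, e) $ (b, c) = Di $ (e, c) $ (a, b)"
    and rotate_Di: "Di $ (a, e) $ (b, c) = Q $ (e, c) $ (a, b)"
    and rotate_D: "\<kappa> a * D $ (a, e) $ (b, c) = \<kappa> c * Rb $ (e, c) $ (a, b)"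
    and rotate_Qi: "\<kappa> a * Qi $ (a, e) $ (b, c) = \<kappa> c * D $ (e, c) $ (a, b)"
    and twist: "(\<Sum>i\<in>UNIV. D $ (i, i) $ (a, b)) = (if a = b then z * \<kappa> b else 0)"
    and z_nonzero: "z \<noteq> 0"
begin

lemma R_braid_entries:
  "(\<Sum>m\<in>UNIV. \<Sum>n\<in>UNIV. \<Sum>k\<in>UNIV. R $ (a, b) $ (n, m) * R $ (m, c) $ (k, f) * R $ (n, k) $ (d, e)) =
    (\<Sum>m\<in>UNIV. \<Sum>n\<in>UNIV. \<Sum>k\<in>UNIV. R $ (b, c) $ (n, k) * R $ (a, n) $ (d, m) * R $ (m, k) $ (e, f))"
  using R_braid unfolding braid_kernels_def by blast

lemma Di_entry: "Di $ (k, l) $ (j, i) = R $ (j, k) $ (i, l)"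
  by (simp add: rotate_R)

lemma Q_entry: "Q $ (k, l) $ (i, j) = R $ (j, i) $ (l, k)"
  by (simp add: rotate_R rotate_Di)

text \<open>Rotating one strand of the braid relation of \<open>R\<close> gives the relation that involves \<open>Di\<close>; rotating two or
three strands gives the relations that involve \<open>Q\<close>.\<close>
lemma braid_Di_R: "braid_kernels R Di Di Di Di R"
  unfolding braid_kernels_def
proof (intro allI)
  fix a b c d e f
  have "(\<Sum>m\<in>UNIV. \<Sum>n\<in>UNIV. \<Sum>k\<in>UNIV. R $ (a, b) $ (n, m) * Di $ (m, c) $ (k, f) * Di $ (n, k) $ (d, e))
    = (\<Sum>m\<in>UNIV. \<Sum>n\<in>UNIV. \<Sum>k\<in>UNIV. R $ (a, b) $ (n, m) * R $ (d, n) $ (e, k) * R $ (k, m) $ (f, c))"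
    by (intro sum.cong refl) (simp add: Di_entry)
  also have "\<dots> = (\<Sum>k\<in>UNIV. \<Sum>n\<in>UNIV. \<Sum>m\<in>UNIV. R $ (a, b) $ (n, m) * R $ (d, n) $ (e, k) * R $ (k, m) $ (f, c))"
    by (subst sum_rotate3) (rule sum.cong[OF refl], rule sum.swap)
  also have "\<dots> = (\<Sum>m\<in>UNIV. \<Sum>n\<in>UNIV. \<Sum>k\<in>UNIV. R $ (d, a) $ (n, m) * R $ (m, b) $ (k, c) * R $ (n, k) $ (e, f))"
    by (rule R_braid_entries[symmetric])
  also have "\<dots> = (\<Sum>n\<in>UNIV. \<Sum>k\<in>UNIV. \<Sum>m\<in>UNIV. R $ (d, a) $ (n, m) * R $ (m, b) $ (k, c) * R $ (n, k) $ (e, f))"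
    by (rule sum_rotate3[symmetric])
  also have "\<dots> = (\<Sum>m\<in>UNIV. \<Sum>n\<in>UNIV. \<Sum>k\<in>UNIV. Di $ (b, c) $ (n, k) * Di $ (a, n) $ (d, m) * R $ (m, k) $ (e, f))"
    by (rule sum.cong[OF refl], subst sum.swap) (intro sum.cong refl, simp add: Di_entry)
  finally show "(\<Sum>m\<in>UNIV. \<Sum>n\<in>UNIV. \<Sum>k\<in>UNIV. R $ (a, b) $ (n, m) * Di $ (m, c) $ (k, f) * Di $ (n, k) $ (d, e))
    = (\<Sum>m\<in>UNIV. \<Sum>n\<in>UNIV. \<Sum>k\<in>UNIV. Di $ (b, c) $ (n, k) * Di $ (a, n) $ (d, m) * R $ (m, k) $ (e, f))" .
qed

lemma braid_Di_Q: "braid_kernels Di Di Q Q Di Di"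
  unfolding braid_kernels_def
proof (intro allI)
  fix a b c d e f
  have "(\<Sum>m\<in>UNIV. \<Sum>n\<in>UNIV. \<Sum>k\<in>UNIV. Di $ (a, b) $ (n, m) * Di $ (m, c) $ (k, f) * Q $ (n, k) $ (d, e))
    = (\<Sum>m\<in>UNIV. \<Sum>n\<in>UNIV. \<Sum>k\<in>UNIV. R $ (e, d) $ (k, n) * R $ (n, a) $ (m, b) * R $ (k, m) $ (f, c))"
    by (intro sum.cong refl) (simp add: Di_entry Q_entry)
  also have "\<dots> = (\<Sum>n\<in>UNIV. \<Sum>k\<in>UNIV. \<Sum>m\<in>UNIV. R $ (e, d) $ (k, n) * R $ (n, a) $ (m, b) * R $ (k, m) $ (f, c))"
    by (rule sum_rotate3[symmetric])
  also have "\<dots> = (\<Sum>n\<in>UNIV. \<Sum>m\<in>UNIV. \<Sum>k\<in>UNIV. R $ (d, a) $ (m, k) * R $ (e, m) $ (f, n) * R $ (n, k) $ (c, b))"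
    by (rule R_braid_entries)
  also have "\<dots> = (\<Sum>m\<in>UNIV. \<Sum>k\<in>UNIV. \<Sum>n\<in>UNIV. R $ (d, a) $ (m, k) * R $ (e, m) $ (f, n) * R $ (n, k) $ (c, b))"
    by (rule sum_rotate3[symmetric])
  also have "\<dots> = (\<Sum>m\<in>UNIV. \<Sum>n\<in>UNIV. \<Sum>k\<in>UNIV. Q $ (b, c) $ (n, k) * Di $ (a, n) $ (d, m) * Di $ (m, k) $ (e, f))"
    by (intro sum.cong refl) (simp add: Di_entry Q_entry)
  finally show "(\<Sum>m\<in>UNIV. \<Sum>n\<in>UNIV. \<Sum>k\<in>UNIV. Di $ (a, b) $ (n, m) * Di $ (m, c) $ (k, f) * Q $ (n, k) $ (d, e))
    = (\<Sum>m\<in>UNIV. \<Sum>n\<in>UNIV. \<Sum>k\<in>UNIV. Q $ (b, c) $ (n, k) * Di $ (a, n) $ (d, m) * Di $ (m, k) $ (e, f))" .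
qed

lemma braid_Q: "braid_kernels Q Q Q Q Q Q"
  unfolding braid_kernels_def
proof (intro allI)
  fix a b c d e f
  have "(\<Sum>m\<in>UNIV. \<Sum>n\<in>UNIV. \<Sum>k\<in>UNIV. Q $ (a, b) $ (n, m) * Q $ (m, c) $ (k, f) * Q $ (n, k) $ (d, e))
    = (\<Sum>m\<in>UNIV. \<Sum>n\<in>UNIV. \<Sum>k\<in>UNIV. R $ (e, d) $ (k, n) * R $ (f, k) $ (c, m) * R $ (m, n) $ (b, a))"
    by (intro sum.cong refl) (simp add: Q_entry)
  also have "\<dots> = (\<Sum>m\<in>UNIV. \<Sum>k\<in>UNIV. \<Sum>n\<in>UNIV. R $ (e, d) $ (k, n) * R $ (f, k) $ (c, m) * R $ (m, n) $ (b, a))"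
    by (rule sum.cong[OF refl], rule sum.swap)
  also have "\<dots> = (\<Sum>m\<in>UNIV. \<Sum>k\<in>UNIV. \<Sum>n\<in>UNIV. R $ (f, e) $ (k, m) * R $ (m, d) $ (n, a) * R $ (k, n) $ (c, b))"
    by (rule R_braid_entries[symmetric])
  also have "\<dots> = (\<Sum>m\<in>UNIV. \<Sum>n\<in>UNIV. \<Sum>k\<in>UNIV. Q $ (b, c) $ (n, k) * Q $ (a, n) $ (d, m) * Q $ (m, k) $ (e, f))"
    by (rule sum.cong[OF refl], subst sum.swap) (intro sum.cong refl, simp add: Q_entry)
  finally show "(\<Sum>m\<in>UNIV. \<Sum>n\<in>UNIV. \<Sum>k\<in>UNIV. Q $ (a, b) $ (n, m) * Q $ (m, c) $ (k, f) * Q $ (n, k) $ (d, e))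
    = (\<Sum>m\<in>UNIV. \<Sum>n\<in>UNIV. \<Sum>k\<in>UNIV. Q $ (b, c) $ (n, k) * Q $ (a, n) $ (d, m) * Q $ (m, k) $ (e, f))" .
qed

lemmas cancel = on_legs_inverse[OF R_inv(1)] on_legs_inverse[OF R_inv(2)]
  on_legs_inverse[OF D_inv(1)] on_legs_inverse[OF D_inv(2)]
  on_legs_inverse[OF Q_inv(1)] on_legs_inverse[OF Q_inv(2)]

lemma braids:
  "on_legs k R (on_legs (Suc k) R (on_legs k R x)) = on_legs (Suc k) R (on_legs k R (on_legs (Suc k) R x))"
  "on_legs k R (on_legs (Suc k) Di (on_legs k Di x)) = on_legs (Suc k) Di (on_legs k Di (on_legs (Suc k) R x))"
  "on_legs k Di (on_legs (Suc k) Di (on_legs k Q x)) = on_legs (Suc k) Q (on_legs k Di (on_legs (Suc k) Di x))"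
  "on_legs k Q (on_legs (Suc k) Q (on_legs k Q x)) = on_legs (Suc k) Q (on_legs k Q (on_legs (Suc k) Q x))"
  by (rule on_legs_braid, fact R_braid braid_Di_R braid_Di_Q braid_Q)+

text \<open>A leg of type \<open>V\<^sup>*\<close> that moves to the right by \<open>Di\<close> (past \<open>V\<close>) and by \<open>Qi\<close> (past \<open>V\<^sup>*\<close>) runs
under all other strands: both are inverse braidings. Hence it slides under any crossing of two other strands;
the suffixes tell the types of those two, \<open>D\<close> standing for \<open>V\<^sup>*\<close>.\<close>
lemma under_VV: "on_legs (Suc k) Di (on_legs k Di (on_legs (Suc k) R x)) = on_legs k R (on_legs (Suc k) Di (on_legs k Di x))"
  by (simp add: braids)

lemma under_DV: "on_legs (Suc k) Qi (on_legs k Di (on_legs (Suc k) Di x)) = on_legs k Di (on_legs (Suc k) Di (on_legs k Qi x))"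
  using arg_cong[OF braids(3)[of k "on_legs k Qi x"], of "on_legs (Suc k) Qi"] by (simp add: cancel)

lemma under_VD: "on_legs (Suc k) Di (on_legs k Qi (on_legs (Suc k) D x)) = on_legs k D (on_legs (Suc k) Qi (on_legs k Di x))"
proof -
  have "on_legs k Di (on_legs (Suc k) Di (on_legs k Qi (on_legs (Suc k) D x)))
      = on_legs (Suc k) Qi (on_legs k Di x)"
    by (simp add: under_DV[symmetric] cancel)
  from arg_cong[OF this, of "on_legs k D"] show ?thesis by (simp add: cancel)
qed

lemma under_DD: "on_legs (Suc k) Qi (on_legs k Qi (on_legs (Suc k) Qi x)) = on_legs k Qi (on_legs (Suc k) Qi (on_legs k Qi x))"
proof -
  let ?y = "on_legs (Suc k) Qi (on_legs k Qi (on_legs (Suc k) Qi x))"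
  have "on_legs k Q (on_legs (Suc k) Q (on_legs k Q ?y)) = x"
    by (simp only: braids(4) cancel)
  from arg_cong[OF this, of "\<lambda>u. on_legs k Qi (on_legs (Suc k) Qi (on_legs k Qi u))"]
  show ?thesis by (simp only: cancel)
qed

text \<open>In the same way a leg of type \<open>V\<close> that moves to the right by \<open>R\<close> (past \<open>V\<close>) and by \<open>D\<close> (past \<open>V\<^sup>*\<close>)
runs over all other strands.\<close>
lemma over_VV: "on_legs (Suc k) R (on_legs k R (on_legs (Suc k) R x)) = on_legs k R (on_legs (Suc k) R (on_legs k R x))"
  by (simp add: braids)

lemma over_VD: "on_legs (Suc k) R (on_legs k D (on_legs (Suc k) D x)) = on_legs k D (on_legs (Suc k) D (on_legs k R x))"
  using arg_cong[OF under_VV[of k "on_legs k D (on_legs (Suc k) D x)"],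
      of "\<lambda>u. on_legs k D (on_legs (Suc k) D u)"] 
  by (simp only: cancel)

lemma over_DV: "on_legs (Suc k) D (on_legs k R (on_legs (Suc k) Di x)) = on_legs k Di (on_legs (Suc k) R (on_legs k D x))"
  using arg_cong[OF over_VD[of k "on_legs (Suc k) Di x"], of "on_legs k Di"] 
  by (simp only: cancel)

lemma over_DD: "on_legs (Suc k) D (on_legs k D (on_legs (Suc k) Qi x)) = on_legs k Qi (on_legs (Suc k) D (on_legs k D x))"
  using arg_cong[OF under_DV[of k "on_legs (Suc k) D (on_legs k D x)"],
      of "\<lambda>u. on_legs (Suc k) D (on_legs k D u)"] 
  by (simp only: cancel)

text \<open>A strand that runs over, or under, both ends of a cap does not see the cap.\<close>
abbreviation E where "E \<equiv> cap (\<lambda>_. 1)"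
abbreviation E' where "E' \<equiv> cap \<kappa>"

lemma E_over: "E k (on_legs (Suc k) R (on_legs k D x)) = E (Suc k) x"
  by (subst cap_slide[where B = Di]) (simp_all add: rotate_R[symmetric] cancel)

lemma E_under: "E k (on_legs (Suc k) Di (on_legs k Qi x)) = E (Suc k) x"
  by (subst cap_slide[where B = Q]) (simp_all add: rotate_Di[symmetric] cancel)

lemma E'_slide_D: "E' k (on_legs (Suc k) D x) = E' (Suc k) (on_legs k Rb x)"
  by (rule cap_slide) (rule rotate_D)

lemma E'_slide_Qi: "E' k (on_legs (Suc k) Qi x) = E' (Suc k) (on_legs k D x)"
  by (rule cap_slide) (rule rotate_Qi)

lemma E'_over: "E' k (on_legs (Suc k) D (on_legs k R x)) = E' (Suc k) x"
  by (simp add: E'_slide_D cancel)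

lemma E'_under: "E' k (on_legs (Suc k) Qi (on_legs k Di x)) = E' (Suc k) x"
  by (simp add: E'_slide_Qi cancel)

lemma E_D: "E k (on_legs k D x) = (\<lambda>f. z *\<^sub>C E' k x f)"
  by (rule cap_twist) (rule twist)

lemma E'_Di: "E' k (on_legs k Di x) = (\<lambda>f. inverse z *\<^sub>C E k x f)"
proof -
  have "E k x = (\<lambda>f. z *\<^sub>C E' k (on_legs k Di x) f)"
    using E_D[of k "on_legs k Di x"] by (simp add: cancel)
  then show ?thesis using z_nonzero by (simp add: scaleC_scaleC scaleC_one)
qed

text \<open>\<open>T\<close> moves a pair \<open>V, V\<^sup>*\<close> past another such pair. In the product of the two maps \<open>S\<close> and \<open>S~\<close>, whose
composition it is, the inverse of \<open>D\<close> in the first cancels \<open>D\<close> in the second. What remains moves the leg of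
type \<open>V\<^sup>*\<close> under, and then the leg of type \<open>V\<close> over, the legs of the other pair.\<close>
definition T where
  "T k x = on_legs (k + 1) D (on_legs k R (on_legs (k + 2) Qi (on_legs (k + 1) Di x)))"

lemma T_eq_0:
  assumes "T k x = (\<lambda>_. 0)" shows "x = (\<lambda>_. 0)"
proof -
  have o0: "on_legs j A (\<lambda>_. 0) = (\<lambda>_. 0)" for j and A :: "complex^('n \<times> 'n)^('n \<times> 'n)"
    by (simp add: on_legs_def fun_eq_iff)
  have "x = on_legs (k + 1) D (on_legs (k + 2) Q (on_legs k Rb (on_legs (k + 1) Di (T k x))))"
    by (simp add: T_def cancel)
  then show ?thesis by (simp add: assms o0)
qed

text \<open>Since the \<open>V\<^sup>*\<close> strand of a moving pair runs under and the \<open>V\<close> strand runs over everything, a product of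
copies of \<open>T\<close> can be sorted into crossings of the under-strand followed by crossings of the over-strand. The two
halves are then moved past other crossings one strand at a time. The strand moves past four legs, which alternate in type
(\<open>under_V\<close>, \<open>over_V\<close>) or come in the order \<open>V, V, V\<^sup>*, V\<^sup>*\<close> (\<open>under_S\<close>, \<open>over_S\<close>).\<close>
definition under_V where "under_V k x = on_legs (k+3) Qi (on_legs (k+2) Di (on_legs (k+1) Qi (on_legs k Di x)))"
definition under_S where "under_S k x = on_legs (k+3) Qi (on_legs (k+2) Qi (on_legs (k+1) Di (on_legs k Di x)))"
definition over_V where "over_V k x = on_legs (k+3) D (on_legs (k+2) R (on_legs (k+1) D (on_legs k R x)))"
definition over_S where "over_S k x = on_legs (k+3) D (on_legs (k+2) D (on_legs (k+1) R (on_legs k R x)))"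

lemma T_T: "T 2 (T 0 x) = over_V 0 (under_V 1 x)"
  by (simp add: T_def over_V_def under_V_def numeral_eq_Suc on_legs_commute)

text \<open>A pair that moves past two further pairs does not see whether their inner legs have been contracted; this is why
weights of families multiply under matrix multiplication.\<close>
lemma E_T_T: "E 1 (T 2 (T 0 x)) = T 0 (E 3 x)"
proof -
  have "E 1 (T 2 (T 0 x)) = E 1 (on_legs 3 D (on_legs 2 R (on_legs 1 D (on_legs 0 R (under_V 1 x)))))"
    unfolding T_T over_V_def by (simp add: numeral_eq_Suc)
  also have "\<dots> = on_legs 1 D (E 1 (on_legs 2 R (on_legs 1 D (on_legs 0 R (under_V 1 x)))))"
    using cap_on_legs_above[of 1 1] by (simp add: numeral_eq_Suc)
  also have "\<dots> = on_legs 1 D (on_legs 0 R (E 2 (under_V 1 x)))"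
    by (simp add: numeral_eq_Suc cap_on_legs_below E_over[of 1, simplified])
  also have "E 2 (under_V 1 x) = on_legs 2 Qi (E 2 (on_legs 3 Di (on_legs 2 Qi (on_legs 1 Di x))))"
    using cap_on_legs_above[of 2 2] by (simp add: under_V_def numeral_eq_Suc)
  also have "\<dots> = on_legs 2 Qi (on_legs 1 Di (E 3 x))"
    using E_under[of 2 "on_legs 1 Di x"] by (simp add: numeral_eq_Suc cap_on_legs_below)
  finally show ?thesis by (simp add: T_def numeral_eq_Suc)
qed

text \<open>A contracted pair can be moved past another pair at no cost; this is why the q-trace of a
family inherits its weight.\<close>
lemma E'_T: "E' 0 (T 0 x) = E' 2 x"
  by (simp add: T_def numeral_eq_Suc E'_over[of 0, simplified] E'_under[of 1, simplified])

lemma under_moves: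
  "under_S 1 (on_legs 3 Di x) = on_legs 2 Di (under_V 1 x)"
  "under_S 1 (on_legs 2 R x) = on_legs 1 R (under_S 1 x)"
  "under_S 1 (on_legs 4 Qi x) = on_legs 3 Qi (under_S 1 x)"
  "under_V 1 (on_legs 3 D x) = on_legs 2 D (under_S 1 x)"
proof -
  have c: "on_legs 1 A (on_legs 3 B y) = on_legs 3 B (on_legs 1 A y)"
    "on_legs 4 A (on_legs 2 B y) = on_legs 2 B (on_legs 4 A y)"
    "on_legs 4 A (on_legs 1 B y) = on_legs 1 B (on_legs 4 A y)"
    "on_legs 3 A (on_legs 1 B y) = on_legs 1 B (on_legs 3 A y)"
    "on_legs 2 A (on_legs 4 B y) = on_legs 4 B (on_legs 2 A y)"
    "on_legs 1 A (on_legs 4 B y) = on_legs 4 B (on_legs 1 A y)"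
    for A B :: "complex^('n \<times> 'n)^('n \<times> 'n)" and y :: "(nat \<Rightarrow> 'n) \<Rightarrow> 'm::complex_vector"
    by (simp_all add: on_legs_commute)
  show "under_S 1 (on_legs 3 Di x) = on_legs 2 Di (under_V 1 x)"
    unfolding under_S_def under_V_def
    using c(1)[of Di Di x] under_DV[of 2 "on_legs 1 Di x"] c(2)[of Qi Di "on_legs 3 Di (on_legs 2 Qi (on_legs 1 Di x))"]
    by (simp add: numeral_eq_Suc)
  show "under_S 1 (on_legs 2 R x) = on_legs 1 R (under_S 1 x)"
    unfolding under_S_def
    using under_VV[of 1 x] c(4)[of Qi R "on_legs 2 Di (on_legs 1 Di x)"] c(3)[of Qi R "on_legs 3 Qi (on_legs 2 Di (on_legs 1 Di x))"]
    by (simp add: numeral_eq_Suc)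
  show "under_S 1 (on_legs 4 Qi x) = on_legs 3 Qi (under_S 1 x)"
    unfolding under_S_def
    using c(6)[of Di Qi x] c(5)[of Di Qi "on_legs 1 Di x"] under_DD[of 3 "on_legs 2 Di (on_legs 1 Di x)"]
    by (simp add: numeral_eq_Suc)
  show "under_V 1 (on_legs 3 D x) = on_legs 2 D (under_S 1 x)"
    unfolding under_S_def under_V_def
    using c(1)[of Di D x] under_VD[of 2 "on_legs 1 Di x"] c(2)[of Qi D "on_legs 3 Qi (on_legs 2 Di (on_legs 1 Di x))"]
    by (simp add: numeral_eq_Suc)
qed

lemma over_moves:
  "over_S 0 (on_legs 2 Di x) = on_legs 1 Di (over_V 0 x)"
  "over_S 0 (on_legs 1 R x) = on_legs 0 R (over_S 0 x)"
  "over_S 0 (on_legs 3 Qi x) = on_legs 2 Qi (over_S 0 x)"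
  "over_V 0 (on_legs 2 D x) = on_legs 1 D (over_S 0 x)"
proof -
  have c: "on_legs 0 A (on_legs 2 B y) = on_legs 2 B (on_legs 0 A y)"
    "on_legs 3 A (on_legs 1 B y) = on_legs 1 B (on_legs 3 A y)"
    "on_legs 3 A (on_legs 0 B y) = on_legs 0 B (on_legs 3 A y)"
    "on_legs 2 A (on_legs 0 B y) = on_legs 0 B (on_legs 2 A y)"
    "on_legs 1 A (on_legs 3 B y) = on_legs 3 B (on_legs 1 A y)"
    "on_legs 0 A (on_legs 3 B y) = on_legs 3 B (on_legs 0 A y)"
    for A B :: "complex^('n \<times> 'n)^('n \<times> 'n)" and y :: "(nat \<Rightarrow> 'n) \<Rightarrow> 'm::complex_vector"
    by (simp_all add: on_legs_commute)
  show "over_S 0 (on_legs 2 Di x) = on_legs 1 Di (over_V 0 x)"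
    unfolding over_S_def over_V_def
    using c(1)[of R Di x] over_DV[of 1 "on_legs 0 R x"] c(2)[of D Di "on_legs 2 R (on_legs 1 D (on_legs 0 R x))"]
    by (simp add: numeral_eq_Suc)
  show "over_S 0 (on_legs 1 R x) = on_legs 0 R (over_S 0 x)"
    unfolding over_S_def
    using over_VV[of 0 x] c(4)[of D R "on_legs 1 R (on_legs 0 R x)"] c(3)[of D R "on_legs 2 D (on_legs 1 R (on_legs 0 R x))"]
    by (simp add: numeral_eq_Suc)
  show "over_S 0 (on_legs 3 Qi x) = on_legs 2 Qi (over_S 0 x)"
    unfolding over_S_def
    using c(6)[of R Qi x] c(5)[of R Qi "on_legs 0 R x"] over_DD[of 2 "on_legs 1 R (on_legs 0 R x)"]
    by (simp add: numeral_eq_Suc)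
  show "over_V 0 (on_legs 2 D x) = on_legs 1 D (over_S 0 x)"
    unfolding over_S_def over_V_def
    using c(1)[of R D x] over_VD[of 1 "on_legs 0 R x"] c(2)[of D D "on_legs 2 D (on_legs 1 R (on_legs 0 R x))"]
    by (simp add: numeral_eq_Suc)
qed

text \<open>The braid relation for pairs. It is the reason why applying \<open>T\<close> to a product of two families does not change
the weight.\<close>
lemma T_braid: "T 0 (T 2 (T 0 x)) = T 2 (T 0 (T 2 x))"
proof -
  have "T 2 (T 0 (T 2 x)) = over_V 0 (under_V 1 (on_legs 3 D (on_legs 2 R (on_legs 4 Qi (on_legs 3 Di x)))))"
    unfolding T_T[symmetric] T_def by (simp add: numeral_eq_Suc)
  also have "\<dots> = on_legs 1 D (on_legs 0 R (on_legs 2 Qi (on_legs 1 Di (over_V 0 (under_V 1 x)))))"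
    by (simp only: under_moves over_moves)
  also have "\<dots> = T 0 (T 2 (T 0 x))"
    unfolding T_T[symmetric] by (simp add: T_def numeral_eq_Suc)
  finally show ?thesis by simp
qed

end

section \<open>Weights\<close>

text \<open>For \<open>s = r\<close> the Dynkin diagram is traversed from its other end. In this numbering of the nodes, \<open>V\<close> is in both
cases the vector representation, in which the \<open>j\<close>-th lowering operator takes the \<open>j\<close>-th weight to the next one.\<close>
definition node :: "nat \<Rightarrow> nat \<Rightarrow> nat \<Rightarrow> nat"
  where "node r s j = (if s = 1 then j else r + 1 - j)"

text \<open>The pairing of the \<open>j\<close>-th simple root with the \<open>k\<close>-th weight of the vector representation.\<close>
definition nu :: "nat \<Rightarrow> nat \<Rightarrow> real"
  where "nu j k = (if k = j then 1 else 0) - (if k = j + 1 then 1 else 0)"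

lemma node_in: "j \<in> {1..r} \<Longrightarrow> node r s j \<in> {1..r}"
  by (auto simp: node_def)

lemma node_node: "j \<in> {1..r} \<Longrightarrow> node r s (node r s j) = j"
  by (auto simp: node_def)

lemma node_inj: "i \<in> {1..r} \<Longrightarrow> j \<in> {1..r} \<Longrightarrow> node r s i = node r s j \<longleftrightarrow> i = j"
  by (auto simp: node_def)

lemma wform_alpha: 
  assumes "i \<in> {1..r}" shows "wform r (alpha i) \<mu> = \<mu> i - \<mu> (i + 1)"
proof -
  have "wform r (alpha i) \<mu> = (\<Sum>k=1..r+1. (if k = i then \<mu> k else 0) - (if k = i + 1 then \<mu> k else 0))"
    unfolding wform_def by (intro sum.cong) (auto simp: alpha_def)
  also have "\<dots> = \<mu> i - \<mu> (i + 1)" using assms by (simp add: sum_subtractf)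
  finally show ?thesis .
qed

lemma wform_alpha_omega:
  assumes "i \<in> {1..r}" "l \<in> {1..r}"
  shows "wform r (alpha i) (omega r l) = (if i = l then 1 else 0)"
  using assms by (auto simp: wform_alpha omega_def)

lemma wform_alpha_node:
  assumes "s \<in> {1, r}" "i \<in> {1..r}" "j \<in> {1..r}"
  shows "wform r (alpha (node r s i)) (alpha (node r s j)) = nu i j - nu i (j + 1)"
proof -
  have "wform r (alpha (node r s i)) (alpha (node r s j))
      = alpha (node r s j) (node r s i) - alpha (node r s j) (node r s i + 1)"
    by (rule wform_alpha[OF node_in[OF assms(2)]])
  also have "\<dots> = nu i j - nu i (j + 1)"
  proof (cases "s = 1")
    case True
    then show ?thesis by (simp add: alpha_def nu_def node_def)
  next
    case False
    have "i \<le> r" "j \<le> r" using assms by auto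
    then have c: "r + 1 - i = r + 1 - j \<longleftrightarrow> j = i" "r + 1 - i = r + 1 - j + 1 \<longleftrightarrow> j = i + 1"
      "r + 1 - i + 1 = r + 1 - j \<longleftrightarrow> j + 1 = i" "r + 1 - i + 1 = r + 1 - j + 1 \<longleftrightarrow> j = i"
      by linarith+
    have "alpha (r + 1 - j) (r + 1 - i) = (if j = i then 1 else if j = i + 1 then - 1 else 0)"
      "alpha (r + 1 - j) (r + 1 - i + 1) = (if j + 1 = i then 1 else if j = i then - 1 else 0)"
      unfolding alpha_def by (simp_all only: c)
    then show ?thesis using False by (simp add: nu_def node_def)
  qed
  finally show ?thesis .
qed

text \<open>Two weights of the vector representation differ by the simple root \<open>\<alpha>\<^sub>j\<close> only if they are the \<open>j\<close>-th and
the next one: this locates the nonzero entries of raising and lowering operators.\<close>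
lemma nu_difference:
  assumes k: "k \<in> {1..r+1}" "k' \<in> {1..r+1}" and j: "j \<in> {1..r}"
    and eq: "\<And>l. l \<in> {1..r} \<Longrightarrow> nu l k' - nu l k = nu l j - nu l (j + 1)"
  shows "k' = j \<and> k = j + 1"
proof -
  define e :: "nat \<Rightarrow> nat \<Rightarrow> real" where "e k = (\<lambda>l. if l = k then 1 else 0)" for k
  define y where "y l = e k' l + e (j + 1) l - e k l - e j l" for l
  have step: "y (l + 1) = y l" if "l \<in> {1..r}" for l
  proof -
    have nu: "nu l k = e k l - e k (l + 1)" for k by (simp add: nu_def e_def)
    show ?thesis using eq[OF that] unfolding nu y_def by linarith
  qed
  have y1: "y (Suc l) = y 1" if "l \<le> r" for l
    using that
  proof (induction l)
    case (Suc l)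
    then show ?case using step[of "Suc l"] by simp
  qed simp
  have s1: "(\<Sum>l=1..r+1. e k l) = 1" if "k \<in> {1..r+1}" for k
    using that by (simp add: e_def)
  have a1: "(\<Sum>l=1..r+1. y l) = 0"
    using s1[of k'] s1[of "j+1"] s1[of k] s1[of j] k j unfolding y_def sum.distrib sum_subtractf by simp
  have a2: "(\<Sum>l=1..r+1. y l) = real (r + 1) * y 1"
  proof -
    have "(\<Sum>l=1..r+1. y l) = (\<Sum>l=1..r+1. y 1)"
    proof (intro sum.cong refl)
      fix l assume "l \<in> {1..r+1}"
      then obtain l' where "l = Suc l'" "l' \<le> r" by (cases l) auto
      then show "y l = y 1" using y1[of l'] by simp
    qed
    then show ?thesis by simp
  qed
  have "real (r + 1) * y 1 = 0" by (rule trans[OF a2[symmetric] a1])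
  then have "y 1 = 0" by (simp del: of_nat_add)
  then have y0: "y (Suc l) = 0" if "l \<le> r" for l using y1[OF that] by simp
  have "k' = j"
  proof -
    obtain j' where j': "j = Suc j'" using j by (cases j) auto
    have "y j = e k' j + 0 - e k j - 1" by (simp add: y_def e_def)
    then have "e k' j + 0 - e k j - 1 = 0" using y0[of j'] j j' by simp
    then show ?thesis by (simp add: e_def split: if_splits)
  qed
  moreover have "k = j + 1"
  proof -
    have "y (Suc j) = 1 - e k (j + 1)" using \<open>k' = j\<close> by (simp add: y_def e_def)
    then have "1 - e k (j + 1) = 0" using y0[of j] j by simp
    then show ?thesis by (simp add: e_def split: if_splits)
  qed
  ultimately show ?thesis by simp
qed

lemma nu_inj:
  assumes "k \<in> {1..r+1}" "k' \<in> {1..r+1}" "\<And>l. l \<in> {1..r} \<Longrightarrow> nu l k' = nu l k"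
  shows "k' = k"
proof (rule ccontr)
  assume "k' \<noteq> k"
  then consider "k < k'" | "k' < k" by linarith
  then show False
  proof cases
    case 1 then have "k \<in> {1..r}" using assms(1,2) by simp
    from assms(3)[OF this] 1 show False by (simp add: nu_def split: if_splits)
  next
    case 2 then have "k' \<in> {1..r}" using assms(1,2) by simp
    from assms(3)[OF this] 2 show False by (simp add: nu_def split: if_splits)
  qed
qed

lemma sum_omega: "(\<Sum>k=1..r+1. omega r l k) = 0" if "l \<in> {1..r}"
proof -
  have "(\<Sum>k=1..r+1. omega r l k) = (\<Sum>k=1..r+1. (if k \<le> l then 1 else 0) - real l / real (r + 1))"
    by (intro sum.cong) (auto simp: omega_def)
  also have "\<dots> = (\<Sum>k=1..r+1. if k \<le> l then 1 else 0) - real l"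
    by (simp add: sum_subtractf)
  also have "(\<Sum>k=1..r+1. if k \<le> l then 1 else (0::real)) = real (card {k\<in>{1..r+1}. k \<le> l})"
    by (subst sum.inter_filter[symmetric]) simp_all
  also have "{k\<in>{1..r+1}. k \<le> l} = {1..l}" using that by auto
  finally show ?thesis by simp
qed

lemma wform_omega:
  assumes "s \<in> {1, r}" "1 \<le> r" "(\<Sum>k=1..r+1. \<mu> k) = 0"
  shows "wform r (omega r s) \<mu> = (if s = 1 then \<mu> 1 else - \<mu> (r + 1))"
proof -
  have "wform r (omega r s) \<mu> = (\<Sum>k=1..r+1. (if k \<le> s then \<mu> k else 0) - real s / real (r + 1) * \<mu> k)"
    unfolding wform_def by (intro sum.cong) (auto simp: omega_def algebra_simps)
  also have "\<dots> = (\<Sum>k=1..r+1. if k \<le> s then \<mu> k else 0) - real s / real (r + 1) * (\<Sum>k=1..r+1. \<mu> k)"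
    by (simp only: sum_subtractf sum_distrib_left)
  also have "\<dots> = (\<Sum>k\<in>{k\<in>{1..r+1}. k \<le> s}. \<mu> k)"
    unfolding assms(3) by (subst sum.inter_filter[symmetric]) simp_all
  also have "{k\<in>{1..r+1}. k \<le> s} = {1..s}" using assms by auto
  also have "(\<Sum>k=1..s. \<mu> k) = (if s = 1 then \<mu> 1 else - \<mu> (r + 1))"
    using assms by auto
  finally show ?thesis .
qed

lemma two_rho_eq: "two_rho r k = real r + 2 - 2 * real k" if "k \<in> {1..r+1}"
proof -
  have "(\<Sum>i=1..r. omega r i k) = (\<Sum>i=1..r. (if k \<le> i then 1 else 0) - real i / real (r + 1))"
    using that by (intro sum.cong) (auto simp: omega_def)
  also have "\<dots> = (\<Sum>i=1..r. if k \<le> i then 1 else 0) - real (\<Sum>i=1..r. i) / real (r + 1)"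
    by (simp add: sum_subtractf sum_divide_distrib)
  also have "(\<Sum>i=1..r. if k \<le> i then 1 else (0::real)) = real (card {i\<in>{1..r}. k \<le> i})"
    by (subst sum.inter_filter[symmetric]) simp_all
  also have "{i\<in>{1..r}. k \<le> i} = {k..r}" using that by auto
  also have "real (\<Sum>i=1..r. i) = real r * real (r + 1) / 2"
    by (induction r) (simp_all add: field_simps)
  also have "real r * real (r + 1) / 2 / real (r + 1) = real r / 2"
    by (simp del: of_nat_add of_nat_Suc)
  finally show ?thesis using that by (simp add: two_rho_def of_nat_diff)
qed

lemma const_m_eq:
  assumes "s \<in> {1, r}" "1 \<le> r" shows "const_m r s = real r"
proof -
  have "(\<Sum>k=1..r+1. two_rho r k) = (\<Sum>i=1..r. 2 * (\<Sum>k=1..r+1. omega r i k))"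
    unfolding two_rho_def by (simp only: sum_distrib_left) (rule sum.swap)
  also have "\<dots> = 0" 
  proof (rule sum.neutral, rule ballI)
    fix i assume "i \<in> {1..r}"
    then show "2 * (\<Sum>k=1..r+1. omega r i k) = 0" by (subst sum_omega) simp_all
  qed
  finally have "const_m r s = (if s = 1 then two_rho r 1 else - two_rho r (r + 1))"
    unfolding const_m_def by (intro wform_omega assms)
  then show ?thesis using assms by (simp add: two_rho_eq)
qed

lemma const_a_eq: "s \<in> {1, r} \<Longrightarrow> 1 \<le> r \<Longrightarrow> const_a r s = 2"
  by (subst const_a_def, subst wform_alpha) (auto simp: alpha_def)

lemma sum_weyl: "(\<Sum>k=1..r+1. weyl_w0 r \<mu> k) = (\<Sum>k=1..r+1. \<mu> k)"
  by (rule sum.reindex_bij_witness[of _ "\<lambda>k. r + 2 - k" "\<lambda>k. r + 2 - k"]) (auto simp: weyl_w0_def)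

lemma const_w_eq:
  assumes "s \<in> {1, r}" "1 \<le> r" shows "const_w r s = real r / (1 + real r)"
proof -
  have "s \<in> {1..r}" using assms by auto
  then have "const_w r s = (if s = 1 then omega r s 1 else - omega r s (r + 1))"
    unfolding const_w_def by (intro wform_omega assms sum_omega)
  moreover have "1 - 1 / (1 + real r) = real r / (1 + real r)" by (simp add: field_simps)
  ultimately show ?thesis using assms by (auto simp: omega_def)
qed

lemma wform_omega_w0:
  assumes "s \<in> {1, r}" "1 \<le> r"
  shows "wform r (omega r s) (weyl_w0 r (omega r s)) = const_w r s - 1"
    and "wform r (omega r s) (weyl_w0 r (omega r (r + 1 - s))) = - const_w r s"
    and "wform r (omega r (r + 1 - s)) (weyl_w0 r (omega r (r + 1 - s))) = const_w r s - 1"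
proof -
  have s: "r + 1 - s \<in> {1, r}" "s \<in> {1..r}" "r + 1 - s \<in> {1..r}" using assms by auto
  have h: "1 - 1 / (1 + real r) = real r / (1 + real r)" by (simp add: field_simps)
  have z: "(\<Sum>k=1..r+1. weyl_w0 r (omega r l) k) = 0" if "l \<in> {1..r}" for l
    by (simp only: sum_weyl sum_omega[OF that])
  have "wform r (omega r s) (weyl_w0 r (omega r s)) = (if s = 1 then weyl_w0 r (omega r s) 1 else - weyl_w0 r (omega r s) (r + 1))"
    by (intro wform_omega z s assms)
  then show "wform r (omega r s) (weyl_w0 r (omega r s)) = const_w r s - 1"
    using assms h by (auto simp: const_w_eq weyl_w0_def omega_def)
  have "wform r (omega r s) (weyl_w0 r (omega r (r + 1 - s))) = (if s = 1 then weyl_w0 r (omega r (r + 1 - s)) 1 else - weyl_w0 r (omega r (r + 1 - s)) (r + 1))"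
    by (intro wform_omega z s assms)
  then show "wform r (omega r s) (weyl_w0 r (omega r (r + 1 - s))) = - const_w r s"
    using assms h by (auto simp: const_w_eq weyl_w0_def omega_def)
  have "wform r (omega r (r + 1 - s)) (weyl_w0 r (omega r (r + 1 - s))) = (if (r + 1 - s) = 1 then weyl_w0 r (omega r (r + 1 - s)) 1 else - weyl_w0 r (omega r (r + 1 - s)) (r + 1))"
    by (intro wform_omega z s assms)
  then show "wform r (omega r (r + 1 - s)) (weyl_w0 r (omega r (r + 1 - s))) = const_w r s - 1"
    using assms h by (auto simp: const_w_eq weyl_w0_def omega_def)
qed

text \<open>The module sees a weight only through its pairings with simple roots. Those determine the pairing with \<open>2\<rho>\<close>,
because \<open>2\<rho>\<close> is the combination of simple roots with coefficients \<open>i (r + 1 - i)\<close>.\<close>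
lemma wform_two_rho:
  assumes "1 \<le> r"
  shows "wform r \<mu> (two_rho r) = (\<Sum>i=1..r. real i * real (r + 1 - i) * wform r (alpha i) \<mu>)"
proof -
  have "(\<Sum>i=1..r. real i * real (r + 1 - i) * wform r (alpha i) \<mu>)
    = (\<Sum>i=1..r. real i * real (r + 1 - i) * \<mu> i) - (\<Sum>i=1..r. real i * real (r + 1 - i) * \<mu> (i + 1))"
    by (simp add: wform_alpha right_diff_distrib flip: sum_subtractf)
  also have "(\<Sum>i=1..r. real i * real (r + 1 - i) * \<mu> i) = (\<Sum>k=1..r+1. real k * real (r + 1 - k) * \<mu> k)"
    by simp
  also have "(\<Sum>i=1..r. real i * real (r + 1 - i) * \<mu> (i + 1)) = (\<Sum>k=2..r+1. real (k - 1) * real (r + 2 - k) * \<mu> k)"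
    by (rule sum.reindex_bij_witness[of _ "\<lambda>k. k - 1" "\<lambda>k. k + 1"]) auto
  also have "\<dots> = (\<Sum>k=1..r+1. real (k - 1) * real (r + 2 - k) * \<mu> k)"
    by (rule sum.mono_neutral_left) (auto simp: not_le less_Suc_eq numeral_2_eq_2)
  also have "(\<Sum>k=1..r+1. real k * real (r + 1 - k) * \<mu> k) - (\<Sum>k=1..r+1. real (k - 1) * real (r + 2 - k) * \<mu> k)
    = (\<Sum>k=1..r+1. \<mu> k * two_rho r k)"
    unfolding sum_subtractf[symmetric]
    by (intro sum.cong refl) (auto simp: two_rho_eq of_nat_diff algebra_simps)
  finally show ?thesis by (simp add: wform_def)
qed

lemma wform_two_rho_nu:
  assumes "1 \<le> r" "s \<in> {1, r}" "k \<in> {1..r+1}"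
    and "\<And>j. j \<in> {1..r} \<Longrightarrow> wform r (alpha (node r s j)) \<mu> = nu j k"
  shows "wform r \<mu> (two_rho r) = real r + 2 - 2 * real k"
proof -
  have "wform r \<mu> (two_rho r) = (\<Sum>i=1..r. real i * real (r + 1 - i) * wform r (alpha i) \<mu>)"
    by (rule wform_two_rho) fact
  also have "\<dots> = (\<Sum>j=1..r. real (node r s j) * real (r + 1 - node r s j) * wform r (alpha (node r s j)) \<mu>)"
    using node_in[of _ r s] node_node[of _ r s]
    by (intro sum.reindex_bij_witness[of _ "node r s" "node r s"]) auto
  also have "\<dots> = (\<Sum>j=1..r. real j * real (r + 1 - j) * nu j k)"
  proof (intro sum.cong refl)
    fix j assume j: "j \<in> {1..r}"
    then have "real (node r s j) * real (r + 1 - node r s j) = real j * real (r + 1 - j)"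
      by (auto simp: node_def of_nat_diff)
    then show "real (node r s j) * real (r + 1 - node r s j) * wform r (alpha (node r s j)) \<mu>
        = real j * real (r + 1 - j) * nu j k"
      by (simp add: assms(4)[OF j])
  qed
  also have "\<dots> = (\<Sum>j=1..r. (if j = k then real j * real (r + 1 - j) else 0) - (if j = k - 1 then real j * real (r + 1 - j) else 0))"
    using assms(3) by (intro sum.cong refl) (auto simp: nu_def)
  also have "\<dots> = real k * real (r + 1 - k) - real (k - 1) * real (r + 2 - k)"
    using assms(1,3) by (auto simp: sum_subtractf)
  also have "\<dots> = real r + 2 - 2 * real k"
    using assms(3) by (auto simp: of_nat_diff algebra_simps)
  finally show ?thesis .
qed

section \<open>The module with highest weight \<open>\<omega>\<^sub>s\<close>\<close>

lemma matrix_vector_axis: "(A *v axis b 1) $ a = A $ a $ (b :: 'n::finite)" for A :: "complex^'n^'m"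
  by (simp add: matrix_vector_mult_def axis_def if_distrib[of "\<lambda>u. _ * u"] cong: if_cong)

lemma scaleR_matrix_vector: "(c *\<^sub>R A) *v x = c *\<^sub>R (A *v x)" for A :: "complex^'n::finite^'m::finite"
  by (simp add: matrix_vector_mult_def vec_eq_iff scaleR_sum_right)

lemma matrix_vector_diff: "(A - B) *v x = A *v x - B *v x" for A :: "complex^'n::finite^'m::finite"
  by (simp add: matrix_vector_mult_def vec_eq_iff sum_subtractf left_diff_distrib)

lemma powr_inj_iff: "0 < q \<Longrightarrow> q < 1 \<Longrightarrow> q powr x = q powr y \<longleftrightarrow> x = (y::real)"
  by (metis powr_inj less_irrefl)

lemma uq_module_relations:
  assumes "uq_module r q X" "i \<in> {1..r}" "j \<in> {1..r}"
  shows "X (GK i) ** X (GE j) ** X (GKinv i) = (q powr wform r (alpha i) (alpha j)) *\<^sub>R X (GE j)"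
    and "X (GK i) ** X (GF j) ** X (GKinv i) = (q powr - wform r (alpha i) (alpha j)) *\<^sub>R X (GF j)"
    and "X (GE i) ** X (GF j) - X (GF j) ** X (GE i) =
        (if i = j then (1 / (q - 1 / q)) *\<^sub>R (X (GK i) - X (GKinv i)) else 0)"
  using assms(1)[unfolded uq_module_def, THEN conjunct2, THEN conjunct1, rule_format, OF assms(2,3)]
  by blast+

text \<open>The generators act in the weight basis as in the vector representation, \<open>idx\<close> numbering the basis from the
highest weight to the lowest. Of the raising and lowering operators only the positions of the nonzero entries are recorded:
their values depend on the scaling of the basis vectors.\<close>
definition vector_module where
  "vector_module r s q X idx \<longleftrightarrow> bij_betw idx UNIV {1..r+1} \<and>
    (\<forall>j\<in>{1..r}. \<forall>a b.
      X (GK (node r s j)) $ a $ b = (if a = b then complex_of_real (q powr nu j (idx b)) else 0) \<and>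
      X (GKinv (node r s j)) $ a $ b = (if a = b then complex_of_real (q powr - nu j (idx b)) else 0) \<and>
      (X (GE (node r s j)) $ a $ b \<noteq> 0 \<longleftrightarrow> idx a = j \<and> idx b = j + 1) \<and>
      (X (GF (node r s j)) $ a $ b \<noteq> 0 \<longleftrightarrow> idx b = j \<and> idx a = j + 1))"

text \<open>Apply the lowering operators of the nodes \<open>1, 2, ..., r\<close> in turn to the highest weight vector. The commutator of
raising and lowering operators takes each vector so obtained back to the previous one, so none of them
vanishes. Their \<open>r + 1\<close> weights are distinct, so by counting dimensions these are all the weights, each of
multiplicity one, and weights alone then decide which entries of the generators can be nonzero.\<close>
lemma vector_module_exists:
  fixes X :: "('n::finite) rep"
  assumes r: "1 \<le> r" and card: "CARD('n) = r + 1" and q: "0 < q" "q < 1" and s: "s \<in> {1, r}"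
    and X: "uq_module r q X" and wt: "weight_basis r q X wt"
    and v: "highest_weight_vector r q X (omega r s) v"
  obtains idx where "vector_module r s q X idx"
    and "\<And>b. wform r (wt b) (two_rho r) = real r + 2 - 2 * real (idx b)"
    and "\<And>b. idx b = 1 \<Longrightarrow> highest_weight_vector r q X (omega r s) (axis b 1)"
proof -
  let ?n = "node r s"
  define l where "l i b = wform r (alpha i) (wt b)" for i b
  have K: "X (GK i) $ a $ b = (if a = b then complex_of_real (q powr l i b) else 0)" if i: "i \<in> {1..r}" for i a b
  proof -
    have "X (GK i) *v axis b 1 = (q powr l i b) *\<^sub>R axis b 1"
      using wt i by (auto simp: weight_basis_def weight_vector_def l_def)
    then have "X (GK i) $ a $ b = ((q powr l i b) *\<^sub>R (axis b 1 :: complex^'n)) $ a"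
      by (simp add: matrix_vector_axis[symmetric])
    then have "X (GK i) $ a $ b = (q powr l i b) *\<^sub>R ((axis b 1 :: complex^'n) $ a)"
      by (simp only: vector_scaleR_component)
    then show ?thesis by (simp add: axis_def scaleR_conv_of_real)
  qed
  have Kv: "(X (GK i) *v x) $ a = complex_of_real (q powr l i a) * x $ a" if i: "i \<in> {1..r}" for i a x
    using i by (simp add: matrix_vector_mult_def K if_distrib[of "\<lambda>u. u * _"] cong: if_cong)
  have inv: "X (GK i) ** X (GKinv i) = mat 1" "X (GKinv i) ** X (GK i) = mat 1" if i: "i \<in> {1..r}" for i
    using X i by (auto simp: uq_module_def)
  have Kinv: "X (GKinv i) $ a $ b = (if a = b then complex_of_real (q powr - l i b) else 0)" if i: "i \<in> {1..r}" for i a b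
  proof -
    have "(X (GK i) ** X (GKinv i)) $ a $ b = (if a = b then 1 else 0)"
      unfolding inv(1)[OF i] by (simp add: mat_def)
    then have "complex_of_real (q powr l i a) * X (GKinv i) $ a $ b = (if a = b then 1 else 0)"
      using i by (simp add: matrix_matrix_mult_def K if_distrib[of "\<lambda>u. u * _"] cong: if_cong)
    then show ?thesis using q by (auto simp: powr_minus field_simps split: if_splits)
  qed
  have shift: "complex_of_real (q powr l i a) * Y $ a $ b = complex_of_real (q powr (c + l i b)) * Y $ a $ b"
    if i: "i \<in> {1..r}" and Y: "X (GK i) ** Y ** X (GKinv i) = (q powr c) *\<^sub>R Y" for i Y c a b
  proof -
    have "X (GK i) ** Y = X (GK i) ** Y ** X (GKinv i) ** X (GK i)"
      by (simp only: inv(2)[OF i] matrix_mul_assoc[symmetric] matrix_mul_rid)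
    also have "\<dots> = ((q powr c) *\<^sub>R Y) ** X (GK i)" by (simp only: Y)
    finally have "(X (GK i) ** Y) $ a $ b = (((q powr c) *\<^sub>R Y) ** X (GK i)) $ a $ b" by simp
    then have "complex_of_real (q powr l i a) * Y $ a $ b = q powr c *\<^sub>R (Y $ a $ b * complex_of_real (q powr l i b))"
      using i by (simp add: matrix_matrix_mult_def K if_distrib[of "\<lambda>u. u * _"] if_distrib[of "\<lambda>u. _ * u"]
          if_distrib[of "scaleR _"] cong: if_cong)
    then show ?thesis by (simp only: scaleR_conv_of_real powr_add of_real_mult mult_ac)
  qed
  \<comment> \<open>Raising and lowering operators change weights by simple roots.\<close>
  have shiftE: "l (?n i) a = l (?n i) b + nu i j - nu i (j + 1)"
    if "X (GE (?n j)) $ a $ b \<noteq> 0" "i \<in> {1..r}" "j \<in> {1..r}" for i j a b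
  proof -
    have "X (GK (?n i)) ** X (GE (?n j)) ** X (GKinv (?n i)) = (q powr (nu i j - nu i (j + 1))) *\<^sub>R X (GE (?n j))"
      unfolding uq_module_relations(1)[OF X node_in[OF that(2)] node_in[OF that(3)]] wform_alpha_node[OF s that(2,3)] ..
    from shift[OF node_in this, of a b] that have "q powr l (?n i) a = q powr (nu i j - nu i (j + 1) + l (?n i) b)"
      by simp
    then show ?thesis by (simp add: powr_inj_iff q)
  qed
  have shiftF: "l (?n i) a = l (?n i) b - nu i j + nu i (j + 1)"
    if "X (GF (?n j)) $ a $ b \<noteq> 0" "i \<in> {1..r}" "j \<in> {1..r}" for i j a b
  proof -
    have "X (GK (?n i)) ** X (GF (?n j)) ** X (GKinv (?n i)) = (q powr - (nu i j - nu i (j + 1))) *\<^sub>R X (GF (?n j))"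
      unfolding uq_module_relations(2)[OF X node_in[OF that(2)] node_in[OF that(3)]] wform_alpha_node[OF s that(2,3)] ..
    from shift[OF node_in this, of a b] that have "q powr l (?n i) a = q powr (- (nu i j - nu i (j + 1)) + l (?n i) b)"
      by simp
    then show ?thesis by (simp add: powr_inj_iff q)
  qed
  have EF: "X (GE (?n i)) *v (X (GF (?n j)) *v x) = X (GF (?n j)) *v (X (GE (?n i)) *v x) +
      (if i = j then (1 / (q - 1 / q)) *\<^sub>R (X (GK (?n j)) *v x - X (GKinv (?n j)) *v x) else 0)"
    if "i \<in> {1..r}" "j \<in> {1..r}" for i j x
  proof -
    have "X (GE (?n i)) ** X (GF (?n j)) - X (GF (?n j)) ** X (GE (?n i)) =
        (if i = j then (1 / (q - 1 / q)) *\<^sub>R (X (GK (?n j)) - X (GKinv (?n j))) else 0)"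
      unfolding uq_module_relations(3)[OF X node_in[OF that(1)] node_in[OF that(2)]] node_inj[OF that]
      by (rule if_cong) auto
    from arg_cong[OF this, of "\<lambda>A. A *v x"]
    show ?thesis
      by (cases "i = j") (simp_all only: matrix_vector_diff scaleR_matrix_vector matrix_vector_mul_assoc[symmetric]
          if_True if_False diff_eq_eq add.commute matrix_vector_mult_0 add_0_left add_0_right simp_thms)
  qed
  have n1: "?n 1 = s" using s r by (auto simp: node_def)
  have v0: "v \<noteq> 0" and vK: "\<And>i. i \<in> {1..r} \<Longrightarrow> X (GK i) *v v = (q powr wform r (alpha i) (omega r s)) *\<^sub>R v"
    and vE: "\<And>i. i \<in> {1..r} \<Longrightarrow> X (GE i) *v v = 0"
    using v by (auto simp: highest_weight_vector_def weight_vector_def)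
  \<comment> \<open>The vectors reached from the highest weight vector by lowering along the chain of nodes.\<close>
  define u where "u = rec_nat v (\<lambda>k x. X (GF (?n (Suc k))) *v x)"
  have u0: "u 0 = v" and uS: "\<And>k. u (Suc k) = X (GF (?n (Suc k))) *v u k" by (simp_all add: u_def)
  have supp: "l (?n j) b = nu j (k + 1)" if "k \<le> r" "u k $ b \<noteq> 0" "j \<in> {1..r}" for k b j
    using that
  proof (induction k arbitrary: b)
    case 0
    have "(X (GK (?n j)) *v v) $ b = ((q powr wform r (alpha (?n j)) (omega r s)) *\<^sub>R v) $ b"
      using vK[OF node_in[OF 0(3)]] by simp
    then have "complex_of_real (q powr l (?n j) b) * v $ b = (q powr wform r (alpha (?n j)) (omega r s)) *\<^sub>R (v $ b)"
      unfolding Kv[OF node_in[OF 0(3)]] vector_scaleR_component .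
    then have "q powr l (?n j) b = q powr wform r (alpha (?n j)) (omega r s)"
      using 0(2) by (simp add: u0 scaleR_conv_of_real)
    then have "l (?n j) b = wform r (alpha (?n j)) (omega r s)" by (simp add: powr_inj_iff q)
    also have "\<dots> = (if ?n j = ?n 1 then 1 else 0)"
      unfolding n1 using s r by (subst wform_alpha_omega[OF node_in[OF 0(3)]]) auto
    also have "\<dots> = nu j (0 + 1)" using node_inj[OF 0(3), of 1 s] 0(3) r by (auto simp: nu_def)
    finally show ?case .
  next
    case (Suc k)
    have "(\<Sum>c\<in>UNIV. X (GF (?n (Suc k))) $ b $ c * u k $ c) \<noteq> 0"
      using Suc.prems(2) by (simp add: uS matrix_vector_mult_def)
    then obtain c where "X (GF (?n (Suc k))) $ b $ c \<noteq> 0" "u k $ c \<noteq> 0"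
      by (metis (no_types, lifting) mult_eq_0_iff sum.neutral)
    then show ?case using shiftF[of "Suc k" b c j] Suc.IH[of c] Suc.prems by simp
  qed
  have Ev: "X (GE (?n j)) *v u k = 0" if "k < j" "j \<le> r" for k j
    using that
  proof (induction k)
    case 0 then show ?case using vE[OF node_in[of j r s]] by (simp add: u0)
  next
    case (Suc k) then show ?case using EF[of j "Suc k" "u k"] by (simp add: uS)
  qed
  \<comment> \<open>The pairing of the weight of \<open>u k\<close> with the next simple root is \<open>1\<close>, so the commutator acts on it by the q-number \<open>[1] = 1\<close>.\<close>
  have EFu: "X (GE (?n (Suc k))) *v u (Suc k) = u k" if "k < r" for k
  proof -
    let ?i = "?n (Suc k)"
    have i: "?i \<in> {1..r}" using that by (intro node_in) auto
    have sup: "l ?i b = 1" if "u k $ b \<noteq> 0" for b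
      using supp[OF _ that, of "Suc k"] \<open>k < r\<close> by (simp add: nu_def)
    have "X (GK ?i) *v u k = q *\<^sub>R u k"
      unfolding vec_eq_iff vector_scaleR_component Kv[OF i]
    proof
      fix b show "complex_of_real (q powr l ?i b) * u k $ b = q *\<^sub>R (u k $ b)"
        using sup[of b] q by (cases "u k $ b = 0") (simp_all add: scaleR_conv_of_real)
    qed
    moreover from arg_cong[OF this, of "\<lambda>x. X (GKinv ?i) *v x"] have "X (GKinv ?i) *v u k = (1 / q) *\<^sub>R u k"
    proof -
      have "(X (GKinv ?i) *v u k) $ b = ((1 / q) *\<^sub>R u k) $ b" for b
      proof -
        have "(X (GKinv ?i) *v u k) $ b = complex_of_real (q powr - l ?i b) * u k $ b"
          using i by (simp add: matrix_vector_mult_def Kinv if_distrib[of "\<lambda>u. u * _"] cong: if_cong)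
        moreover have "complex_of_real (q powr - l ?i b) * u k $ b = (1 / q) *\<^sub>R (u k $ b)"
          using sup[of b] q by (cases "u k $ b = 0") (simp_all add: powr_minus scaleR_conv_of_real field_simps)
        ultimately show ?thesis unfolding vector_scaleR_component by simp
      qed
      then show ?thesis by (simp add: vec_eq_iff)
    qed
    moreover have "X (GE ?i) *v u (Suc k) = X (GF ?i) *v (X (GE ?i) *v u k) + (1 / (q - 1 / q)) *\<^sub>R (X (GK ?i) *v u k - X (GKinv ?i) *v u k)"
      using EF[of "Suc k" "Suc k" "u k"] that by (simp add: uS)
    moreover have "X (GE ?i) *v u k = 0" using Ev[of k "Suc k"] that by simp
    moreover have "q - 1 / q \<noteq> 0" using q mult_strict_mono[of q 1 q 1] by (simp add: field_simps)
    ultimately show ?thesis by (simp add: scaleR_diff_left[symmetric])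
  qed
  have unz: "u k \<noteq> 0" if "k \<le> r" for k
    using that
  proof (induction k)
    case 0 then show ?case using v0 u0 by simp
  next
    case (Suc k) then show ?case using EFu[of k] by (metis Suc_leD Suc_le_lessD matrix_vector_mult_0_right)
  qed
  \<comment> \<open>A basis vector that occurs in \<open>u (k - 1)\<close>; the weights show that there is no other.\<close>
  define \<beta> where "\<beta> k = (SOME b. u (k - 1) $ b \<noteq> 0)" for k
  have \<beta>: "u (k - 1) $ \<beta> k \<noteq> 0" if "k \<in> {1..r+1}" for k
  proof -
    have "\<exists>b. u (k - 1) $ b \<noteq> 0" using unz[of "k - 1"] that by (auto simp: vec_eq_iff)
    then show ?thesis unfolding \<beta>_def by (rule someI_ex)
  qed
  have l\<beta>: "l (?n j) b = nu j k" if "k \<in> {1..r+1}" "j \<in> {1..r}" "u (k - 1) $ b \<noteq> 0" for j k b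
    using supp[of "k - 1" b j] that by auto
  have inj: "inj_on \<beta> {1..r+1}"
  proof (rule inj_onI)
    fix k k' assume k: "k \<in> {1..r+1}" "k' \<in> {1..r+1}" "\<beta> k = \<beta> k'"
    show "k = k'"
    proof (rule nu_inj[OF k(2,1)])
      fix j assume j: "j \<in> {1..r}"
      show "nu j k = nu j k'" using l\<beta>[OF k(1) j \<beta>[OF k(1)]] l\<beta>[OF k(2) j \<beta>[OF k(2)]] k(3) by simp
    qed
  qed
  have bij: "bij_betw \<beta> {1..r+1} UNIV"
    unfolding bij_betw_def
  proof
    show "\<beta> ` {1..r+1} = UNIV"
      by (rule card_subset_eq) (simp_all add: card_image[OF inj, simplified] card)
  qed (rule inj)
  define idx where "idx = inv_into {1..r+1} \<beta>"
  have idx: "bij_betw idx UNIV {1..r+1}" unfolding idx_def by (rule bij_betw_inv_into) (rule bij)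
  have idx_in: "idx b \<in> {1..r+1}" for b using idx by (auto simp: bij_betw_def)
  have \<beta>idx: "\<beta> (idx b) = b" for b unfolding idx_def by (rule bij_betw_inv_into_right[OF bij]) simp
  have idx_inj: "idx a = idx b \<longleftrightarrow> a = b" for a b using \<beta>idx by metis
  have lidx: "l (?n j) b = nu j (idx b)" if "j \<in> {1..r}" for j b
    using l\<beta>[OF idx_in that \<beta>, OF idx_in] by (simp add: \<beta>idx)
  have usupp: "u (k - 1) $ b \<noteq> 0 \<longleftrightarrow> idx b = k" if "k \<in> {1..r+1}" for k b
  proof
    assume "idx b = k" then show "u (k - 1) $ b \<noteq> 0" using \<beta>[OF that] \<beta>idx[of b] by auto
  next
    assume b: "u (k - 1) $ b \<noteq> 0"
    show "idx b = k"
    proof (rule nu_inj[OF that idx_in])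
      fix j assume j: "j \<in> {1..r}"
      show "nu j (idx b) = nu j k" using l\<beta>[OF that j b] lidx[OF j, of b] by simp
    qed
  qed
  have act: "(Y *v u (k - 1)) $ a = Y $ a $ b * u (k - 1) $ b" if "k \<in> {1..r+1}" "idx b = k" for Y :: "complex^'n^'n" and k a b
  proof -
    have "(Y *v u (k - 1)) $ a = (\<Sum>c\<in>UNIV. if c = b then Y $ a $ b * u (k - 1) $ b else 0)"
      unfolding matrix_vector_mult_def vec_lambda_beta
      using usupp[OF that(1)] that(2) idx_inj by (intro sum.cong refl) fastforce
    then show ?thesis by simp
  qed
  have E: "X (GE (?n j)) $ a $ b \<noteq> 0 \<longleftrightarrow> idx a = j \<and> idx b = j + 1" if j: "j \<in> {1..r}" for j a b
  proof
    assume nz: "X (GE (?n j)) $ a $ b \<noteq> 0"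
    show "idx a = j \<and> idx b = j + 1"
    proof (rule nu_difference[OF idx_in idx_in j])
      fix i assume i: "i \<in> {1..r}"
      show "nu i (idx a) - nu i (idx b) = nu i j - nu i (j + 1)"
        using shiftE[OF nz i j] lidx[OF i, of a] lidx[OF i, of b] by simp
    qed
  next
    assume ab: "idx a = j \<and> idx b = j + 1"
    have "(X (GE (?n j)) *v u j) $ a = X (GE (?n j)) $ a $ b * u j $ b"
      using act[of "j + 1" b "X (GE (?n j))" a] ab j by simp
    moreover have "X (GE (?n j)) *v u j = u (j - 1)" using EFu[of "j - 1"] j by auto
    ultimately show "X (GE (?n j)) $ a $ b \<noteq> 0" using usupp[of j a] ab j by auto
  qed
  have F: "X (GF (?n j)) $ a $ b \<noteq> 0 \<longleftrightarrow> idx b = j \<and> idx a = j + 1" if j: "j \<in> {1..r}" for j a b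
  proof
    assume nz: "X (GF (?n j)) $ a $ b \<noteq> 0"
    show "idx b = j \<and> idx a = j + 1"
    proof (rule nu_difference[OF idx_in idx_in j])
      fix i assume i: "i \<in> {1..r}"
      show "nu i (idx b) - nu i (idx a) = nu i j - nu i (j + 1)"
        using shiftF[OF nz i j] lidx[OF i, of a] lidx[OF i, of b] by simp
    qed
  next
    assume ab: "idx b = j \<and> idx a = j + 1"
    have "(X (GF (?n j)) *v u (j - 1)) $ a = X (GF (?n j)) $ a $ b * u (j - 1) $ b"
      using act[of j b "X (GF (?n j))" a] ab j by simp
    moreover have "X (GF (?n j)) *v u (j - 1) = u j" using uS[of "j - 1"] j by auto
    ultimately show "X (GF (?n j)) $ a $ b \<noteq> 0" using usupp[of "j + 1" a] ab j by auto
  qed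
  \<comment> \<open>The highest weight space is one-dimensional, so its basis vector is itself a highest weight vector.\<close>
  have hw: "highest_weight_vector r q X (omega r s) (axis b 1)" if b: "idx b = 1" for b
  proof -
    have nz: "v $ b \<noteq> 0" using usupp[of 1 b] b by (simp add: u0)
    have v: "v = v $ b *s axis b 1"
      unfolding vec_eq_iff
    proof
      fix i
      have "v $ i = 0" if "i \<noteq> b" using usupp[of 1 i] b idx_inj[of i b] that by (auto simp: u0)
      then show "v $ i = (v $ b *s axis b 1) $ i" by (simp add: axis_def vector_scalar_mult_def)
    qed
    have ax: "axis b 1 = inverse (v $ b) *s v"
      using nz by (subst (2) v) (simp add: vec_eq_iff axis_def vector_scalar_mult_def)
    have ms: "A *v (c *s x) = c *s (A *v x)" for A :: "complex^'n^'n" and c x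
      by (simp add: matrix_vector_mult_def vec_eq_iff vector_scalar_mult_def sum_distrib_left mult_ac)
    have "X (GE i) *v axis b 1 = 0" if "i \<in> {1..r}" for i
      unfolding ax ms vE[OF that] by (simp add: vec_eq_iff vector_scalar_mult_def)
    moreover have "X (GK i) *v axis b 1 = (q powr wform r (alpha i) (omega r s)) *\<^sub>R axis b 1" if "i \<in> {1..r}" for i
      unfolding ax ms vK[OF that] by (simp add: vec_eq_iff vector_scalar_mult_def)
    moreover have "(axis b 1 :: complex^'n) \<noteq> 0" by (simp add: axis_eq_0_iff)
    ultimately show ?thesis using \<open>highest_weight_vector r q X (omega r s) v\<close>
      by (auto simp: highest_weight_vector_def weight_vector_def)
  qed
  show ?thesis
  proof (rule that[OF _ _ hw])
    show "vector_module r s q X idx"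
      unfolding vector_module_def
  proof (intro conjI ballI allI idx)
    fix j a b assume j: "j \<in> {1..r}"
    show "X (GK (?n j)) $ a $ b = (if a = b then complex_of_real (q powr nu j (idx b)) else 0)"
      "X (GKinv (?n j)) $ a $ b = (if a = b then complex_of_real (q powr - nu j (idx b)) else 0)"
      by (simp_all only: K[OF node_in[OF j]] Kinv[OF node_in[OF j]] lidx[OF j])
  qed (fact E F)+
  next
    show "wform r (wt b) (two_rho r) = real r + 2 - 2 * real (idx b)" for b
      by (rule wform_two_rho_nu[OF r s idx_in]) (use lidx in \<open>simp add: l_def\<close>)
  qed
qed

section \<open>The braiding of V with itself\<close>

lemma kron_tensor_vec: "kron A B *v tensor_vec x y = tensor_vec (A *v x) (B *v y)"
proof -
  have "(\<Sum>z\<in>UNIV. A $ fst i $ fst z * B $ snd i $ snd z * (x $ fst z * y $ snd z))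
      = (\<Sum>j\<in>UNIV. A $ fst i $ j * x $ j) * (\<Sum>j\<in>UNIV. B $ snd i $ j * y $ j)" for i
    by (simp add: sum_UNIV_prod sum_product mult_ac)
  then show ?thesis by (simp add: kron_def tensor_vec_def matrix_vector_mult_def vec_eq_iff)
qed

lemma tensor_vec_axis: "tensor_vec (axis a 1) (axis b 1) = axis (a, b) 1"
  by (auto simp: tensor_vec_def axis_def vec_eq_iff)

lemma tensor_vec_scale: "tensor_vec (c *s x) y = c *s tensor_vec x y" "tensor_vec x (c *s y) = c *s tensor_vec x y"
  by (simp_all add: tensor_vec_def vec_eq_iff)

lemma tensor_vec_0: "tensor_vec 0 y = 0" "tensor_vec x 0 = 0"
  by (simp_all add: tensor_vec_def vec_eq_iff)

lemma matrix_vector_scale: "A *v (c *s x) = c *s (A *v x)" for A :: "complex^'n^'m"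
  by (simp add: matrix_vector_mult_def vec_eq_iff sum_distrib_left mult_ac)

lemma matrix_vector_add_rdistrib: "(A + B) *v x = A *v x + B *v x" for A :: "complex^'n^'m"
  by (simp add: matrix_vector_mult_def vec_eq_iff sum.distrib distrib_right)

lemmas matrix_vector_linear = matrix_vector_scale matrix_vector_right_distrib matrix_vector_add_rdistrib

declare tensor_rep.simps [simp del] dual_rep.simps [simp del]

text \<open>The standard solution of the braid relation for the vector representation, \<open>Q\<close> being \<open>q\<close> and \<open>W\<close> a normalisation.\<close>
definition hecke_R :: "('n::finite \<Rightarrow> nat) \<Rightarrow> complex \<Rightarrow> complex \<Rightarrow> complex^('n \<times> 'n)^('n \<times> 'n)" where
  "hecke_R idx Q W = (\<chi> x y. W * (if fst x = snd x then (if y = x then Q else 0)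
    else if y = (snd x, fst x) then 1 else if y = x \<and> idx (snd x) < idx (fst x) then Q - 1 / Q else 0))"

lemma hecke_R_axis:
  "hecke_R idx Q W *v axis (c, d) 1 = (if c = d then (Q * W) *s axis (c, c) 1
    else W *s axis (d, c) 1 + (if idx d < idx c then ((Q - 1 / Q) * W) *s axis (c, d) 1 else 0))"
proof -
  have "hecke_R idx Q W $ (a, b) $ (c, d) = (if c = d then (Q * W) *s axis (c, c) 1
    else W *s axis (d, c) 1 + (if idx d < idx c then ((Q - 1 / Q) * W) *s axis (c, d) 1 else 0)) $ (a, b)" for a b
    by (auto simp: hecke_R_def axis_def)
  then show ?thesis by (simp add: vec_eq_iff matrix_vector_axis split_paired_all)
qed

lemma matrix_eq_axis: "A = B" if "\<And>x. A *v axis x 1 = B *v axis x 1" for A B :: "complex^'n::finite^'m"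
  using that by (metis (no_types) vec_eq_iff matrix_vector_axis)

lemma qc_simps: "qc q 0 = (if q = 0 then 0 else 1)" "qc q x * qc q y = qc q (x + y)" 
  "qc q (- x) = 1 / qc q x"
  by (simp_all add: qc_def powr_add powr_minus field_simps)

lemma qc_pos: "0 < q \<Longrightarrow> qc q x \<noteq> 0" by (simp add: qc_def)

locale vector_rep =
  fixes r s :: nat and q :: real and X :: "('n::finite) rep" and idx :: "'n \<Rightarrow> nat"
  assumes r: "1 \<le> r" and q: "0 < q" "q < 1" and s: "s \<in> {1, r}"
    and X: "vector_module r s q X idx"
begin

abbreviation "n \<equiv> node r s"

definition bb where "bb k = (THE b. idx b = k)"

lemma bij: "bij_betw idx UNIV {1..r+1}" using X by (auto simp: vector_module_def)

lemma idx_in: "idx b \<in> {1..r+1}" using bij by (auto simp: bij_betw_def)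

lemma idx_inj: "idx a = idx b \<longleftrightarrow> a = b" using bij by (auto simp: bij_betw_def inj_def)

lemma idx_bb: "k \<in> {1..r+1} \<Longrightarrow> idx (bb k) = k"
proof -
  assume "k \<in> {1..r+1}"
  then have "k \<in> range idx" using bij by (simp only: bij_betw_def)
  then obtain b where "idx b = k" by blast
  then show ?thesis unfolding bb_def by (rule theI) (use \<open>idx b = k\<close> idx_inj in auto)
qed

lemma bb_idx: "bb (idx b) = b" by (simp add: idx_bb[OF idx_in] flip: idx_inj)

lemma bb_eq: "k \<in> {1..r+1} \<Longrightarrow> l \<in> {1..r+1} \<Longrightarrow> bb k = bb l \<longleftrightarrow> k = l"
  by (metis idx_bb)

lemma entries:
  assumes "j \<in> {1..r}"
  shows "X (GK (n j)) $ a $ b = (if a = b then qc q (nu j (idx b)) else 0)"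
    and "X (GKinv (n j)) $ a $ b = (if a = b then qc q (- nu j (idx b)) else 0)"
    and "X (GE (n j)) $ a $ b \<noteq> 0 \<longleftrightarrow> idx a = j \<and> idx b = j + 1"
    and "X (GF (n j)) $ a $ b \<noteq> 0 \<longleftrightarrow> idx b = j \<and> idx a = j + 1"
  using X assms unfolding vector_module_def qc_def by blast+

definition ee where "ee j = X (GE (n j)) $ bb j $ bb (j + 1)"
definition ff where "ff j = X (GF (n j)) $ bb (j + 1) $ bb j"

lemma ee_ff_nonzero: "j \<in> {1..r} \<Longrightarrow> ee j \<noteq> 0" "j \<in> {1..r} \<Longrightarrow> ff j \<noteq> 0"
  by (simp_all add: ee_def ff_def entries idx_bb)

abbreviation v where "v k \<equiv> axis (bb k) (1::complex)"
abbreviation vv where "vv k l \<equiv> axis (bb k, bb l) (1::complex)"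

lemma act:
  assumes j: "j \<in> {1..r}" and k: "k \<in> {1..r+1}"
  shows "X (GK (n j)) *v v k = qc q (nu j k) *s v k"
    and "X (GKinv (n j)) *v v k = qc q (- nu j k) *s v k"
    and "X (GE (n j)) *v v k = (if k = j + 1 then ee j *s v j else 0)"
    and "X (GF (n j)) *v v k = (if k = j then ff j *s v (j + 1) else 0)"
proof -
  show "X (GK (n j)) *v v k = qc q (nu j k) *s v k" "X (GKinv (n j)) *v v k = qc q (- nu j k) *s v k"
    using k by (auto simp: vec_eq_iff matrix_vector_axis entries[OF j] idx_bb) (simp_all add: axis_def)
  show "X (GE (n j)) *v v k = (if k = j + 1 then ee j *s v j else 0)"
    unfolding vec_eq_iff
  proof
    fix a
    have "X (GE (n j)) $ a $ bb k = (if k = j + 1 \<and> a = bb j then ee j else 0)"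
      using entries(3)[OF j, of a "bb k"] k j idx_bb[of k] bb_idx[of a] by (auto simp: ee_def)
    then show "(X (GE (n j)) *v v k) $ a = (if k = j + 1 then ee j *s v j else 0) $ a"
      by (simp add: matrix_vector_axis) (simp add: axis_def)
  qed
  show "X (GF (n j)) *v v k = (if k = j then ff j *s v (j + 1) else 0)"
    unfolding vec_eq_iff
  proof
    fix a
    have "X (GF (n j)) $ a $ bb k = (if k = j \<and> a = bb (j + 1) then ff j else 0)"
      using entries(4)[OF j, of a "bb k"] k j idx_bb[of k] bb_idx[of a] by (auto simp: ff_def)
    then show "(X (GF (n j)) *v v k) $ a = (if k = j then ff j *s v (j + 1) else 0) $ a"
      by (simp add: matrix_vector_axis) (simp add: axis_def)
  qed
qed

lemma act2:
  assumes j: "j \<in> {1..r}" and k: "k \<in> {1..r+1}" and l: "l \<in> {1..r+1}"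
  shows "tensor_rep X X (GE (n j)) *v vv k l =
      (if k = j + 1 then (ee j * qc q (nu j l)) *s vv j l else 0) + (if l = j + 1 then ee j *s vv k j else 0)"
    and "tensor_rep X X (GF (n j)) *v vv k l =
      (if k = j then ff j *s vv (j + 1) l else 0) + (if l = j then (ff j * qc q (- nu j k)) *s vv k (j + 1) else 0)"
  unfolding tensor_vec_axis[symmetric] tensor_rep.simps
  by (simp_all add: matrix_vector_add_rdistrib kron_tensor_vec act[OF j k] act[OF j l] tensor_vec_scale tensor_vec_0
      matrix_vector_mul_lid mult_ac)

definition "Q = qc q 1"
lemma Q0: "Q \<noteq> 0" using q by (simp add: Q_def qc_def)
lemma qc_nu: "qc q (nu j k) = (if k = j then Q else if k = j + 1 then 1 / Q else 1)"
    "qc q (- nu j k) = (if k = j then 1 / Q else if k = j + 1 then Q else 1)"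
  using q by (auto simp: nu_def Q_def qc_def powr_minus field_simps)

text \<open>The vector \<open>v\<^sub>1 \<otimes> v\<close> with \<open>v\<close> of lowest weight generates the tensor square. Lowering operators only move its first
factor, since they annihilate the second one; raising operators then move the second factor, up to terms that are already
known. So a module map is determined by its value at that vector.\<close>
lemma braiding_VV:
  assumes R: "\<And>j. j \<in> {1..r} \<Longrightarrow> R ** tensor_rep X X (GE (n j)) = tensor_rep X X (GE (n j)) ** R"
    "\<And>j. j \<in> {1..r} \<Longrightarrow> R ** tensor_rep X X (GF (n j)) = tensor_rep X X (GF (n j)) ** R"
    and R1: "R *v vv 1 (r + 1) = W *s vv (r + 1) 1"
  shows "R = hecke_R idx Q W"
proof -
  define h where "h k l = (if k = l then (Q * W) *s vv k k
    else W *s vv l k + (if l < k then ((Q - 1 / Q) * W) *s vv k l else 0))" for k l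
  have hR: "hecke_R idx Q W *v vv k l = h k l" if "k \<in> {1..r+1}" "l \<in> {1..r+1}" for k l
    using that by (simp add: hecke_R_axis h_def bb_eq idx_bb del: atLeastAtMost_iff)
  have RE: "R *v (tensor_rep X X (GE (n j)) *v x) = tensor_rep X X (GE (n j)) *v (R *v x)"
    "R *v (tensor_rep X X (GF (n j)) *v x) = tensor_rep X X (GF (n j)) *v (R *v x)" if "j \<in> {1..r}" for j x
    by (simp_all only: matrix_vector_mul_assoc R that)
  have 1: "R *v vv k (r + 1) = h k (r + 1)" if "1 \<le> k" "k \<le> r + 1" for k
    using that
  proof (induction k rule: dec_induct)
    case base then show ?case using R1 r by (simp add: h_def)
  next
    case (step k)
    then have k: "k \<in> {1..r}" "k \<in> {1..r+1}" "Suc k \<in> {1..r+1}" "k \<noteq> r + 1" by auto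
    have "ff k *s (R *v vv (k + 1) (r + 1)) = R *v (tensor_rep X X (GF (n k)) *v vv k (r + 1))"
      using k by (simp add: act2 matrix_vector_linear)
    also have "\<dots> = tensor_rep X X (GF (n k)) *v h k (r + 1)"
      using step k by (simp add: RE)
    also have "\<dots> = ff k *s h (k + 1) (r + 1)"
      using k Q0 by (auto simp: h_def matrix_vector_linear act2 qc_nu mult_ac)
    finally show ?case using ee_ff_nonzero(2)[OF k(1)] by simp
  qed
  have 2: "R *v vv k l = h k l" if "l \<le> r + 1" "1 \<le> l" "k \<in> {1..r+1}" for k l
    using that
  proof (induction l arbitrary: k rule: inc_induct)
    case base then show ?case using 1 by simp
  next
    case (step l)
    have l: "l \<in> {1..r}" "l \<in> {1..r+1}" "l + 1 \<in> {1..r+1}" using step by auto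
    have k: "k \<in> {1..r+1}" by fact
    have IH: "R *v vv k (l + 1) = h k (l + 1)" if "k \<in> {1..r+1}" for k using step that by simp
    have "ee l *s (R *v vv k l) = R *v (tensor_rep X X (GE (n l)) *v vv k (l + 1))
        - (if k = l + 1 then (ee l / Q) *s (R *v vv l (l + 1)) else 0)"
      using l k by (auto simp: act2 matrix_vector_linear qc_nu)
    also have "\<dots> = tensor_rep X X (GE (n l)) *v h k (l + 1) - (if k = l + 1 then (ee l / Q) *s h l (l + 1) else 0)"
      unfolding RE(1)[OF l(1)] IH[OF k] IH[OF l(2)] ..
    also have "\<dots> = ee l *s h k l"
    proof -
      consider "k = l + 1" | "k = l" | "k \<noteq> l" "k \<noteq> l + 1" by auto
      then show ?thesis
      proof cases
        case 1
        show ?thesis using l k Q0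
          by (simp add: 1 h_def matrix_vector_linear act2 qc_nu vec_eq_iff) (simp add: field_simps)
      next
        case 2
        show ?thesis using l k Q0
          by (simp add: 2 h_def matrix_vector_linear act2 qc_nu vec_eq_iff)
      next
        case 3
        then have "l + 1 < k \<longleftrightarrow> l < k" by auto
        then show ?thesis using l k 3
          by (simp add: h_def matrix_vector_linear act2 qc_nu vec_eq_iff mult_ac)
      qed
    qed
    finally show ?case using ee_ff_nonzero(1)[OF l(1)] by simp
  qed
  show ?thesis
  proof (rule matrix_eq_axis)
    fix x :: "'n \<times> 'n"
    obtain a b where x: "x = (a, b)" by force
    show "R *v axis x 1 = hecke_R idx Q W *v axis x 1"
      using 2[of "idx b" "idx a"] hR[of "idx a" "idx b"] idx_in[of a] idx_in[of b] by (simp add: x bb_idx)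
  qed
qed

end

section \<open>The explicit braidings\<close>

text \<open>The inverse belongs to the opposite order of the basis and to the inverse parameters.\<close>
lemma hecke_R_inverse:
  assumes inj: "inj idx" and opp: "\<And>a b. idx' a < (idx' b :: nat) \<longleftrightarrow> idx b < (idx a :: nat)" and 0: "Q \<noteq> 0" "W \<noteq> 0"
  shows "hecke_R idx Q W ** hecke_R idx' (1 / Q) (1 / W) = mat 1"
proof (rule matrix_eq_axis)
  fix x :: "'a \<times> 'a"
  obtain c d where x: "x = (c, d)" by force
  consider "c = d" | "c \<noteq> d" "idx c < idx d" "\<not> idx d < idx c" | "c \<noteq> d" "idx d < idx c" "\<not> idx c < idx d"
    using less_linear[of "idx c" "idx d"] injD[OF inj, of c d] by force
  then have "hecke_R idx Q W *v (hecke_R idx' (1 / Q) (1 / W) *v axis (c, d) 1) = axis (c, d) 1"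
    by cases (simp_all add: hecke_R_axis opp matrix_vector_linear 0 vec_eq_iff field_simps)
  then show "hecke_R idx Q W ** hecke_R idx' (1 / Q) (1 / W) *v axis x 1 = mat 1 *v axis x 1"
    by (simp add: x matrix_vector_mul_assoc[symmetric] matrix_vector_mul_lid)
qed

lemma hecke_R_eq_0:
  assumes "y \<noteq> x" "y \<noteq> (snd x, fst x)" shows "hecke_R idx Q W $ x $ y = 0"
  using assms by (simp add: hecke_R_def)

lemma on_legs_hecke_R:
  "on_legs k (hecke_R idx Q W) x f = (if f k = f (Suc k) then (Q * W) *\<^sub>C x f
    else W *\<^sub>C x (f(k := f (Suc k), Suc k := f k)) + (if idx (f (Suc k)) < idx (f k) then ((Q - 1 / Q) * W) *\<^sub>C x f else 0))"
proof -
  let ?y = "\<lambda>i j. x (f(k := i, Suc k := j))"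
  have y: "?y (f k) (f (Suc k)) = x f" by simp
  let ?a = "f k" and ?b = "f (Suc k)"
  have "on_legs k (hecke_R idx Q W) x f = (\<Sum>i\<in>UNIV. \<Sum>j\<in>UNIV.
      (if j = ?b then 1 else 0) *\<^sub>C ((if i = ?a then 1 else 0) *\<^sub>C ((if ?a = ?b then Q * W else if idx ?b < idx ?a then (Q - 1 / Q) * W else 0) *\<^sub>C ?y i j))
    + (if j = ?a then 1 else 0) *\<^sub>C ((if i = ?b then 1 else 0) *\<^sub>C ((if ?a = ?b then 0 else W) *\<^sub>C ?y i j)))"
    unfolding on_legs_def hecke_R_def by (intro sum.cong refl) (auto simp: scaleC_one mult.commute)
  also have "\<dots> = (if ?a = ?b then Q * W else if idx ?b < idx ?a then (Q - 1 / Q) * W else 0) *\<^sub>C ?y ?a ?b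
      + (if ?a = ?b then 0 else W) *\<^sub>C ?y ?b ?a"
    by (simp add: sum.distrib sum_delta_scaleC del: cvec.scale_scale)
  finally show ?thesis by (auto simp: y)
qed

text \<open>The matrix is a combination of the identity and the swap on every two basis vectors, with coefficients that depend
only on their order. So the braid relation can be checked for each relative order of three indices; the only
identity that enters is \<open>Q\<^sup>2 = 1 + Q (Q - 1 / Q)\<close>.\<close>
lemma hecke_R_braid:
  assumes inj: "inj (idx :: 'n::finite \<Rightarrow> nat)" and 0: "Q \<noteq> 0"
  shows "braid_kernels (hecke_R idx Q W) (hecke_R idx Q W) (hecke_R idx Q W) (hecke_R idx Q W) (hecke_R idx Q W) (hecke_R idx Q W)"
  unfolding braid_kernels_def
proof (intro allI)
  fix a b c d e f :: 'n
  let ?R = "hecke_R idx Q W"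
  define x :: "(nat \<Rightarrow> 'n) \<Rightarrow> complex" where "x g = (if g 0 = d then 1 else 0) * ((if g 1 = e then 1 else 0) * (if g 2 = f then 1 else 0))" for g
  define y where "y a b c = x (set3 0 a b c (\<lambda>_. a))" for a b c
  have xg: "x g = y (g 0) (g (Suc 0)) (g (Suc (Suc 0)))" for g
    by (simp add: x_def y_def set3_def numeral_2_eq_2)
  define g where "g = set3 0 a b c (\<lambda>_. a)"
  have g: "g 0 = a" "g (Suc 0) = b" "g (Suc (Suc 0)) = c" by (simp_all add: g_def set3_def)
  have eq: "u = v \<longleftrightarrow> idx u = idx v" for u v using inj by (auto dest: injD)
  have H: "on_legs k ?R u h = (if h k = h (Suc k) then (Q * W) * u h
      else W * u (h(k := h (Suc k), Suc k := h k)) + (if idx (h (Suc k)) < idx (h k) then ((Q - 1 / Q) * W) * u h else 0))"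
    for k h and u :: "(nat \<Rightarrow> 'n) \<Rightarrow> complex"
    by (simp add: on_legs_hecke_R scaleC_complex_def)
  define s1 where "s1 u a b c = (if a = b then (Q * W) * u a b c else W * u b a c + (if idx b < idx a then ((Q - 1 / Q) * W) * u a b c else 0))"
    for u :: "'n \<Rightarrow> 'n \<Rightarrow> 'n \<Rightarrow> complex" and a b c
  define s2 where "s2 u a b c = (if b = c then (Q * W) * u a b c else W * u a c b + (if idx c < idx b then ((Q - 1 / Q) * W) * u a b c else 0))"
    for u :: "'n \<Rightarrow> 'n \<Rightarrow> 'n \<Rightarrow> complex" and a b c
  have L1: "on_legs 0 ?R (\<lambda>h. u (h 0) (h (Suc 0)) (h (Suc (Suc 0)))) = (\<lambda>h. s1 u (h 0) (h (Suc 0)) (h (Suc (Suc 0))))" for u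
    by (rule ext) (simp add: H s1_def)
  have L2: "on_legs (Suc 0) ?R (\<lambda>h. u (h 0) (h (Suc 0)) (h (Suc (Suc 0)))) = (\<lambda>h. s2 u (h 0) (h (Suc 0)) (h (Suc (Suc 0))))" for u
    by (rule ext) (simp add: H s2_def)
  have QQ: "Q * (Q * t) = t + Q * ((Q - 1 / Q) * t)" for t using 0 by (simp add: field_simps)
  define z where "z = Q - 1 / Q"
  note s12 = s1_def[folded z_def] s2_def[folded z_def]
  have lt: "u \<noteq> v \<and> v \<noteq> u \<and> idx u < idx v \<and> \<not> idx v < idx u" if "idx u < idx v" for u v
    using that by auto
  have tri: "idx u < idx v \<or> v = u \<or> idx v < idx u" for u v
    unfolding eq using less_linear[of "idx u" "idx v"] by auto
  \<comment> \<open>The thirteen ways in which three indices can be ordered.\<close>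
  have core: "s1 (s2 (s1 y)) a b c = s2 (s1 (s2 y)) a b c"
  proof -
    consider "b = a" "c = a" | "b = a" "idx a < idx c" | "b = a" "idx c < idx a"
      | "c = b" "idx a < idx b" | "c = b" "idx b < idx a" | "c = a" "idx a < idx b" | "c = a" "idx b < idx a"
      | "idx a < idx b" "idx b < idx c" "idx a < idx c" | "idx a < idx c" "idx c < idx b" "idx a < idx b"
      | "idx b < idx a" "idx a < idx c" "idx b < idx c" | "idx b < idx c" "idx c < idx a" "idx b < idx a"
      | "idx c < idx a" "idx a < idx b" "idx c < idx b" | "idx c < idx b" "idx b < idx a" "idx c < idx a"
      using tri[of a b] tri[of b c] tri[of a c] by (elim disjE) (blast | linarith)+
    then show ?thesis
    proof cases
      case 1 show ?thesis by (simp add: s12 1)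
    next
      case 2 show ?thesis by (simp add: s12 2(1) lt[OF 2(2)], (simp add: algebra_simps QQ[folded z_def])?)
    next
      case 3 show ?thesis by (simp add: s12 3(1) lt[OF 3(2)], (simp add: algebra_simps QQ[folded z_def])?)
    next
      case 4 show ?thesis by (simp add: s12 4(1) lt[OF 4(2)], (simp add: algebra_simps QQ[folded z_def])?)
    next
      case 5 show ?thesis by (simp add: s12 5(1) lt[OF 5(2)], (simp add: algebra_simps QQ[folded z_def])?)
    next
      case 6 show ?thesis by (simp add: s12 6(1) lt[OF 6(2)], (simp add: algebra_simps QQ[folded z_def])?)
    next
      case 7 show ?thesis by (simp add: s12 7(1) lt[OF 7(2)], (simp add: algebra_simps QQ[folded z_def])?)
    next
      case 8 show ?thesis by (simp add: s12 lt[OF 8(1)] lt[OF 8(2)] lt[OF 8(3)], (simp add: algebra_simps QQ[folded z_def])?)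
    next
      case 9 show ?thesis by (simp add: s12 lt[OF 9(1)] lt[OF 9(2)] lt[OF 9(3)], (simp add: algebra_simps QQ[folded z_def])?)
    next
      case 10 show ?thesis by (simp add: s12 lt[OF 10(1)] lt[OF 10(2)] lt[OF 10(3)], (simp add: algebra_simps QQ[folded z_def])?)
    next
      case 11 show ?thesis by (simp add: s12 lt[OF 11(1)] lt[OF 11(2)] lt[OF 11(3)], (simp add: algebra_simps QQ[folded z_def])?)
    next
      case 12 show ?thesis by (simp add: s12 lt[OF 12(1)] lt[OF 12(2)] lt[OF 12(3)], (simp add: algebra_simps QQ[folded z_def])?)
    next
      case 13 show ?thesis by (simp add: s12 lt[OF 13(1)] lt[OF 13(2)] lt[OF 13(3)], (simp add: algebra_simps QQ[folded z_def])?)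
    qed
  qed
  have YB: "on_legs 0 ?R (on_legs (Suc 0) ?R (on_legs 0 ?R x)) g = on_legs (Suc 0) ?R (on_legs 0 ?R (on_legs (Suc 0) ?R x)) g"
  proof -
    have x: "x = (\<lambda>h. y (h 0) (h (Suc 0)) (h (Suc (Suc 0))))" by (rule ext) (rule xg)
    show ?thesis unfolding x L1 L2 g core ..
  qed
  have pick: "(\<Sum>d'\<in>UNIV. \<Sum>e'\<in>UNIV. \<Sum>f'\<in>UNIV. K d' e' f' *\<^sub>C x (set3 0 d' e' f' g)) = K d e f" for K
  proof -
    have "(\<Sum>d'\<in>UNIV. \<Sum>e'\<in>UNIV. \<Sum>f'\<in>UNIV. K d' e' f' *\<^sub>C x (set3 0 d' e' f' g))
      = (\<Sum>d'\<in>UNIV. (if d' = d then 1 else 0) *\<^sub>C (\<Sum>e'\<in>UNIV. (if e' = e then 1 else 0) *\<^sub>C (\<Sum>f'\<in>UNIV. (if f' = f then 1 else 0) *\<^sub>C K d' e' f')))"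
      by (simp add: x_def set3_def scaleC_complex_def sum_distrib_left mult_ac)
    then show ?thesis by (simp add: sum_delta_scaleC)
  qed
  show "(\<Sum>m\<in>UNIV. \<Sum>n\<in>UNIV. \<Sum>k\<in>UNIV. ?R $ (a, b) $ (n, m) * ?R $ (m, c) $ (k, f) * ?R $ (n, k) $ (d, e)) =
    (\<Sum>m\<in>UNIV. \<Sum>n\<in>UNIV. \<Sum>k\<in>UNIV. ?R $ (b, c) $ (n, k) * ?R $ (a, n) $ (d, m) * ?R $ (m, k) $ (e, f))"
    using YB unfolding on_legs_121 on_legs_212 pick g .
qed

text \<open>Quarter turns of a crossing \<open>R\<close> of two strands of type \<open>V\<close>. Turning one strand of the braiding gives the inverse of
the braiding of \<open>V\<close> with \<open>V\<^sup>*\<close>, turning both gives the braiding of \<open>V\<^sup>*\<close> with itself. The braiding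
of \<open>V\<close> with \<open>V\<^sup>*\<close> arises from the inverse crossing by turning it the other way, which involves the caps
\<open>E'\<close> and therefore the weights \<open>\<kappa>\<close>.\<close>
definition rot_Di :: "complex^('n::finite \<times> 'n)^('n \<times> 'n) \<Rightarrow> complex^('n \<times> 'n)^('n \<times> 'n)" where
  "rot_Di R = (\<chi> x y. R $ (fst y, fst x) $ (snd y, snd x))"

definition rot_Q :: "complex^('n::finite \<times> 'n)^('n \<times> 'n) \<Rightarrow> complex^('n \<times> 'n)^('n \<times> 'n)" where
  "rot_Q R = (\<chi> x y. R $ (snd y, fst y) $ (snd x, fst x))"

definition rot_D :: "('n::finite \<Rightarrow> complex) \<Rightarrow> complex^('n \<times> 'n)^('n \<times> 'n) \<Rightarrow> complex^('n \<times> 'n)^('n \<times> 'n)" where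
  "rot_D \<kappa> R = (\<chi> x y. \<kappa> (snd y) / \<kappa> (fst x) * R $ (snd x, snd y) $ (fst x, fst y))"

lemma sum_telescope: "m \<le> n \<Longrightarrow> (\<Sum>k\<in>{m..<n}. t k - t (Suc k)) = t m - (t n :: complex)" for m n :: nat
  by (induction n rule: dec_induct) simp_all

lemma qc_divide: "qc q x / qc q y = qc q (x - y)"
  by (simp add: qc_def powr_diff)

lemma rot_entries:
  "rot_Di R $ (k, l) $ (j, i) = R $ (j, k) $ (i, l)"
  "rot_Q R $ (k, l) $ (i, j) = R $ (j, i) $ (l, k)"
  "rot_D \<kappa> R $ (c, d) $ (i, j) = \<kappa> j / \<kappa> c * R $ (d, j) $ (c, i)"
  by (simp_all add: rot_Di_def rot_Q_def rot_D_def)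

lemma rot_Q_mult: "rot_Q A ** rot_Q B = rot_Q (B ** A)"
proof -
  have "(rot_Q A ** rot_Q B) $ (a, b) $ (c, d) = rot_Q (B ** A) $ (a, b) $ (c, d)" for a b c d
    unfolding matrix_matrix_mult_def vec_lambda_beta rot_entries sum_UNIV_prod
    by (subst sum.swap) (simp add: mult.commute)
  then show ?thesis by (simp add: vec_eq_iff split_paired_all)
qed

lemma rot_Q_mat_1: "rot_Q (mat 1) = mat 1"
proof -
  have "rot_Q (mat 1) $ (a, b) $ (c, d) = mat 1 $ (a, b) $ (c, d)" for a b c d :: 'a
    unfolding rot_entries by (auto simp: mat_def)
  then show ?thesis by (simp add: vec_eq_iff split_paired_all)
qed

context vector_rep begin

definition "\<kappa> b = qc q (real r + 2 - 2 * real (idx b))"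
definition "idx' b = r + 1 - idx b"

lemma \<kappa>0: "\<kappa> b \<noteq> 0" using q by (simp add: \<kappa>_def qc_pos)

lemma opp: "idx' a < idx' b \<longleftrightarrow> idx b < idx a"
  using idx_in[of a] idx_in[of b] by (auto simp: idx'_def)

lemma inj: "inj idx" "inj idx'"
proof -
  show "inj idx" using bij by (simp add: bij_betw_def)
  show "inj idx'"
  proof (rule injI)
    fix a b assume "idx' a = idx' b"
    then have "idx a = idx b" using idx_in[of a] idx_in[of b] by (auto simp: idx'_def)
    then show "a = b" by (simp only: idx_inj)
  qed
qed

lemma sum_idx: "(\<Sum>b\<in>UNIV. g (idx b)) = (\<Sum>k=1..r+1. g k)"
  using sum.reindex_bij_betw[OF bij] by simp

context
  fixes W :: complex assumes W: "W \<noteq> 0"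
begin

abbreviation "R \<equiv> hecke_R idx Q W"
abbreviation "Rb \<equiv> hecke_R idx' (1 / Q) (1 / W)"

lemma R_Rb: "R ** Rb = mat 1" "Rb ** R = mat 1"
  using hecke_R_inverse[OF inj(1) opp Q0 W] hecke_R_inverse[OF inj(2) opp[symmetric], of "1 / Q" "1 / W"] W Q0 by simp_all

lemma qc_Q: "Q = qc q 1" by (rule Q_def)

text \<open>The terms of the sum that come from the triangular part of the matrix telescope.\<close>
lemma twist:
  "(\<Sum>i\<in>UNIV. rot_D \<kappa> Rb $ (i, i) $ (a, b)) = (if a = b then (1 / W * qc q (- real (r + 1))) * \<kappa> b else 0)"
proof (cases "a = b")
  case False
  then have "Rb $ (i, b) $ (i, a) = 0" for i by (auto simp: hecke_R_def)
  then show ?thesis using False unfolding rot_entries by simp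
next
  case True
  define t where "t k = qc q (2 * real k - 1)" for k
  have tel: "(1 / Q - Q) * qc q (2 * real k) = t k - t (Suc k)" for k
  proof -
    have i: "1 / qc q 1 = qc q (- 1)" and e: "2 * real k - 1 = - 1 + 2 * real k" "2 * real (Suc k) - 1 = 1 + 2 * real k"
      by (simp_all add: qc_simps(3))
    show ?thesis unfolding t_def e by (simp only: qc_Q i left_diff_distrib qc_simps(2))
  qed
  have "(\<Sum>i\<in>UNIV. rot_D \<kappa> Rb $ (i, i) $ (a, b))
    = (\<Sum>i\<in>UNIV. \<kappa> b / W * qc q (- (real r + 2)) * ((if idx i = idx b then qc q (2 * real (idx b)) / Q else 0) +
        (if idx i < idx b then (1 / Q - Q) * qc q (2 * real (idx i)) else 0)))"
    unfolding rot_entries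
  proof (intro sum.cong refl)
    fix i
    have k: "1 / \<kappa> i = qc q (- (real r + 2)) * qc q (2 * real (idx i))"
      unfolding \<kappa>_def qc_simps(2) qc_simps(3)[symmetric] by (rule arg_cong[where f = "qc q"]) simp
    have R: "Rb $ (i, b) $ (i, a) = 1 / W * ((if idx i = idx b then 1 / Q else 0) + (if idx i < idx b then 1 / Q - Q else 0))"
      using True by (auto simp: hecke_R_def opp idx_inj)
    show "\<kappa> b / \<kappa> i * Rb $ (i, b) $ (i, a) = \<kappa> b / W * qc q (- (real r + 2)) * ((if idx i = idx b then qc q (2 * real (idx b)) / Q else 0) +
        (if idx i < idx b then (1 / Q - Q) * qc q (2 * real (idx i)) else 0))"
      unfolding R using k by (auto simp: divide_inverse mult_ac)
  qed
  also have "\<dots> = \<kappa> b / W * qc q (- (real r + 2)) * (\<Sum>k=1..r+1. (if k = idx b then qc q (2 * real (idx b)) / Q else 0) +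
        (if k < idx b then (1 / Q - Q) * qc q (2 * real k) else 0))"
    unfolding sum_distrib_left[symmetric] by (subst sum_idx[symmetric]) simp
  also have "(\<Sum>k=1..r+1. (if k = idx b then qc q (2 * real (idx b)) / Q else 0) +
        (if k < idx b then (1 / Q - Q) * qc q (2 * real k) else 0)) = 
      qc q (2 * real (idx b)) / Q + (\<Sum>k\<in>{1..<idx b}. t k - t (Suc k))"
  proof -
    have "(\<Sum>k=1..r+1. (if k < idx b then (1 / Q - Q) * qc q (2 * real k) else 0)) = (\<Sum>k\<in>{1..<idx b}. t k - t (Suc k))"
      using idx_in[of b] by (intro sum.mono_neutral_cong_right) (auto simp: tel)
    then show ?thesis using idx_in[of b] by (simp add: sum.distrib)
  qed
  also have "(\<Sum>k\<in>{1..<idx b}. t k - t (Suc k)) = t 1 - t (idx b)"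
    using idx_in[of b] by (intro sum_telescope) simp
  also have "qc q (2 * real (idx b)) / Q = t (idx b)"
    unfolding t_def qc_Q qc_divide ..
  finally have "(\<Sum>i\<in>UNIV. rot_D \<kappa> Rb $ (i, i) $ (a, b)) = \<kappa> b / W * (qc q (- (real r + 2)) * qc q 1)"
    by (simp add: t_def)
  also have "qc q (- (real r + 2)) * qc q 1 = qc q (- real (r + 1))" by (simp add: qc_simps(2))
  finally show ?thesis using True by simp
qed

text \<open>With the weights \<open>\<kappa>\<close>, the turns of a crossing and of its inverse in opposite directions
are inverse to each other: the contributions of the basis vectors between \<open>d\<close> and \<open>i\<close> telescope and cancel
those of \<open>d\<close> and \<open>i\<close>.\<close>
lemma D_Di: "rot_D \<kappa> Rb ** rot_Di R = mat 1"
proof -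
  have "(rot_D \<kappa> Rb ** rot_Di R) $ (c, d) $ (j, i) = mat 1 $ (c, d) $ (j, i)" for c d j i
  proof -
    have sum: "(rot_D \<kappa> Rb ** rot_Di R) $ (c, d) $ (j, i)
        = (\<Sum>k\<in>UNIV. \<Sum>l\<in>UNIV. \<kappa> l / \<kappa> c * Rb $ (d, l) $ (c, k) * R $ (j, k) $ (i, l))"
      unfolding matrix_matrix_mult_def vec_lambda_beta sum_UNIV_prod rot_entries ..
    show ?thesis
    proof (cases "j = i")
      case False
      have "(\<Sum>k\<in>UNIV. \<Sum>l\<in>UNIV. \<kappa> l / \<kappa> c * Rb $ (d, l) $ (c, k) * R $ (j, k) $ (i, l))
        = (\<Sum>k\<in>UNIV. \<Sum>l\<in>UNIV. (if l = j then 1 else 0) *\<^sub>C ((if k = i then 1 else 0) *\<^sub>C (\<kappa> l / \<kappa> c * Rb $ (d, l) $ (c, k) * W)))"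
      proof (intro sum.cong refl)
        fix k l
        have e: "R $ (j, k) $ (i, l) = (if l = j then 1 else 0) * ((if k = i then 1 else 0) * W)"
          using False by (auto simp: hecke_R_def)
        show "\<kappa> l / \<kappa> c * Rb $ (d, l) $ (c, k) * R $ (j, k) $ (i, l) =
            (if l = j then 1 else 0) *\<^sub>C ((if k = i then 1 else 0) *\<^sub>C (\<kappa> l / \<kappa> c * Rb $ (d, l) $ (c, k) * W))"
          unfolding e scaleC_complex_def by (simp only: mult_ac)
      qed
      also have "\<dots> = \<kappa> j / \<kappa> c * Rb $ (d, j) $ (c, i) * W"
        by (simp add: sum_delta_scaleC del: cvec.scale_scale)
      also have "\<dots> = mat 1 $ (c, d) $ (j, i)"
        using False W \<kappa>0 by (auto simp: hecke_R_def mat_def)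
      finally show ?thesis using sum by simp
    next
      case True
      let ?z = "Q - 1 / Q"
      define t where "t k = qc q (1 - 2 * real k)" for k
      have tel: "?z * qc q (- 2 * real k) = t k - t (Suc k)" for k
      proof -
        have i: "1 / qc q 1 = qc q (- 1)"
          and e: "1 - 2 * real k = 1 + - 2 * real k" "1 - 2 * real (Suc k) = - 1 + - 2 * real k"
          by (simp_all add: qc_simps(3))
        show ?thesis unfolding t_def e by (simp only: qc_Q i left_diff_distrib qc_simps(2))
      qed
      have "(\<Sum>k\<in>UNIV. \<Sum>l\<in>UNIV. \<kappa> l / \<kappa> c * Rb $ (d, l) $ (c, k) * R $ (j, k) $ (i, l))
        = (\<Sum>k\<in>UNIV. \<Sum>l\<in>UNIV. (if l = k then 1 else 0) *\<^sub>C (\<kappa> l / \<kappa> c * Rb $ (d, l) $ (c, k) * R $ (i, k) $ (i, k)))"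
      proof (intro sum.cong refl)
        fix k l
        have e: "R $ (j, k) $ (i, l) = (if l = k then 1 else 0) * R $ (i, k) $ (i, k)"
          using True by (auto simp: hecke_R_def)
        show "\<kappa> l / \<kappa> c * Rb $ (d, l) $ (c, k) * R $ (j, k) $ (i, l) =
            (if l = k then 1 else 0) *\<^sub>C (\<kappa> l / \<kappa> c * Rb $ (d, l) $ (c, k) * R $ (i, k) $ (i, k))"
          unfolding e scaleC_complex_def by (simp only: mult_ac)
      qed
      also have "\<dots> = (\<Sum>k\<in>UNIV. \<kappa> k / \<kappa> c * Rb $ (d, k) $ (c, k) * R $ (i, k) $ (i, k))"
        by (simp add: sum_delta_scaleC del: cvec.scale_scale)
      also have "\<dots> = mat 1 $ (c, d) $ (j, i)"
      proof (cases "c = d")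
        case False
        then have "Rb $ (d, k) $ (c, k) = 0" for k by (auto simp: hecke_R_def)
        then show ?thesis using True False by (auto simp: mat_def)
      next
        case cd: True
        let ?e = "\<lambda>k. qc q (- 2 * real k)"
        have "(\<Sum>k\<in>UNIV. \<kappa> k / \<kappa> c * Rb $ (d, k) $ (c, k) * R $ (i, k) $ (i, k))
          = (\<Sum>k\<in>UNIV. qc q (2 * real (idx d)) * (?e (idx k) * ((if idx k = idx d then 1 / Q else if idx d < idx k then - ?z else 0)
              * (if idx k = idx i then Q else if idx k < idx i then ?z else 0))))"
        proof (intro sum.cong refl)
          fix k
          have "\<kappa> k / \<kappa> c = qc q (2 * real (idx d)) * ?e (idx k)"
            unfolding \<kappa>_def cd qc_divide by (simp add: qc_simps(2))
          moreover have "Rb $ (d, k) $ (c, k) = 1 / W * (if idx k = idx d then 1 / Q else if idx d < idx k then - ?z else 0)"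
            by (auto simp: hecke_R_def cd opp idx_inj)
          moreover have "R $ (i, k) $ (i, k) = W * (if idx k = idx i then Q else if idx k < idx i then ?z else 0)"
            by (auto simp: hecke_R_def cd idx_inj)
          ultimately show "\<kappa> k / \<kappa> c * Rb $ (d, k) $ (c, k) * R $ (i, k) $ (i, k) = qc q (2 * real (idx d)) * (?e (idx k) *
              ((if idx k = idx d then 1 / Q else if idx d < idx k then - ?z else 0)
              * (if idx k = idx i then Q else if idx k < idx i then ?z else 0)))"
            using W by simp
        qed
        also have "\<dots> = qc q (2 * real (idx d)) * (\<Sum>k=1..r+1. ?e k * ((if k = idx d then 1 / Q else if idx d < k then - ?z else 0)
              * (if k = idx i then Q else if k < idx i then ?z else 0)))" (is "_ = _ * ?S")
          unfolding sum_distrib_left[symmetric] by (subst sum_idx[symmetric]) simp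
        also have "\<dots> = (if d = i then 1 else 0)"
        proof -
          consider "idx d = idx i" | "idx i < idx d" | "idx d < idx i" by linarith
          then show ?thesis
          proof cases
            case 1
            have "?S = (\<Sum>k=1..r+1. if k = idx d then ?e (idx d) else 0)"
              using 1 Q0 by (intro sum.cong refl) auto
            also have "\<dots> = ?e (idx d)" using idx_in[of d] by simp
            finally have "qc q (2 * real (idx d)) * ?S = qc q (2 * real (idx d) + - 2 * real (idx d))"
              by (simp only: qc_simps(2))
            also have "\<dots> = 1" using q by (simp add: qc_def)
            finally show ?thesis using 1 by (simp only: idx_inj if_True refl)
          next
            case 2
            have "?S = 0" using 2 by (intro sum.neutral) auto
            then show ?thesis using 2 by auto
          next
            case 3
            have "?S = (\<Sum>k=1..r+1. ((if k = idx d then ?e k * ?z / Q else 0) + (if k = idx i then - ?z * ?e k * Q else 0))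
                + (if idx d < k \<and> k < idx i then - ?z * (?z * ?e k) else 0))"
            proof (intro sum.cong refl)
              fix k
              consider "k = idx d" | "k = idx i" | "idx d < k" "k < idx i" | "k < idx d" | "idx i < k" by linarith
              then show "?e k * ((if k = idx d then 1 / Q else if idx d < k then - ?z else 0)
                  * (if k = idx i then Q else if k < idx i then ?z else 0))
                = (if k = idx d then ?e k * ?z / Q else 0) + (if k = idx i then - ?z * ?e k * Q else 0)
                  + (if idx d < k \<and> k < idx i then - ?z * (?z * ?e k) else 0)"
                using 3 by cases (simp_all del: left_diff_distrib right_diff_distrib)
            qed
            also have "\<dots> = ?e (idx d) * ?z / Q - ?z * ?e (idx i) * Q + (\<Sum>k=1..r+1. (if idx d < k \<and> k < idx i then - ?z * (?z * ?e k) else 0))"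
              using idx_in[of d] idx_in[of i] by (simp add: sum.distrib) (simp add: algebra_simps)
            also have "(\<Sum>k=1..r+1. (if idx d < k \<and> k < idx i then - ?z * (?z * ?e k) else 0)) = (\<Sum>k\<in>{Suc (idx d)..<idx i}. - ?z * (t k - t (Suc k)))"
              using idx_in[of i] unfolding tel by (intro sum.mono_neutral_cong_right) auto
            also have "\<dots> = - ?z * (\<Sum>k\<in>{Suc (idx d)..<idx i}. t k - t (Suc k))"
              by (rule sum_distrib_left[symmetric])
            also have "(\<Sum>k\<in>{Suc (idx d)..<idx i}. t k - t (Suc k)) = t (Suc (idx d)) - t (idx i)"
              using 3 by (intro sum_telescope) simp
            also have "t (Suc (idx d)) = ?e (idx d) / Q"
              unfolding t_def qc_Q qc_divide by (rule arg_cong[where f = "qc q"]) simp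
            also have "t (idx i) = ?e (idx i) * Q"
              unfolding t_def qc_Q by (simp add: qc_simps(2))
            also have "?e (idx d) * ?z / Q - ?z * ?e (idx i) * Q + - ?z * (?e (idx d) / Q - ?e (idx i) * Q) = 0"
            proof -
              have "E * z / Q - z * I * Q + - z * (E / Q - I * Q) = 0" for E I z
                by (simp add: algebra_simps)
              then show ?thesis .
            qed
            finally have "?S = 0" .
            then show ?thesis using 3 by auto
          qed
        qed
        also have "\<dots> = mat 1 $ (c, d) $ (j, i)" using cd True by (simp add: mat_def)
        finally show ?thesis .
      qed
      finally show ?thesis using sum by simp
    qed
  qed
  then show ?thesis by (simp add: vec_eq_iff split_paired_all)
qed

lemma braiding_data: "braiding_data R Rb (rot_D \<kappa> Rb) (rot_Di R) (rot_Q R) (rot_Q Rb) \<kappa> (1 / W * qc q (- real (r + 1)))"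
proof
  show "R ** Rb = mat 1" "Rb ** R = mat 1" by (rule R_Rb)+
  show "rot_D \<kappa> Rb ** rot_Di R = mat 1" by (rule D_Di)
  then show "rot_Di R ** rot_D \<kappa> Rb = mat 1" by (simp only: matrix_left_right_inverse)
  show "rot_Q R ** rot_Q Rb = mat 1" "rot_Q Rb ** rot_Q R = mat 1"
    by (simp_all add: rot_Q_mult R_Rb rot_Q_mat_1)
  show "braid_kernels R R R R R R" by (rule hecke_R_braid[OF inj(1) Q0])
  show "(\<Sum>i\<in>UNIV. rot_D \<kappa> Rb $ (i, i) $ (a, b)) = (if a = b then 1 / W * qc q (- real (r + 1)) * \<kappa> b else 0)" for a b
    by (rule twist)
  show "1 / W * qc q (- real (r + 1)) \<noteq> 0" using W qc_pos[OF q(1)] by simp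
  fix a b c e
  show "R $ (a, e) $ (b, c) = rot_Di R $ (e, c) $ (a, b)" "rot_Di R $ (a, e) $ (b, c) = rot_Q R $ (e, c) $ (a, b)"
    by (simp_all add: rot_entries)
  show "\<kappa> a * rot_D \<kappa> Rb $ (a, e) $ (b, c) = \<kappa> c * Rb $ (e, c) $ (a, b)"
  proof -
    have "\<kappa> a * (\<kappa> c / \<kappa> a) = \<kappa> c" using \<kappa>0[of a] by simp
    then show ?thesis by (simp only: rot_entries mult.assoc[symmetric])
  qed
  \<comment> \<open>Nonzero entries of the matrix preserve the total weight, so the weights of both caps agree.\<close>
  have "(e, a) = (c, b) \<or> (e, a) = (b, c) \<or> Rb $ (c, b) $ (e, a) = 0"
    using hecke_R_eq_0[of "(e, a)" "(c, b)"] by (simp only: fst_conv snd_conv) blast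
  then have "Rb $ (c, b) $ (e, a) = 0 \<or> \<kappa> c * \<kappa> b = \<kappa> e * \<kappa> a"
    by (elim disjE) (simp_all only: prod.inject mult.commute simp_thms)
  then show "\<kappa> a * rot_Q Rb $ (a, e) $ (b, c) = \<kappa> c * rot_D \<kappa> Rb $ (e, c) $ (a, b)"
  proof
    assume "Rb $ (c, b) $ (e, a) = 0" then show ?thesis by (simp only: rot_entries mult_zero_right)
  next
    assume "\<kappa> c * \<kappa> b = \<kappa> e * \<kappa> a"
    then have "\<kappa> c * (\<kappa> b / \<kappa> e) = \<kappa> a" using \<kappa>0[of e] by simp
    then show ?thesis by (simp only: rot_entries mult.assoc[symmetric])
  qed
qed

end

end

section \<open>The braidings that involve the dual module\<close>

lemma kron_mult: "kron A B ** kron C D = kron (A ** C) (B ** D)"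
proof -
  have "(kron A B ** kron C D) $ x $ y = kron (A ** C) (B ** D) $ x $ y" for x y
    by (simp add: kron_def matrix_matrix_mult_def sum_UNIV_prod sum_product mult_ac)
  then show ?thesis by (simp add: vec_eq_iff)
qed

lemma kron_mat_1: "kron (mat 1) (mat 1) = mat 1"
  by (auto simp: kron_def mat_def vec_eq_iff)

lemma kron_minus: "kron (- A) B = - kron A B" "kron A (- B) = - kron A B"
  by (simp_all add: kron_def vec_eq_iff)

lemma matrix_minus_mult: "(- A) ** B = - (A ** B)" "A ** (- B) = - (A ** B)" for A :: "complex^'n^'m"
  by (simp_all add: matrix_matrix_mult_def vec_eq_iff sum_negf)

lemma matrix_add_rdistrib: "(A + B) ** C = A ** C + B ** C" for A B :: "complex^'n^'m"
  by (simp add: matrix_matrix_mult_def vec_eq_iff distrib_right sum.distrib)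

lemma rot_Di_add: "rot_Di (A + B) = rot_Di A + rot_Di B" "rot_Di (- A) = - rot_Di A"
  by (simp_all add: rot_Di_def vec_eq_iff)

lemma rot_Q_add: "rot_Q (A + B) = rot_Q A + rot_Q B" "rot_Q (- A) = - rot_Q A"
  by (simp_all add: rot_Q_def vec_eq_iff)

lemma sum_3412:
  "(\<Sum>i\<in>A. \<Sum>l\<in>B. \<Sum>j\<in>C. \<Sum>k\<in>D. g i l j k) = (\<Sum>j\<in>C. \<Sum>i\<in>A. \<Sum>k\<in>D. \<Sum>l\<in>B. g i l j k)"
proof -
  have "(\<Sum>i\<in>A. \<Sum>l\<in>B. \<Sum>j\<in>C. \<Sum>k\<in>D. g i l j k) = (\<Sum>i\<in>A. \<Sum>j\<in>C. \<Sum>k\<in>D. \<Sum>l\<in>B. g i l j k)"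
    by (rule sum.cong[OF refl]) (rule sum_rotate3[symmetric])
  also have "\<dots> = (\<Sum>j\<in>C. \<Sum>i\<in>A. \<Sum>k\<in>D. \<Sum>l\<in>B. g i l j k)"
    by (rule sum.swap)
  finally show ?thesis .
qed

text \<open>In a rotated matrix the legs that have been turned are acted on by transposed operators, on the other side.\<close>
lemma rot_Di_kron:
  "kron B (transpose D) ** rot_Di M ** kron (transpose A) C = rot_Di (kron A B ** M ** kron C D)"
proof -
  have "(kron B (transpose D) ** rot_Di M ** kron (transpose A) C) $ (k, l) $ (j, i)
    = rot_Di (kron A B ** M ** kron C D) $ (k, l) $ (j, i)" for k l j i
  proof -
    let ?t = "\<lambda>i' l' j' k'. A $ j $ j' * B $ k $ k' * M $ (j', k') $ (i', l') * C $ i' $ i * D $ l' $ l"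
    have "(kron B (transpose D) ** rot_Di M ** kron (transpose A) C) $ (k, l) $ (j, i)
      = (\<Sum>j'\<in>UNIV. \<Sum>i'\<in>UNIV. \<Sum>k'\<in>UNIV. \<Sum>l'\<in>UNIV. ?t i' l' j' k')"
      by (simp add: matrix_matrix_mult_def kron_def transpose_def sum_UNIV_prod rot_entries sum_distrib_right sum_distrib_left mult_ac)
    also have "\<dots> = (\<Sum>i'\<in>UNIV. \<Sum>l'\<in>UNIV. \<Sum>j'\<in>UNIV. \<Sum>k'\<in>UNIV. ?t i' l' j' k')"
      by (rule sum_3412[symmetric])
    also have "\<dots> = rot_Di (kron A B ** M ** kron C D) $ (k, l) $ (j, i)"
      by (simp add: matrix_matrix_mult_def kron_def transpose_def sum_UNIV_prod rot_entries sum_distrib_right sum_distrib_left mult_ac)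
    finally show ?thesis .
  qed
  then show ?thesis by (simp add: vec_eq_iff split_paired_all)
qed

lemma rot_Q_kron:
  "kron (transpose D) (transpose C) ** rot_Q M ** kron (transpose B) (transpose A) = rot_Q (kron A B ** M ** kron C D)"
proof -
  have "(kron (transpose D) (transpose C) ** rot_Q M ** kron (transpose B) (transpose A)) $ (k, l) $ (i, j)
    = rot_Q (kron A B ** M ** kron C D) $ (k, l) $ (i, j)" for k l j i
  proof -
    let ?t = "\<lambda>i' j' k' l'. A $ j $ j' * B $ i $ i' * M $ (j', i') $ (l', k') * C $ l' $ l * D $ k' $ k"
    have "(kron (transpose D) (transpose C) ** rot_Q M ** kron (transpose B) (transpose A)) $ (k, l) $ (i, j)
      = (\<Sum>i'\<in>UNIV. \<Sum>j'\<in>UNIV. \<Sum>k'\<in>UNIV. \<Sum>l'\<in>UNIV. ?t i' j' k' l')"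
      by (simp add: matrix_matrix_mult_def kron_def transpose_def sum_UNIV_prod rot_entries sum_distrib_right sum_distrib_left mult_ac)
    also have "\<dots> = (\<Sum>j'\<in>UNIV. \<Sum>i'\<in>UNIV. \<Sum>k'\<in>UNIV. \<Sum>l'\<in>UNIV. ?t i' j' k' l')"
      by (rule sum.swap)
    also have "\<dots> = (\<Sum>j'\<in>UNIV. \<Sum>i'\<in>UNIV. \<Sum>l'\<in>UNIV. \<Sum>k'\<in>UNIV. ?t i' j' k' l')"
      by (rule sum.cong[OF refl], rule sum.cong[OF refl], rule sum.swap)
    also have "\<dots> = (\<Sum>l'\<in>UNIV. \<Sum>j'\<in>UNIV. \<Sum>i'\<in>UNIV. \<Sum>k'\<in>UNIV. ?t i' j' k' l')"
      by (rule sum_rotate3)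
    also have "\<dots> = (\<Sum>l'\<in>UNIV. \<Sum>k'\<in>UNIV. \<Sum>j'\<in>UNIV. \<Sum>i'\<in>UNIV. ?t i' j' k' l')"
      by (rule sum.cong[OF refl], rule sum_rotate3)
    also have "\<dots> = rot_Q (kron A B ** M ** kron C D) $ (k, l) $ (i, j)"
      by (simp add: matrix_matrix_mult_def kron_def transpose_def sum_UNIV_prod rot_entries sum_distrib_right sum_distrib_left mult_ac)
    finally show ?thesis .
  qed
  then show ?thesis by (simp add: vec_eq_iff split_paired_all)
qed

lemma transpose_mat_1: "transpose (mat 1 :: complex^'n^'n) = mat 1"
  by (simp add: transpose_mat)

lemma rot_Di_left: "kron B (transpose D) ** rot_Di M = rot_Di (kron (mat 1) B ** M ** kron (mat 1) D)"
  and rot_Di_right: "rot_Di M ** kron (transpose A) C = rot_Di (kron A (mat 1) ** M ** kron C (mat 1))"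
  using rot_Di_kron[of B D M "mat 1" "mat 1"] rot_Di_kron[of "mat 1" "mat 1" M A C]
  by (simp_all add: transpose_mat_1 kron_mat_1)

lemma rot_Q_left: "kron (transpose D) (transpose C) ** rot_Q M = rot_Q (M ** kron C D)"
  and rot_Q_right: "rot_Q M ** kron (transpose B) (transpose A) = rot_Q (kron A B ** M)"
  using rot_Q_kron[of D C M "mat 1" "mat 1"] rot_Q_kron[of "mat 1" "mat 1" M B A]
  by (simp_all add: transpose_mat_1 kron_mat_1)

context
  fixes X :: "('n::finite) rep" and R :: "complex^('n \<times> 'n)^('n \<times> 'n)" and i :: nat
  assumes inv: "X (GK i) ** X (GKinv i) = mat 1" "X (GKinv i) ** X (GK i) = mat 1"
    and RK: "R ** tensor_rep X X (GK i) = tensor_rep X X (GK i) ** R"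
    and RL: "R ** tensor_rep X X (GKinv i) = tensor_rep X X (GKinv i) ** R"
    and RE: "R ** tensor_rep X X (GE i) = tensor_rep X X (GE i) ** R"
    and RF: "R ** tensor_rep X X (GF i) = tensor_rep X X (GF i) ** R"
begin

abbreviation "K \<equiv> X (GK i)"
abbreviation "K' \<equiv> X (GKinv i)"
abbreviation "EE \<equiv> X (GE i)"
abbreviation "FF \<equiv> X (GF i)"

lemmas K_simps = kron_mult matrix_mul_lid matrix_mul_rid inv

lemma K_comm: "kron K K ** R = R ** kron K K" "kron K' K' ** R = R ** kron K' K'"
  using RK RL by (simp_all add: tensor_rep.simps)

lemma E_comm: "R ** kron EE K + R ** kron (mat 1) EE = kron EE K ** R + kron (mat 1) EE ** R"
  using RE by (simp add: tensor_rep.simps matrix_add_ldistrib matrix_add_rdistrib)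

lemma F_comm: "R ** kron FF (mat 1) + R ** kron K' FF = kron FF (mat 1) ** R + kron K' FF ** R"
  using RF by (simp add: tensor_rep.simps matrix_add_ldistrib matrix_add_rdistrib)

text \<open>The rotations of a module map are module maps, where turned legs carry the dual representation. For the raising and
lowering operators, multiply the relation for \<open>R\<close> by a power of \<open>K\<close> on one leg so that the terms that change
sides match the antipode in the dual action.\<close>
lemma Di_K: "tensor_rep X (dual_rep X) (GK i) ** rot_Di R = rot_Di R ** tensor_rep (dual_rep X) X (GK i)"
proof -
  have "kron (mat 1) K ** R ** kron (mat 1) K' = kron K' (mat 1) ** (kron K K ** R) ** kron (mat 1) K'"
    by (simp add: matrix_mul_assoc K_simps)
  also have "\<dots> = kron K' (mat 1) ** R ** (kron K K ** kron (mat 1) K')"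
    by (simp only: K_comm matrix_mul_assoc)
  also have "\<dots> = kron K' (mat 1) ** R ** kron K (mat 1)"
    by (simp add: K_simps)
  finally show ?thesis by (simp add: tensor_rep.simps dual_rep.simps rot_Di_left rot_Di_right)
qed

lemma Di_E: "tensor_rep X (dual_rep X) (GE i) ** rot_Di R = rot_Di R ** tensor_rep (dual_rep X) X (GE i)"
proof -
  have e1: "R ** kron EE (mat 1) + R ** kron (mat 1) (EE ** K')
      = kron EE K ** R ** kron (mat 1) K' + kron (mat 1) EE ** R ** kron (mat 1) K'"
    using arg_cong[OF E_comm, of "\<lambda>u. u ** kron (mat 1) K'"]
    by (simp add: matrix_add_rdistrib matrix_mul_assoc[symmetric] K_simps)
  have "kron EE K ** R ** kron (mat 1) K' = kron (EE ** K') (mat 1) ** (kron K K ** R) ** kron (mat 1) K'"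
  proof -
    have "kron EE K = kron (EE ** K') (mat 1) ** kron K K"
      by (simp add: kron_mult matrix_mul_assoc[symmetric] inv)
    then show ?thesis by (simp only: matrix_mul_assoc)
  qed
  also have "\<dots> = kron (EE ** K') (mat 1) ** R ** (kron K K ** kron (mat 1) K')"
    by (simp only: K_comm matrix_mul_assoc)
  also have "\<dots> = kron (EE ** K') (mat 1) ** R ** kron K (mat 1)"
    by (simp add: K_simps)
  finally have e2: "kron EE K ** R ** kron (mat 1) K' = kron (EE ** K') (mat 1) ** R ** kron K (mat 1)" .
  have l: "kron EE (transpose K') ** rot_Di R = rot_Di (kron (mat 1) EE ** R ** kron (mat 1) K')"
    "kron (mat 1) (transpose (- (EE ** K'))) ** rot_Di R = rot_Di (- (R ** kron (mat 1) (EE ** K')))"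
    using rot_Di_left[of EE K' R] rot_Di_left[of "mat 1" "- (EE ** K')" R]
    by (simp_all add: kron_mat_1 kron_minus matrix_minus_mult)
  have r: "rot_Di R ** kron (transpose (- (EE ** K'))) K = rot_Di (- (kron (EE ** K') (mat 1) ** R ** kron K (mat 1)))"
    "rot_Di R ** kron (mat 1) EE = rot_Di (R ** kron EE (mat 1))"
    using rot_Di_right[of R "- (EE ** K')" K] rot_Di_right[of R "mat 1" EE]
    by (simp_all add: transpose_mat_1 kron_mat_1 kron_minus matrix_minus_mult)
  have "kron (mat 1) EE ** R ** kron (mat 1) K' + - (R ** kron (mat 1) (EE ** K'))
      = - (kron (EE ** K') (mat 1) ** R ** kron K (mat 1)) + R ** kron EE (mat 1)"
    using e1 unfolding e2 by (simp add: algebra_simps)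
  then show ?thesis
    unfolding tensor_rep.simps dual_rep.simps matrix_add_rdistrib matrix_add_ldistrib l r rot_Di_add(1)[symmetric] by simp
qed

lemma Di_F: "tensor_rep X (dual_rep X) (GF i) ** rot_Di R = rot_Di R ** tensor_rep (dual_rep X) X (GF i)"
proof -
  have e1: "kron K (mat 1) ** R ** kron FF (mat 1) + kron K (mat 1) ** R ** kron K' FF
      = kron (K ** FF) (mat 1) ** R + kron (mat 1) FF ** R"
    using arg_cong[OF F_comm, of "\<lambda>u. kron K (mat 1) ** u"]
    by (simp add: matrix_add_ldistrib matrix_mul_assoc K_simps)
  have "kron (mat 1) K' ** R ** kron (mat 1) (K ** FF) = kron K (mat 1) ** (kron K' K' ** R) ** kron (mat 1) (K ** FF)"
    by (simp add: matrix_mul_assoc K_simps)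
  also have "\<dots> = kron K (mat 1) ** R ** (kron K' K' ** kron (mat 1) (K ** FF))"
    by (simp only: K_comm matrix_mul_assoc)
  also have "\<dots> = kron K (mat 1) ** R ** kron K' FF"
    by (simp add: kron_mult matrix_mul_assoc inv matrix_mul_lid matrix_mul_rid)
  finally have e2: "kron (mat 1) K' ** R ** kron (mat 1) (K ** FF) = kron K (mat 1) ** R ** kron K' FF" .
  have l: "kron FF (mat 1) ** rot_Di R = rot_Di (kron (mat 1) FF ** R)"
    "kron K' (transpose (- (K ** FF))) ** rot_Di R = rot_Di (- (kron (mat 1) K' ** R ** kron (mat 1) (K ** FF)))"
    using rot_Di_left[of FF "mat 1" R] rot_Di_left[of K' "- (K ** FF)" R]
    by (simp_all add: transpose_mat_1 kron_mat_1 kron_minus matrix_minus_mult)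
  have r: "rot_Di R ** kron (transpose (- (K ** FF))) (mat 1) = rot_Di (- (kron (K ** FF) (mat 1) ** R))"
    "rot_Di R ** kron (transpose K) FF = rot_Di (kron K (mat 1) ** R ** kron FF (mat 1))"
    using rot_Di_right[of R "- (K ** FF)" "mat 1"] rot_Di_right[of R K FF]
    by (simp_all add: kron_mat_1 kron_minus matrix_minus_mult)
  have "kron (mat 1) FF ** R + - (kron (mat 1) K' ** R ** kron (mat 1) (K ** FF))
      = - (kron (K ** FF) (mat 1) ** R) + kron K (mat 1) ** R ** kron FF (mat 1)"
    using e1 unfolding e2 by (simp add: algebra_simps)
  then show ?thesis
    unfolding tensor_rep.simps dual_rep.simps matrix_add_rdistrib matrix_add_ldistrib l r rot_Di_add(1)[symmetric] by simp
qed

lemma Q_K: "rot_Q R ** tensor_rep (dual_rep X) (dual_rep X) (GK i) = tensor_rep (dual_rep X) (dual_rep X) (GK i) ** rot_Q R"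
  by (simp add: tensor_rep.simps dual_rep.simps rot_Q_left rot_Q_right K_comm)

lemma Q_E: "rot_Q R ** tensor_rep (dual_rep X) (dual_rep X) (GE i) = tensor_rep (dual_rep X) (dual_rep X) (GE i) ** rot_Q R"
proof -
  have r: "kron EE K ** kron K' K' = kron (EE ** K') (mat 1)" "kron (mat 1) EE ** kron K' K' = kron K' (EE ** K')"
    by (simp_all add: K_simps)
  have 1: "(R ** kron EE K + R ** kron (mat 1) EE) ** kron K' K' = R ** kron (EE ** K') (mat 1) + R ** kron K' (EE ** K')"
    unfolding matrix_add_rdistrib matrix_mul_assoc[symmetric] r ..
  have "(kron EE K ** R + kron (mat 1) EE ** R) ** kron K' K' = kron (EE ** K') (mat 1) ** R + kron K' (EE ** K') ** R"
    unfolding matrix_add_rdistrib matrix_mul_assoc[symmetric] K_comm(2)[symmetric] 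
    unfolding matrix_mul_assoc r ..
  with 1 have e: "R ** kron (EE ** K') (mat 1) + R ** kron K' (EE ** K') = kron (EE ** K') (mat 1) ** R + kron K' (EE ** K') ** R"
    by (simp only: E_comm)
  have l: "kron (transpose (- (EE ** K'))) (transpose K') ** rot_Q R = rot_Q (- (R ** kron K' (EE ** K')))"
    "kron (mat 1) (transpose (- (EE ** K'))) ** rot_Q R = rot_Q (- (R ** kron (EE ** K') (mat 1)))"
    using rot_Q_left[of "- (EE ** K')" K' R] rot_Q_left[of "mat 1" "- (EE ** K')" R]
    by (simp_all add: transpose_mat_1 kron_minus matrix_minus_mult)
  have r': "rot_Q R ** kron (transpose (- (EE ** K'))) (transpose K') = rot_Q (- (kron K' (EE ** K') ** R))"
    "rot_Q R ** kron (mat 1) (transpose (- (EE ** K'))) = rot_Q (- (kron (EE ** K') (mat 1) ** R))"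
    using rot_Q_right[of R "- (EE ** K')" K'] rot_Q_right[of R "mat 1" "- (EE ** K')"]
    by (simp_all add: transpose_mat_1 kron_minus matrix_minus_mult)
  have "- (kron K' (EE ** K') ** R) + - (kron (EE ** K') (mat 1) ** R) = - (R ** kron K' (EE ** K')) + - (R ** kron (EE ** K') (mat 1))"
    using e by (simp add: algebra_simps)
  then show ?thesis
    unfolding tensor_rep.simps dual_rep.simps matrix_add_rdistrib matrix_add_ldistrib l r' rot_Q_add(1)[symmetric] by simp
qed

lemma Q_F: "rot_Q R ** tensor_rep (dual_rep X) (dual_rep X) (GF i) = tensor_rep (dual_rep X) (dual_rep X) (GF i) ** rot_Q R"
proof -
  have r: "kron K K ** kron FF (mat 1) = kron (K ** FF) K" "kron K K ** kron K' FF = kron (mat 1) (K ** FF)"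
    by (simp_all add: K_simps)
  have 1: "kron K K ** (kron FF (mat 1) ** R + kron K' FF ** R) = kron (K ** FF) K ** R + kron (mat 1) (K ** FF) ** R"
    unfolding matrix_add_ldistrib matrix_mul_assoc r ..
  have "kron K K ** (R ** kron FF (mat 1) + R ** kron K' FF) = R ** kron (K ** FF) K + R ** kron (mat 1) (K ** FF)"
    unfolding matrix_add_ldistrib matrix_mul_assoc K_comm(1) 
    unfolding matrix_mul_assoc[symmetric] r ..
  with 1 have e: "R ** kron (K ** FF) K + R ** kron (mat 1) (K ** FF) = kron (K ** FF) K ** R + kron (mat 1) (K ** FF) ** R"
    by (simp only: F_comm)
  have l: "kron (transpose (- (K ** FF))) (mat 1) ** rot_Q R = rot_Q (- (R ** kron (mat 1) (K ** FF)))"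
    "kron (transpose K) (transpose (- (K ** FF))) ** rot_Q R = rot_Q (- (R ** kron (K ** FF) K))"
    using rot_Q_left[of "- (K ** FF)" "mat 1" R] rot_Q_left[of K "- (K ** FF)" R]
    by (simp_all add: transpose_mat_1 kron_minus matrix_minus_mult)
  have r': "rot_Q R ** kron (transpose (- (K ** FF))) (mat 1) = rot_Q (- (kron (mat 1) (K ** FF) ** R))"
    "rot_Q R ** kron (transpose K) (transpose (- (K ** FF))) = rot_Q (- (kron (K ** FF) K ** R))"
    using rot_Q_right[of R "- (K ** FF)" "mat 1"] rot_Q_right[of R K "- (K ** FF)"]
    by (simp_all add: transpose_mat_1 kron_minus matrix_minus_mult)
  have "- (kron (mat 1) (K ** FF) ** R) + - (kron (K ** FF) K ** R) = - (R ** kron (mat 1) (K ** FF)) + - (R ** kron (K ** FF) K)"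
    using e by (simp add: algebra_simps)
  then show ?thesis
    unfolding tensor_rep.simps dual_rep.simps matrix_add_rdistrib matrix_add_ldistrib l r' rot_Q_add(1)[symmetric] by simp
qed

end

section \<open>Identification of the braidings\<close>

text \<open>A complex subspace; the vectors are scaled by \<open>*s\<close>.\<close>
definition lin_closed :: "(complex^'n) set \<Rightarrow> bool" where
  "lin_closed U \<longleftrightarrow> 0 \<in> U \<and> (\<forall>x\<in>U. \<forall>y\<in>U. x + y \<in> U) \<and> (\<forall>c. \<forall>x\<in>U. c *s x \<in> U)"

lemma lin_closed_axis:
  fixes U :: "(complex^'n::finite) set"
  assumes U: "lin_closed U" and ax: "\<And>b. axis b 1 \<in> U"
  shows "x \<in> U"
proof -
  have B: "(\<Sum>b\<in>B. x $ b *s axis b 1) \<in> U" if "finite B" for B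
    using that U ax by (induction B) (auto simp: lin_closed_def)
  have x: "x = (\<Sum>b\<in>UNIV. x $ b *s axis b 1)"
    by (simp add: vec_eq_iff axis_def if_distrib[of "\<lambda>u. _ * u"] cong: if_cong)
  show ?thesis by (subst x) (rule B, rule finite)
qed

lemma tensor_vec_add: "tensor_vec (x + x') y = tensor_vec x y + tensor_vec x' y"
    "tensor_vec x (y + y') = tensor_vec x y + tensor_vec x y'"
  by (simp_all add: tensor_vec_def vec_eq_iff algebra_simps)

text \<open>A vector of highest weight tensored with one of lowest weight generates the tensor product: lowering operators move
the first factor alone because they annihilate the second, and modulo what has been reached raising operators move the
second factor.\<close>
lemma tensor_generated:
  fixes X :: "('a::finite) rep" and Y :: "('b::finite) rep" and S :: "(complex^('a \<times> 'b)) set"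
  assumes S: "lin_closed S"
    and act: "\<And>i z. i \<in> I \<Longrightarrow> z \<in> S \<Longrightarrow> tensor_rep X Y (GK i) *v z \<in> S"
      "\<And>i z. i \<in> I \<Longrightarrow> z \<in> S \<Longrightarrow> tensor_rep X Y (GE i) *v z \<in> S"
      "\<And>i z. i \<in> I \<Longrightarrow> z \<in> S \<Longrightarrow> tensor_rep X Y (GF i) *v z \<in> S"
    and inv: "\<And>i. i \<in> I \<Longrightarrow> X (GK i) ** X (GKinv i) = mat 1"
    and hw: "\<And>U x. lin_closed U \<Longrightarrow> (\<And>i x. i \<in> I \<Longrightarrow> x \<in> U \<Longrightarrow> X (GF i) *v x \<in> U) \<Longrightarrow> x1 \<in> U \<Longrightarrow> x \<in> U"
    and lw: "\<And>U y. lin_closed U \<Longrightarrow> (\<And>i y. i \<in> I \<Longrightarrow> y \<in> U \<Longrightarrow> Y (GE i) *v y \<in> U) \<Longrightarrow> y1 \<in> U \<Longrightarrow> y \<in> U"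
    and F0: "\<And>i. i \<in> I \<Longrightarrow> Y (GF i) *v y1 = 0"
    and gen: "tensor_vec x1 y1 \<in> S"
  shows "z \<in> S"
proof -
  have s1: "tensor_vec x y1 \<in> S" for x
  proof -
    have "x \<in> {x. tensor_vec x y1 \<in> S}"
    proof (rule hw)
      show "lin_closed {x. tensor_vec x y1 \<in> S}"
        using S by (auto simp: lin_closed_def tensor_vec_0 tensor_vec_add tensor_vec_scale)
      fix i x assume "i \<in> I" "x \<in> {x. tensor_vec x y1 \<in> S}"
      then show "X (GF i) *v x \<in> {x. tensor_vec x y1 \<in> S}"
        using act(3)[of i "tensor_vec x y1"]
        by (simp add: tensor_rep.simps matrix_vector_add_rdistrib kron_tensor_vec F0 tensor_vec_0)
    qed (use gen in simp)
    then show ?thesis by simp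
  qed
  have s2: "\<forall>x. tensor_vec x y \<in> S" for y
  proof -
    let ?U = "{y. \<forall>x. tensor_vec x y \<in> S}"
    have "y \<in> ?U"
    proof (rule lw)
      show "lin_closed ?U"
        using S by (auto simp: lin_closed_def tensor_vec_0 tensor_vec_add tensor_vec_scale)
      fix i y assume i: "i \<in> I" and y: "y \<in> ?U"
      \<comment> \<open>The coproduct of \<open>E\<close> involves \<open>K\<close> on the second factor, which is first seen to preserve the subspace.\<close>
      have K: "tensor_vec x (Y (GK i) *v y) \<in> S" for x
      proof -
        have "tensor_rep X Y (GK i) *v tensor_vec (X (GKinv i) *v x) y \<in> S" using act(1) i y by simp
        then show ?thesis using inv[OF i] by (simp add: tensor_rep.simps kron_tensor_vec matrix_vector_mul_assoc)
      qed
      have "tensor_vec x (Y (GE i) *v y) \<in> S" for x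
      proof -
        have "tensor_rep X Y (GE i) *v tensor_vec x y \<in> S" using act(2) i y by simp
        then have "tensor_vec (X (GE i) *v x) (Y (GK i) *v y) + tensor_vec x (Y (GE i) *v y) \<in> S"
          by (simp add: tensor_rep.simps matrix_vector_add_rdistrib kron_tensor_vec)
        moreover have "(-1) *s tensor_vec (X (GE i) *v x) (Y (GK i) *v y) \<in> S"
          using S K by (simp only: lin_closed_def)
        ultimately have "(-1) *s tensor_vec (X (GE i) *v x) (Y (GK i) *v y) +
            (tensor_vec (X (GE i) *v x) (Y (GK i) *v y) + tensor_vec x (Y (GE i) *v y)) \<in> S"
          using S by (simp only: lin_closed_def)
        then show ?thesis by (simp add: vec_eq_iff)
      qed
      then show "Y (GE i) *v y \<in> ?U" by simp
    qed (use s1 in simp)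
    then show ?thesis by simp
  qed
  show ?thesis
  proof (rule lin_closed_axis[OF S])
    fix b :: "'a \<times> 'b"
    obtain c d where b: "b = (c, d)" by force
    have "tensor_vec (axis c 1) (axis d 1) \<in> S" using s2 by simp
    then show "axis b 1 \<in> S" by (simp add: b tensor_vec_axis)
  qed
qed

lemma omega_in_lattice:
  assumes l: "l \<in> {1..r}"
  shows "omega r l \<in> weight_lattice r" "(\<lambda>k. - omega r l k) \<in> weight_lattice r"
proof -
  have c: "(\<lambda>k. of_int c * omega r l k) \<in> weight_lattice r" for c
    unfolding weight_lattice_def mem_Collect_eq
  proof (intro exI ext)
    fix k
    have "(\<Sum>i=1..r. of_int (if i = l then c else 0) * omega r i k) = (\<Sum>i=1..r. if i = l then of_int c * omega r l k else 0)"
      by (intro sum.cong) auto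
    also have "\<dots> = of_int c * omega r l k" using l by simp
    finally show "of_int c * omega r l k = (\<Sum>i=1..r. of_int ((\<lambda>i. if i = l then c else 0) i) * omega r i k)"
      by (rule sym)
  qed
  show "omega r l \<in> weight_lattice r" using c[of 1] by simp
  show "(\<lambda>k. - omega r l k) \<in> weight_lattice r" using c[of "-1"] by simp
qed

context vector_rep begin

abbreviation "X' \<equiv> dual_rep X"

lemma inv:
  assumes j: "j \<in> {1..r}"
  shows "X (GK (n j)) ** X (GKinv (n j)) = mat 1" "X (GKinv (n j)) ** X (GK (n j)) = mat 1"
proof -
  have one: "qc q x * qc q (- x) = 1" "qc q (- x) * qc q x = 1" for x
    using q by (simp_all only: qc_simps(2)) (simp_all add: qc_def)
  have "(X (GK (n j)) ** X (GKinv (n j))) $ a $ b = mat 1 $ a $ b"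
    "(X (GKinv (n j)) ** X (GK (n j))) $ a $ b = mat 1 $ a $ b" for a b
    unfolding matrix_matrix_mult_def vec_lambda_beta entries[OF j]
    by (auto simp: mat_def if_distrib[of "\<lambda>u. u * _"] one cong: if_cong)
  then show "X (GK (n j)) ** X (GKinv (n j)) = mat 1" "X (GKinv (n j)) ** X (GK (n j)) = mat 1"
    by (simp_all only: vec_eq_iff) simp_all
qed

lemma axis_bb: "axis b 1 = v (idx b)"
  by (simp add: bb_idx)

lemma nodeE:
  assumes "i \<in> {1..r}" obtains j where "j \<in> {1..r}" "i = n j"
  using assms node_in[OF assms, of s] node_node[OF assms, of s] by metis

lemma dual_act:
  assumes j: "j \<in> {1..r}" and k: "k \<in> {1..r+1}"
  shows "X' (GK (n j)) *v v k = qc q (- nu j k) *s v k"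
    and "k \<noteq> j \<Longrightarrow> X' (GE (n j)) *v v k = 0"
    and "\<exists>c. c \<noteq> 0 \<and> X' (GE (n j)) *v v j = c *s v (j + 1)"
    and "k \<noteq> j + 1 \<Longrightarrow> X' (GF (n j)) *v v k = 0"
    and "\<exists>c. c \<noteq> 0 \<and> X' (GF (n j)) *v v (j + 1) = c *s v j"
proof -
  have EK: "(X (GE (n j)) ** X (GKinv (n j))) $ a $ b = X (GE (n j)) $ a $ b * qc q (- nu j (idx b))" for a b
    by (simp add: matrix_matrix_mult_def entries[OF j] if_distrib[of "\<lambda>u. _ * u"] cong: if_cong)
  have KF: "(X (GK (n j)) ** X (GF (n j))) $ a $ b = qc q (nu j (idx a)) * X (GF (n j)) $ a $ b" for a b
    by (simp add: matrix_matrix_mult_def entries[OF j] if_distrib[of "\<lambda>u. u * _"] cong: if_cong)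
  have E: "X' (GE (n j)) $ a $ b = - (X (GE (n j)) $ b $ a * qc q (- nu j (idx a)))" for a b
    by (simp add: dual_rep.simps transpose_def EK)
  have F: "X' (GF (n j)) $ a $ b = - (qc q (nu j (idx b)) * X (GF (n j)) $ b $ a)" for a b
    by (simp add: dual_rep.simps transpose_def KF)
  have j': "j \<in> {1..r+1}" "j + 1 \<in> {1..r+1}" using j by auto
  show "X' (GK (n j)) *v v k = qc q (- nu j k) *s v k"
    using k by (auto simp: vec_eq_iff matrix_vector_axis dual_rep.simps transpose_def entries[OF j] idx_bb) (simp_all add: axis_def)
  show "X' (GE (n j)) *v v k = 0" if "k \<noteq> j"
    unfolding vec_eq_iff matrix_vector_axis E
    using entries(3)[OF j, of "bb k"] that k by (auto simp: idx_bb)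
  show "X' (GF (n j)) *v v k = 0" if "k \<noteq> j + 1"
    unfolding vec_eq_iff matrix_vector_axis F
    using entries(4)[OF j, of "bb k"] that k by (auto simp: idx_bb)
  show "\<exists>c. c \<noteq> 0 \<and> X' (GE (n j)) *v v j = c *s v (j + 1)"
  proof (intro exI conjI)
    show "- (ee j * qc q (- nu j (j + 1))) \<noteq> 0" using ee_ff_nonzero(1)[OF j] qc_pos[OF q(1)] by simp
    have "X (GE (n j)) $ bb j $ a = (if a = bb (j + 1) then ee j else 0)" for a
      using entries(3)[OF j, of "bb j" a] idx_bb[OF j'(1)] bb_idx[of a] by (auto simp: ee_def)
    then show "X' (GE (n j)) *v v j = (- (ee j * qc q (- nu j (j + 1)))) *s v (j + 1)"
      unfolding vec_eq_iff matrix_vector_axis E using idx_bb[OF j'(2)] by (simp add: axis_def)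
  qed
  show "\<exists>c. c \<noteq> 0 \<and> X' (GF (n j)) *v v (j + 1) = c *s v j"
  proof (intro exI conjI)
    show "- (qc q (nu j (j + 1)) * ff j) \<noteq> 0" using ee_ff_nonzero(2)[OF j] qc_pos[OF q(1)] by simp
    have "X (GF (n j)) $ bb (j + 1) $ a = (if a = bb j then ff j else 0)" for a
      using entries(4)[OF j, of "bb (j + 1)" a] idx_bb[OF j'(2)] bb_idx[of a] by (auto simp: ff_def)
    then show "X' (GF (n j)) *v v (j + 1) = (- (qc q (nu j (j + 1)) * ff j)) *s v j"
      unfolding vec_eq_iff matrix_vector_axis F using idx_bb[OF j'(2)] by (simp add: axis_def)
  qed
qed

lemma lin_closed_scale_iff: "lin_closed U \<Longrightarrow> c \<noteq> 0 \<Longrightarrow> c *s x \<in> U \<Longrightarrow> x \<in> U"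
proof -
  assume "lin_closed U" "c \<noteq> 0" "c *s x \<in> U"
  then have "inverse c *s (c *s x) \<in> U" by (simp only: lin_closed_def)
  then show "x \<in> U" using \<open>c \<noteq> 0\<close> by simp
qed

text \<open>Every basis vector is reached from an end of the chain, in \<open>V\<close> and in its dual.\<close>
lemma chain_V:
  assumes U: "lin_closed U" and F: "\<And>i x. i \<in> {1..r} \<Longrightarrow> x \<in> U \<Longrightarrow> X (GF i) *v x \<in> U" and 1: "v 1 \<in> U"
  shows "x \<in> U"
proof (rule lin_closed_axis[OF U])
  fix b
  have "v k \<in> U" if "1 \<le> k" "k \<le> r + 1" for k
    using that
  proof (induction k rule: dec_induct)
    case (step k)
    then have k: "k \<in> {1..r}" "k \<in> {1..r+1}" by auto
    have "X (GF (n k)) *v v k \<in> U" using F[OF node_in[OF k(1)]] step by simp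
    then have "ff k *s v (k + 1) \<in> U" using act(4)[OF k] by simp
    then show ?case using lin_closed_scale_iff[OF U] ee_ff_nonzero(2)[OF k(1)] by simp
  qed (rule 1)
  then show "axis b 1 \<in> U" using idx_in[of b] axis_bb[of b] by simp
qed

lemma chain_dual_down:
  assumes U: "lin_closed U" and F: "\<And>i x. i \<in> {1..r} \<Longrightarrow> x \<in> U \<Longrightarrow> X' (GF i) *v x \<in> U" and 1: "v (r + 1) \<in> U"
  shows "x \<in> U"
proof (rule lin_closed_axis[OF U])
  fix b
  have "v k \<in> U" if "k \<le> r + 1" "1 \<le> k" for k
    using that
  proof (induction k rule: inc_induct)
    case (step k)
    then have k: "k \<in> {1..r}" "k \<in> {1..r+1}" by auto
    have "X' (GF (n k)) *v v (k + 1) \<in> U" using F[OF node_in[OF k(1)]] step by simp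
    then show ?case using lin_closed_scale_iff[OF U] dual_act(5)[OF k] by metis
  qed (rule 1)
  then show "axis b 1 \<in> U" using idx_in[of b] axis_bb[of b] by simp
qed

lemma chain_dual_up:
  assumes U: "lin_closed U" and F: "\<And>i x. i \<in> {1..r} \<Longrightarrow> x \<in> U \<Longrightarrow> X' (GE i) *v x \<in> U" and 1: "v 1 \<in> U"
  shows "x \<in> U"
proof (rule lin_closed_axis[OF U])
  fix b
  have "v k \<in> U" if "1 \<le> k" "k \<le> r + 1" for k
    using that
  proof (induction k rule: dec_induct)
    case (step k)
    then have k: "k \<in> {1..r}" "k \<in> {1..r+1}" by auto
    have "X' (GE (n k)) *v v k \<in> U" using F[OF node_in[OF k(1)]] step by simp
    then show ?case using lin_closed_scale_iff[OF U] dual_act(3)[OF k] by (metis Suc_eq_plus1)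
  qed (rule 1)
  then show "axis b 1 \<in> U" using idx_in[of b] axis_bb[of b] by simp
qed

lemma node_1_r: "n 1 = s" "n r = r + 1 - s" "s \<in> {1..r}" "r + 1 - s \<in> {1..r}"
  using s r by (auto simp: node_def)

lemma wform_neg: "wform r (alpha i) (\<lambda>k. - \<mu> k) = - wform r (alpha i) \<mu>"
  by (simp add: wform_def sum_negf)

lemma weights_ends:
  assumes "j \<in> {1..r}"
  shows "wform r (alpha (n j)) (omega r s) = nu j 1"
    and "wform r (alpha (n j)) (omega r (r + 1 - s)) = - nu j (r + 1)"
proof -
  have "wform r (alpha (n j)) (omega r s) = (if n j = n 1 then 1 else 0)"
    unfolding node_1_r(1) by (rule wform_alpha_omega[OF node_in[OF assms] node_1_r(3)])
  also have "\<dots> = nu j 1" using node_inj[OF assms, of 1 s] assms r by (auto simp: nu_def)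
  finally show "wform r (alpha (n j)) (omega r s) = nu j 1" .
  have "wform r (alpha (n j)) (omega r (r + 1 - s)) = (if n j = n r then 1 else 0)"
    unfolding node_1_r(2) by (rule wform_alpha_omega[OF node_in[OF assms] node_1_r(4)])
  also have "\<dots> = - nu j (r + 1)" using node_inj[OF assms, of r s] assms r by (auto simp: nu_def)
  finally show "wform r (alpha (n j)) (omega r (r + 1 - s)) = - nu j (r + 1)" .
qed

lemma qc_scale: "(q powr x) *\<^sub>R y = qc q x *s (y :: complex^'m)"
proof -
  have "((q powr x) *\<^sub>R y) $ i = (qc q x *s y) $ i" for i
    unfolding vector_scaleR_component qc_def by (simp add: scaleR_conv_of_real)
  then show ?thesis by (simp add: vec_eq_iff)
qed

lemma weight_vectors:
  shows "highest_weight_vector r q X (omega r s) (v 1)"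
    and "lowest_weight_vector r q X (\<lambda>k. - omega r (r + 1 - s) k) (v (r + 1))"
    and "highest_weight_vector r q X' (omega r (r + 1 - s)) (v (r + 1))"
    and "lowest_weight_vector r q X' (\<lambda>k. - omega r s k) (v 1)"
proof -
  have nz: "v k \<noteq> 0" for k by (simp add: axis_eq_0_iff)
  have e: "1 \<in> {1..r+1}" "r + 1 \<in> {1..r+1}" using r by auto
  note d = highest_weight_vector_def lowest_weight_vector_def weight_vector_def qc_scale
  have *: "\<forall>i\<in>{1..r}. P i" if "\<And>j. j \<in> {1..r} \<Longrightarrow> P (n j)" for P
    using that nodeE by metis
  show "highest_weight_vector r q X (omega r s) (v 1)"
    unfolding d
  proof (intro conjI nz omega_in_lattice(1)[OF node_1_r(3)] *)
    fix j assume j: "j \<in> {1..r}"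
    show "X (GK (n j)) *v v 1 = qc q (wform r (alpha (n j)) (omega r s)) *s v 1"
      unfolding weights_ends(1)[OF j] by (rule act(1)[OF j e(1)])
    show "X (GE (n j)) *v v 1 = 0" using act(3)[OF j e(1)] j by simp
  qed
  show "lowest_weight_vector r q X (\<lambda>k. - omega r (r + 1 - s) k) (v (r + 1))"
    unfolding d
  proof (intro conjI nz omega_in_lattice(2)[OF node_1_r(4)] *)
    fix j assume j: "j \<in> {1..r}"
    show "X (GK (n j)) *v v (r + 1) = qc q (wform r (alpha (n j)) (\<lambda>k. - omega r (r + 1 - s) k)) *s v (r + 1)"
      unfolding wform_neg weights_ends(2)[OF j] minus_minus by (rule act(1)[OF j e(2)])
    show "X (GF (n j)) *v v (r + 1) = 0" using act(4)[OF j e(2)] j by simp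
  qed
  show "highest_weight_vector r q X' (omega r (r + 1 - s)) (v (r + 1))"
    unfolding d
  proof (intro conjI nz omega_in_lattice(1)[OF node_1_r(4)] *)
    fix j assume j: "j \<in> {1..r}"
    show "X' (GK (n j)) *v v (r + 1) = qc q (wform r (alpha (n j)) (omega r (r + 1 - s))) *s v (r + 1)"
      unfolding weights_ends(2)[OF j] by (rule dual_act(1)[OF j e(2)])
    show "X' (GE (n j)) *v v (r + 1) = 0" using j by (intro dual_act(2)[OF j e(2)]) simp
  qed
  show "lowest_weight_vector r q X' (\<lambda>k. - omega r s k) (v 1)"
    unfolding d
  proof (intro conjI nz omega_in_lattice(2)[OF node_1_r(3)] *)
    fix j assume j: "j \<in> {1..r}"
    show "X' (GK (n j)) *v v 1 = qc q (wform r (alpha (n j)) (\<lambda>k. - omega r s k)) *s v 1"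
      unfolding wform_neg weights_ends(1)[OF j] by (rule dual_act(1)[OF j e(1)])
    show "X' (GF (n j)) *v v 1 = 0" using j by (intro dual_act(4)[OF j e(1)]) simp
  qed
qed

definition "W = qc q (const_w r s - 1)"

lemma W0: "W \<noteq> 0" using qc_pos[OF q(1)] by (simp add: W_def)

lemma gens_in: "i \<in> {1..r} \<Longrightarrow> GK i \<in> gens r" "i \<in> {1..r} \<Longrightarrow> GKinv i \<in> gens r" "i \<in> {1..r} \<Longrightarrow> GE i \<in> gens r" "i \<in> {1..r} \<Longrightarrow> GF i \<in> gens r"
  by (auto simp: gens_def)

lemma inv': "i \<in> {1..r} \<Longrightarrow> X (GK i) ** X (GKinv i) = mat 1" "i \<in> {1..r} \<Longrightarrow> X (GKinv i) ** X (GK i) = mat 1"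
  using inv nodeE by metis+

lemma Rvv_eq:
  assumes "is_braiding r q X X Rvv"
  shows "Rvv = hecke_R idx Q W"
proof (rule braiding_VV)
  fix j assume "j \<in> {1..r}"
  then show "Rvv ** tensor_rep X X (GE (n j)) = tensor_rep X X (GE (n j)) ** Rvv"
    "Rvv ** tensor_rep X X (GF (n j)) = tensor_rep X X (GF (n j)) ** Rvv"
    using assms gens_in node_in unfolding is_braiding_def by blast+
next
  have "Rvv *v tensor_vec (v 1) (v (r + 1)) = (q powr wform r (omega r s) (weyl_w0 r (omega r s))) *\<^sub>R tensor_vec (v (r + 1)) (v 1)"
    using assms weight_vectors unfolding is_braiding_def by blast
  then show "Rvv *v vv 1 (r + 1) = W *s vv (r + 1) 1"
    unfolding wform_omega_w0(1)[OF s r] qc_scale W_def tensor_vec_axis .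
qed

text \<open>The composition commutes with the action on \<open>V \<otimes> V\<^sup>*\<close>, so its fixed vectors form a submodule. It contains
a generating vector, because there the two normalisations are inverse to each other.\<close>
lemma Rvd_inverse:
  assumes vv: "is_braiding r q X X Rvv" and vd: "is_braiding r q X X' Rvd"
  shows "rot_Di Rvv ** Rvd = mat 1"
proof -
  let ?S = "{z. rot_Di Rvv *v (Rvd *v z) = z}"
  have comm: "rot_Di Rvv *v (Rvd *v (tensor_rep X X' g *v z)) = tensor_rep X X' g *v z"
    if "rot_Di Rvv *v (Rvd *v z) = z" "Rvd ** tensor_rep X X' g = tensor_rep X' X g ** Rvd"
      "tensor_rep X X' g ** rot_Di Rvv = rot_Di Rvv ** tensor_rep X' X g" for g z
    using that by (metis matrix_vector_mul_assoc)
  have Rg: "Rvv ** tensor_rep X X g = tensor_rep X X g ** Rvv" if "g \<in> gens r" for g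
    using vv that unfolding is_braiding_def by blast
  have Dg: "Rvd ** tensor_rep X X' g = tensor_rep X' X g ** Rvd" if "g \<in> gens r" for g
    using vd that unfolding is_braiding_def by blast
  have Rvv: "Rvv = hecke_R idx Q W" by (rule Rvv_eq[OF vv])
  have "z \<in> ?S" for z
  proof (rule tensor_generated[where I = "{1..r}" and X = X and Y = X' and ?x1.0 = "v 1" and ?y1.0 = "v 1"])
    show "lin_closed ?S" by (simp add: lin_closed_def matrix_vector_linear)
    have "Rvd *v tensor_vec (v 1) (v 1) = (q powr wform r (omega r s) (weyl_w0 r (omega r (r + 1 - s)))) *\<^sub>R tensor_vec (v 1) (v 1)"
      using vd weight_vectors unfolding is_braiding_def by blast
    then have 1: "Rvd *v vv 1 1 = qc q (- const_w r s) *s vv 1 1"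
      unfolding wform_omega_w0(2)[OF s r] qc_scale tensor_vec_axis .
    have 2: "rot_Di Rvv *v vv 1 1 = (Q * W) *s vv 1 1"
    proof -
      have "(rot_Di Rvv *v vv 1 1) $ (k, l) = ((Q * W) *s vv 1 1) $ (k, l)" for k l
        using idx_in[of k] idx_bb[of 1] r
        unfolding matrix_vector_axis rot_entries Rvv by (auto simp: hecke_R_def axis_def)
      then show ?thesis by (simp add: vec_eq_iff split_paired_all del: vector_smult_component)
    qed
    have "qc q (- const_w r s) * (Q * W) = 1"
      using q by (simp add: Q_def W_def qc_simps(2)) (simp add: qc_simps(1))
    then show "tensor_vec (v 1) (v 1) \<in> ?S"
      unfolding mem_Collect_eq tensor_vec_axis 1 matrix_vector_scale 2 by (simp add: vector_smult_assoc)
  next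
    fix i assume i: "i \<in> {1..r}"
    show "X (GK i) ** X (GKinv i) = mat 1" by (rule inv'[OF i])
    obtain j where "j \<in> {1..r}" "i = n j" using i by (rule nodeE)
    then show "X' (GF i) *v v 1 = 0" using dual_act(4)[of j 1] by auto
    note R = Rg[OF gens_in(1)[OF i]] Rg[OF gens_in(2)[OF i]] Rg[OF gens_in(3)[OF i]] Rg[OF gens_in(4)[OF i]]
    fix z assume z: "z \<in> ?S"
    show "tensor_rep X X' (GK i) *v z \<in> ?S"
      using comm[OF _ Dg[OF gens_in(1)[OF i]] Di_K[OF inv'[OF i] R]] z by simp
    show "tensor_rep X X' (GE i) *v z \<in> ?S"
      using comm[OF _ Dg[OF gens_in(3)[OF i]] Di_E[OF inv'[OF i] R]] z by simp
    show "tensor_rep X X' (GF i) *v z \<in> ?S"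
      using comm[OF _ Dg[OF gens_in(4)[OF i]] Di_F[OF inv'[OF i] R]] z by simp
  qed (use chain_V chain_dual_up in blast)+
  then show ?thesis
    by (intro matrix_eq_axis) (simp add: matrix_vector_mul_assoc[symmetric])
qed

text \<open>Again two module maps agree at a generating vector.\<close>
lemma Rdd_eq:
  assumes vv: "is_braiding r q X X Rvv" and dd: "is_braiding r q X' X' Rdd"
  shows "Rdd = rot_Q Rvv"
proof -
  let ?S = "{z. Rdd *v z = rot_Q Rvv *v z}"
  have comm: "Rdd *v (tensor_rep X' X' g *v z) = rot_Q Rvv *v (tensor_rep X' X' g *v z)"
    if "Rdd *v z = rot_Q Rvv *v z" "Rdd ** tensor_rep X' X' g = tensor_rep X' X' g ** Rdd"
      "rot_Q Rvv ** tensor_rep X' X' g = tensor_rep X' X' g ** rot_Q Rvv" for g z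
    using that by (metis matrix_vector_mul_assoc)
  have Rg: "Rvv ** tensor_rep X X g = tensor_rep X X g ** Rvv" if "g \<in> gens r" for g
    using vv that unfolding is_braiding_def by blast
  have Dg: "Rdd ** tensor_rep X' X' g = tensor_rep X' X' g ** Rdd" if "g \<in> gens r" for g
    using dd that unfolding is_braiding_def by blast
  have Rvv: "Rvv = hecke_R idx Q W" by (rule Rvv_eq[OF vv])
  have "z \<in> ?S" for z
  proof (rule tensor_generated[where I = "{1..r}" and X = X' and Y = X' and ?x1.0 = "v (r + 1)" and ?y1.0 = "v 1"])
    show "lin_closed ?S" by (simp add: lin_closed_def matrix_vector_linear)
    have "Rdd *v tensor_vec (v (r + 1)) (v 1) = (q powr wform r (omega r (r + 1 - s)) (weyl_w0 r (omega r (r + 1 - s)))) *\<^sub>R tensor_vec (v 1) (v (r + 1))"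
      using dd weight_vectors unfolding is_braiding_def by blast
    then have 1: "Rdd *v vv (r + 1) 1 = W *s vv 1 (r + 1)"
      unfolding wform_omega_w0(3)[OF s r] qc_scale W_def tensor_vec_axis .
    have "bb 1 \<noteq> bb (r + 1)" "idx (bb 1) = 1" "idx (bb (r + 1)) = r + 1" using r by (auto simp: bb_eq idx_bb)
    then have "(rot_Q Rvv *v vv (r + 1) 1) $ (k, l) = (W *s vv 1 (r + 1)) $ (k, l)" for k l
      unfolding matrix_vector_axis rot_entries Rvv by (auto simp: hecke_R_def axis_def)
    then have "rot_Q Rvv *v vv (r + 1) 1 = W *s vv 1 (r + 1)"
      by (simp add: vec_eq_iff split_paired_all del: vector_smult_component)
    then show "tensor_vec (v (r + 1)) (v 1) \<in> ?S" using 1 by (simp add: tensor_vec_axis)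
  next
    fix i assume i: "i \<in> {1..r}"
    show "X' (GK i) ** X' (GKinv i) = mat 1"
      unfolding dual_rep.simps by (simp add: matrix_transpose_mul[symmetric] inv'[OF i] transpose_mat)
    obtain j where "j \<in> {1..r}" "i = n j" using i by (rule nodeE)
    then show "X' (GF i) *v v 1 = 0" using dual_act(4)[of j 1] by auto
    note R = Rg[OF gens_in(1)[OF i]] Rg[OF gens_in(2)[OF i]] Rg[OF gens_in(3)[OF i]] Rg[OF gens_in(4)[OF i]]
    fix z assume z: "z \<in> ?S"
    show "tensor_rep X' X' (GK i) *v z \<in> ?S"
      using comm[OF _ Dg[OF gens_in(1)[OF i]] Q_K[OF inv'[OF i] R]] z by simp
    show "tensor_rep X' X' (GE i) *v z \<in> ?S"
      using comm[OF _ Dg[OF gens_in(3)[OF i]] Q_E[OF inv'[OF i] R]] z by simp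
    show "tensor_rep X' X' (GF i) *v z \<in> ?S"
      using comm[OF _ Dg[OF gens_in(4)[OF i]] Q_F[OF inv'[OF i] R]] z by simp
  qed (use chain_dual_down chain_dual_up in blast)+
  then show ?thesis by (intro matrix_eq_axis) simp
qed

end

lemma matrix_inv_eq: "A ** B = mat 1 \<Longrightarrow> B ** A = mat 1 \<Longrightarrow> matrix_inv A = B" for A :: "complex^'n^'n"
proof -
  assume AB: "A ** B = mat 1" "B ** A = mat 1"
  have "\<exists>A'. A ** A' = mat 1 \<and> A' ** A = mat 1" using AB by blast
  then have "matrix_inv A ** A = mat 1" unfolding matrix_inv_def by (rule someI2_ex) simp
  then have "matrix_inv A ** (A ** B) = B" by (simp only: matrix_mul_assoc matrix_mul_lid)
  then show "matrix_inv A = B" by (simp only: AB matrix_mul_rid)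
qed

text \<open>The definition of the braidings by normalisation on extremal vectors thus determines their matrices, which
satisfy the axioms of \<open>braiding_data\<close>.\<close>
theorem braidings_of_vector_module:
  fixes V :: "('n::finite) rep"
  assumes "1 \<le> r" and "CARD('n) = r + 1" and "0 < q" and "q < 1" and "s \<in> {1, r}"
    and "simple_module r q V (omega r s)"
    and "weight_basis r q V wt"
    and vv: "is_braiding r q V V Rvv"
    and vd: "is_braiding r q V (dual_rep V) Rvd"
    and dd: "is_braiding r q (dual_rep V) (dual_rep V) Rdd"
  shows "braiding_data Rvv (matrix_inv Rvv) Rvd (matrix_inv Rvd) Rdd (matrix_inv Rdd)
    (\<lambda>b. qc q (wform r (wt b) (two_rho r))) (qc q (- (const_w r s + const_m r s)))"
proof -
  obtain x where x: "uq_module r q V" "highest_weight_vector r q V (omega r s) x"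
    using assms(6) by (auto simp: simple_module_def)
  obtain idx where idx: "vector_module r s q V idx"
    and wt: "\<And>b. wform r (wt b) (two_rho r) = real r + 2 - 2 * real (idx b)"
    by (rule vector_module_exists[OF assms(1-5) x(1) assms(7) x(2)], rule that)
  interpret vector_rep r s q V idx by standard fact+
  define R' where "R' = hecke_R idx' (1 / Q) (1 / W)"
  have data: "braiding_data Rvv R' (rot_D \<kappa> R') (rot_Di Rvv) (rot_Q Rvv) (rot_Q R') \<kappa> (1 / W * qc q (- real (r + 1)))"
    unfolding Rvv_eq[OF vv] R'_def by (rule braiding_data[OF W0])
  then interpret B: braiding_data Rvv R' "rot_D \<kappa> R'" "rot_Di Rvv" "rot_Q Rvv" "rot_Q R'" \<kappa> "1 / W * qc q (- real (r + 1))" .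
  have D: "Rvd = rot_D \<kappa> R'"
  proof -
    have "Rvd = (rot_D \<kappa> R' ** rot_Di Rvv) ** Rvd" by (simp only: B.D_inv matrix_mul_lid)
    also have "\<dots> = rot_D \<kappa> R' ** (rot_Di Rvv ** Rvd)" by (simp only: matrix_mul_assoc)
    also have "\<dots> = rot_D \<kappa> R'" by (simp only: Rvd_inverse[OF vv vd] matrix_mul_rid)
    finally show ?thesis .
  qed
  have "1 / W * qc q (- real (r + 1)) = qc q (- (const_w r s + const_m r s))"
    unfolding W_def qc_simps(3)[symmetric] qc_simps(2) const_m_eq[OF s r] by (rule arg_cong[where f = "qc q"]) simp
  moreover have "\<kappa> = (\<lambda>b. qc q (wform r (wt b) (two_rho r)))"
    by (simp add: fun_eq_iff \<kappa>_def wt)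
  moreover have "matrix_inv Rvv = R'" "matrix_inv Rvd = rot_Di Rvv" "matrix_inv Rdd = rot_Q R'"
    unfolding D Rdd_eq[OF vv dd] by (intro matrix_inv_eq B.R_inv B.D_inv B.Q_inv)+
  ultimately show ?thesis
    using data D Rdd_eq[OF vv dd] by simp
qed

section \<open>Families with values in bimodules\<close>

definition cl :: "('a::complex_vector \<Rightarrow> 'b::complex_vector) \<Rightarrow> bool" where
  "cl h \<longleftrightarrow> (\<forall>x y. h (x + y) = h x + h y) \<and> (\<forall>c x. h (c *\<^sub>C x) = c *\<^sub>C h x)"

lemma clinear_iff: "clinear h \<longleftrightarrow> cl h"
  unfolding Vector_Spaces.linear_iff_module_hom module_hom_iff cl_def
  by (simp add: cvec.module_axioms)

lemma cl_add: "cl h \<Longrightarrow> h (x + y) = h x + h y" and cl_scale: "cl h \<Longrightarrow> h (c *\<^sub>C x) = c *\<^sub>C h x"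
  by (simp_all add: cl_def)

lemma cl_0: "cl h \<Longrightarrow> h 0 = 0"
  using cl_scale[of h 0 0] by simp

lemma cl_minus: "cl h \<Longrightarrow> h (- x) = - h x"
  using cl_scale[of h "-1" x] by simp

lemma cl_diff: "cl h \<Longrightarrow> h (x - y) = h x - h y"
  using cl_add[of h x "- y"] cl_minus[of h y] by simp

lemma cl_sum: "cl h \<Longrightarrow> h (\<Sum>i\<in>I. g i) = (\<Sum>i\<in>I. h (g i))"
  by (induction I rule: infinite_finite_induct) (simp_all add: cl_0 cl_add)

lemma cl_on_legs: "cl h \<Longrightarrow> h (on_legs k A x f) = on_legs k A (\<lambda>f. h (x f)) f"
  by (simp add: on_legs_def cl_sum cl_scale)

lemma cl_cap: "cl h \<Longrightarrow> h (cap \<kappa> k x f) = cap \<kappa> k (\<lambda>f. h (x f)) f"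
  by (simp add: cap_def cl_sum cl_scale)

lemma cl_scaleC: "cl (\<lambda>x. c *\<^sub>C x)"
  by (simp add: cl_def scaleC_add_right mult.commute)

lemma on_legs_scale: "on_legs k A (\<lambda>f. c *\<^sub>C x f) = (\<lambda>f. c *\<^sub>C on_legs k A x f)"
  by (rule ext) (rule cl_on_legs[OF cl_scaleC, symmetric])

lemma on_legs_add: "on_legs k A (\<lambda>f. x f + y f) = (\<lambda>f. on_legs k A x f + on_legs k A y f)"
  by (rule ext) (simp add: on_legs_def scaleC_add_right sum.distrib)

lemma cap_scale: "cap \<kappa> k (\<lambda>f. c *\<^sub>C x f) = (\<lambda>f. c *\<^sub>C cap \<kappa> k x f)"
  by (rule ext) (rule cl_cap[OF cl_scaleC, symmetric])

lemma cap_add: "cap \<kappa> k (\<lambda>f. x f + y f) = (\<lambda>f. cap \<kappa> k x f + cap \<kappa> k y f)"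
  by (rule ext) (simp add: cap_def scaleC_add_right sum.distrib)

text \<open>A linear map may depend on the indices of legs on which an operator does not act; it still commutes with the operator.
The following two lemmas concern operators on the first four of six legs and on the last four of six.\<close>
lemma on_legs_low:
  assumes "\<And>a b. cl (h a b)" and "k \<le> 2"
  shows "on_legs k A (\<lambda>f. h (f 4) (f 5) (x f)) = (\<lambda>f. h (f 4) (f 5) (on_legs k A x f))"
proof (rule ext)
  fix f :: "nat \<Rightarrow> 'a"
  have "(f(k := i, Suc k := j)) 4 = f 4" "(f(k := i, Suc k := j)) 5 = f 5" for i j
    using assms(2) by auto
  then show "on_legs k A (\<lambda>f. h (f 4) (f 5) (x f)) f = h (f 4) (f 5) (on_legs k A x f)"
    by (simp add: cl_on_legs[OF assms(1)]) (simp add: on_legs_def)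
qed

lemma on_legs_high:
  assumes "\<And>a b. cl (h a b)"
  shows "on_legs (k + 2) A (\<lambda>f. h (f 0) (f 1) (x (\<lambda>n. f (n + 2)))) = (\<lambda>f. h (f 0) (f 1) (on_legs k A x (\<lambda>n. f (n + 2))))"
proof (rule ext)
  fix f :: "nat \<Rightarrow> 'a"
  have u: "(\<lambda>n. (f(k + 2 := i, Suc (k + 2) := j)) (n + 2)) = (\<lambda>n. f (n + 2))(k := i, Suc k := j)" for i j
    by (auto simp: fun_eq_iff)
  have v: "(f(k + 2 := i, Suc (k + 2) := j)) 0 = f 0" "(f(k + 2 := i, Suc (k + 2) := j)) 1 = f 1" for i j
    by auto
  show "on_legs (k + 2) A (\<lambda>f. h (f 0) (f 1) (x (\<lambda>n. f (n + 2)))) f = h (f 0) (f 1) (on_legs k A x (\<lambda>n. f (n + 2)))"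
    unfolding cl_on_legs[OF assms] unfolding on_legs_def u v by simp
qed

text \<open>A tensor with \<open>n\<close> legs.\<close>
definition dep :: "nat \<Rightarrow> ((nat \<Rightarrow> 'n) \<Rightarrow> 'm) \<Rightarrow> bool" where
  "dep n x \<longleftrightarrow> (\<forall>f g. (\<forall>i<n. f i = g i) \<longrightarrow> x f = x g)"

lemma dep_on_legs: "dep n x \<Longrightarrow> k + 2 \<le> n \<Longrightarrow> dep n (on_legs k A x)"
  unfolding dep_def
proof (intro allI impI)
  fix f g :: "nat \<Rightarrow> 'a"
  assume x: "\<forall>f g. (\<forall>i<n. f i = g i) \<longrightarrow> x f = x g" and k: "k + 2 \<le> n" and fg: "\<forall>i<n. f i = g i"
  have "x (f(k := i, Suc k := j)) = x (g(k := i, Suc k := j))" for i j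
  proof -
    have "\<forall>l<n. (f(k := i, Suc k := j)) l = (g(k := i, Suc k := j)) l" using fg by simp
    then show ?thesis using x by blast
  qed
  moreover have "f k = g k" "f (Suc k) = g (Suc k)" using k fg by simp_all
  ultimately show "on_legs k A x f = on_legs k A x g" by (simp add: on_legs_def)
qed

lemma dep_cap: "dep (n + 2) x \<Longrightarrow> k \<le> n \<Longrightarrow> dep n (cap \<kappa> k x)"
  unfolding dep_def
proof (intro allI impI)
  fix f g :: "nat \<Rightarrow> 'a"
  assume x: "\<forall>f g. (\<forall>i<n+2. f i = g i) \<longrightarrow> x f = x g" and k: "k \<le> n" and fg: "\<forall>i<n. f i = g i"
  have "x (graft k i f) = x (graft k i g)" for i
  proof -
    have "\<forall>j<n+2. graft k i f j = graft k i g j" using fg k by (auto simp: graft_def)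
    then show ?thesis using x by blast
  qed
  then show "cap \<kappa> k x f = cap \<kappa> k x g" by (simp add: cap_def)
qed

definition pt :: "'n \<Rightarrow> 'n \<Rightarrow> nat \<Rightarrow> 'n" where "pt i j = (\<lambda>n. if n = 0 then i else j)"

lemma dep_pt: "dep 2 x \<Longrightarrow> x (pt (f 0) (f 1)) = x f"
proof -
  assume "dep 2 x"
  moreover have "\<forall>i<2. pt (f 0) (f 1) i = f i" by (auto simp: pt_def less_2_cases_iff)
  ultimately show ?thesis unfolding dep_def by blast
qed

definition prod4 :: "('a \<Rightarrow> 'b \<Rightarrow> 'c) \<Rightarrow> ('n \<Rightarrow> 'n \<Rightarrow> 'a) \<Rightarrow> ('n \<Rightarrow> 'n \<Rightarrow> 'b) \<Rightarrow> (nat \<Rightarrow> 'n) \<Rightarrow> 'c" where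
  "prod4 m A B f = m (A (f 0) (f 1)) (B (f 2) (f 3))"

lemma prod4_shift: "prod4 m A B (\<lambda>n. f (n + 2)) = m (A (f 2) (f 3)) (B (f 4) (f 5))"
  by (simp add: prod4_def numeral_eq_Suc)

lemma dep_prod4: "dep 4 (prod4 m A B)"
  by (simp add: dep_def prod4_def)

text \<open>The matrix product of two families, which is \<open>E\<^sub>2\<^sub>3\<close> applied to their product.\<close>
definition mprod :: "('a \<Rightarrow> 'b \<Rightarrow> 'c::comm_monoid_add) \<Rightarrow> ('n::finite \<Rightarrow> 'n \<Rightarrow> 'a) \<Rightarrow> ('n \<Rightarrow> 'n \<Rightarrow> 'b) \<Rightarrow> 'n \<Rightarrow> 'n \<Rightarrow> 'c" where
  "mprod m A B i l = (\<Sum>j\<in>UNIV. m (A i j) (B j l))"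

lemma cap_prod4: "cap (\<lambda>_. 1) 1 (prod4 m A B) f = mprod m A B (f 0) (f 1)"
  by (simp add: cap_def prod4_def mprod_def graft_def scaleC_one)

text \<open>The q-trace of a family, which is \<open>E'\<^sub>1\<^sub>2\<close> applied to it.\<close>
definition tr :: "('n::finite \<Rightarrow> complex) \<Rightarrow> ('n \<Rightarrow> 'n \<Rightarrow> 'm::complex_vector) \<Rightarrow> 'm" where
  "tr \<kappa> A = (\<Sum>i\<in>UNIV. \<kappa> i *\<^sub>C A i i)"

text \<open>The products \<open>M \<times> N \<rightarrow> P\<close> that induce bimodule maps on the tensor product over the algebra.\<close>
definition pairing :: "('b::complex_algebra_1, 'x::complex_vector) bimod \<Rightarrow> ('b, 'y::complex_vector) bimod
    \<Rightarrow> ('b, 'z::complex_vector) bimod \<Rightarrow> ('x \<Rightarrow> 'y \<Rightarrow> 'z) \<Rightarrow> bool" where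
  "pairing M N P m \<longleftrightarrow> (\<forall>x. cl (m x)) \<and> (\<forall>y. cl (\<lambda>x. m x y)) \<and>
    (\<forall>x b y. m (ract M x b) y = m x (lact N b y)) \<and>
    (\<forall>b x y. m (lact M b x) y = lact P b (m x y)) \<and>
    (\<forall>b x y. m x (ract N y b) = ract P (m x y) b)"

lemma pairingD:
  assumes "pairing M N P m"
  shows "cl (m x)" "cl (\<lambda>x. m x y)" "m (ract M x b) y = m x (lact N b y)"
    "m (lact M b x) y = lact P b (m x y)" "m x (ract N y b) = ract P (m x y) b"
  using assms unfolding pairing_def by blast+

lemma bimodule_cl:
  assumes "bimodule M"
  shows "cl (lact M b)" "cl (\<lambda>x. ract M x b)" "cl (\<lambda>b. lact M b x)" "cl (\<lambda>b. ract M x b)"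
proof -
  interpret bimodule M by fact
  show "cl (lact M b)" "cl (\<lambda>x. ract M x b)" "cl (\<lambda>b. lact M b x)" "cl (\<lambda>b. ract M x b)"
    by (simp_all only: cl_def lact_add_left lact_add_right ract_add_left ract_add_right lact_scaleC_left lact_scaleC_right
        ract_scaleC_left ract_scaleC_right) simp_all
qed

definition reg :: "('b::complex_algebra_1, 'b) bimod" where "reg = \<lparr>lact = (*), ract = (*)\<rparr>"

lemma reg_simps: "lact reg = (*)" "ract reg = (*)"
  by (simp_all add: reg_def)

lemma bimodule_reg: "bimodule reg"
  by standard (simp_all add: reg_def algebra_simps mult_scaleC_left mult_scaleC_right)

lemma pairing_lact:
  assumes "bimodule M" shows "pairing reg M M (lact M)"
proof -
  interpret bimodule M by fact
  show ?thesis unfolding pairing_def using bimodule_cl[OF assms]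
    by (simp add: reg_simps lact_mult lact_ract)
qed

section \<open>Weights of families\<close>

text \<open>Computing with weights takes only a projection \<open>p\<close> that commutes with itself up to
\<open>T\<close> and has nonzero scalar q-trace.\<close>
locale projection_data = braiding_data R Rb D Di Q Qi \<kappa> z
  for R Rb D Di Q Qi :: "complex^('n::finite \<times> 'n)^('n \<times> 'n)" and \<kappa> :: "'n \<Rightarrow> complex" and z :: complex +
  fixes p :: "'n \<Rightarrow> 'n \<Rightarrow> 'b::complex_algebra_1" and qm :: complex
  assumes T_pp: "T 0 (prod4 (*) p p) = prod4 (*) p p"
    and tr_p: "tr \<kappa> p = qm *\<^sub>C 1"
    and p_p: "mprod (*) p p = p"
    and qm: "qm \<noteq> 0"
begin

lemma cl_T: "cl h \<Longrightarrow> h (T k x f) = T k (\<lambda>f. h (x f)) f"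
  by (simp add: T_def cl_on_legs)

lemma T_scale: "T k (\<lambda>f. c *\<^sub>C x f) = (\<lambda>f. c *\<^sub>C T k x f)"
  by (simp add: T_def on_legs_scale)

lemma T_add: "T k (\<lambda>f. x f + y f) = (\<lambda>f. T k x f + T k y f)"
  by (simp add: T_def on_legs_add)

lemma dep_T: "dep 4 x \<Longrightarrow> dep 4 (T 0 x)"
  unfolding T_def by (intro dep_on_legs) simp_all

lemma T_low: "(\<And>a b. cl (h a b)) \<Longrightarrow> T 0 (\<lambda>f. h (f 4) (f 5) (x f)) = (\<lambda>f. h (f 4) (f 5) (T 0 x f))"
  unfolding T_def by (simp add: on_legs_low)

lemma T_high: "(\<And>a b. cl (h a b)) \<Longrightarrow>
    T 2 (\<lambda>f. h (f 0) (f 1) (x (\<lambda>n. f (n + 2)))) = (\<lambda>f. h (f 0) (f 1) (T 0 x (\<lambda>n. f (n + 2))))"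
proof -
  assume h: "\<And>a b. cl (h a b)"
  have i: "2 + 1 = (1::nat) + 2" "2 + 2 = (2::nat) + 2" "2 = (0::nat) + 2" by simp_all
  show ?thesis unfolding T_def
    using on_legs_high[of h 1, OF h] on_legs_high[of h 2, OF h] on_legs_high[of h 0, OF h]
    by (simp add: numeral_eq_Suc)
qed

text \<open>The family \<open>A\<close> has weight \<open>\<alpha>\<close> if moving \<open>p\<close> from its right to its left amounts to \<open>\<alpha> T\<close>; this is the
shape of the relations that define the right module structure of the calculus. The variants \<open>swt\<close> and \<open>wt4\<close>
are the same notion for a single element, and for tensors with four legs, past which
\<open>p\<close> moves by two copies of \<open>T\<close>.\<close>
definition wt :: "('b, 'm::complex_vector) bimod \<Rightarrow> complex \<Rightarrow> ('n \<Rightarrow> 'n \<Rightarrow> 'm) \<Rightarrow> bool" where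
  "wt M \<alpha> A \<longleftrightarrow> prod4 (ract M) A p = (\<lambda>f. \<alpha> *\<^sub>C T 0 (prod4 (lact M) p A) f)"

definition swt :: "('b, 'm::complex_vector) bimod \<Rightarrow> complex \<Rightarrow> 'm \<Rightarrow> bool" where
  "swt M \<alpha> Z \<longleftrightarrow> (\<forall>i j. ract M Z (p i j) = \<alpha> *\<^sub>C lact M (p i j) Z)"

definition wt4 :: "('b, 'm::complex_vector) bimod \<Rightarrow> complex \<Rightarrow> ((nat \<Rightarrow> 'n) \<Rightarrow> 'm) \<Rightarrow> bool" where
  "wt4 M \<alpha> X \<longleftrightarrow> (\<lambda>f. ract M (X f) (p (f 4) (f 5)))
    = (\<lambda>f. \<alpha> *\<^sub>C T 2 (T 0 (\<lambda>f. lact M (p (f 0) (f 1)) (X (\<lambda>n. f (n + 2))))) f)"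

lemma wt4_prod4:
  assumes m: "pairing M N P m" and A: "wt M \<alpha> A" and B: "wt N \<beta> B" 
  shows "wt4 P (\<alpha> * \<beta>) (prod4 m A B)"
proof -
  have "(\<lambda>f. ract P (prod4 m A B f) (p (f 4) (f 5))) = (\<lambda>f. m (A (f 0) (f 1)) (prod4 (ract N) B p (\<lambda>n. f (n + 2))))"
    unfolding prod4_shift by (simp add: fun_eq_iff prod4_def pairingD(5)[OF m])
  also have "\<dots> = (\<lambda>f. \<beta> *\<^sub>C m (A (f 0) (f 1)) (T 0 (prod4 (lact N) p B) (\<lambda>n. f (n + 2))))"
    using B by (simp add: wt_def cl_scale[OF pairingD(1)[OF m]])
  also have "\<dots> = (\<lambda>f. \<beta> *\<^sub>C T 2 (\<lambda>f. m (A (f 0) (f 1)) (prod4 (lact N) p B (\<lambda>n. f (n + 2)))) f)"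
    by (subst T_high) (rule pairingD(1)[OF m], rule refl)
  also have "(\<lambda>f. m (A (f 0) (f 1)) (prod4 (lact N) p B (\<lambda>n. f (n + 2)))) = (\<lambda>f. m (prod4 (ract M) A p f) (B (f 4) (f 5)))"
    unfolding prod4_shift by (simp add: fun_eq_iff prod4_def pairingD(3)[OF m])
  also have "\<dots> = (\<lambda>f. \<alpha> *\<^sub>C m (T 0 (prod4 (lact M) p A) f) (B (f 4) (f 5)))"
    using A by (simp add: wt_def cl_scale[OF pairingD(2)[OF m]])
  also have "\<dots> = (\<lambda>f. \<alpha> *\<^sub>C T 0 (\<lambda>f. m (prod4 (lact M) p A f) (B (f 4) (f 5))) f)"
    by (subst T_low[of "\<lambda>a b x. m x (B a b)"]) (rule pairingD(2)[OF m], rule refl)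
  also have "(\<lambda>f. m (prod4 (lact M) p A f) (B (f 4) (f 5))) = (\<lambda>f. lact P (p (f 0) (f 1)) (prod4 m A B (\<lambda>n. f (n + 2))))"
    unfolding prod4_shift by (simp add: fun_eq_iff prod4_def pairingD(4)[OF m])
  finally show ?thesis by (simp add: wt4_def T_scale mult.commute)
qed

text \<open>By the braid relation, \<open>T\<close> acting within a product can be exchanged with the two copies of \<open>T\<close> that move \<open>p\<close> past it.\<close>
lemma wt4_T:
  assumes P: "bimodule P" and X: "wt4 P \<alpha> X"
  shows "wt4 P \<alpha> (T 0 X)"
proof -
  let ?Y = "\<lambda>f. lact P (p (f 0) (f 1)) (X (\<lambda>n. f (n + 2)))"
  have "(\<lambda>f. ract P (T 0 X f) (p (f 4) (f 5))) = T 0 (\<lambda>f. ract P (X f) (p (f 4) (f 5)))"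
    by (subst T_low[of "\<lambda>a b x. ract P x (p a b)"]) (rule bimodule_cl(2)[OF P], rule refl)
  also have "\<dots> = (\<lambda>f. \<alpha> *\<^sub>C T 0 (T 2 (T 0 ?Y)) f)"
    using X by (simp add: wt4_def T_scale)
  also have "T 0 (T 2 (T 0 ?Y)) = T 2 (T 0 (T 2 ?Y))" by (rule T_braid)
  also have "T 2 ?Y = (\<lambda>f. lact P (p (f 0) (f 1)) (T 0 X (\<lambda>n. f (n + 2))))"
    by (rule T_high[of "\<lambda>a b. lact P (p a b)"]) (rule bimodule_cl(1)[OF P])
  finally show ?thesis by (simp add: wt4_def)
qed

lemma wt_E:
  assumes P: "bimodule P" and X: "wt4 P \<alpha> X" and d: "dep 4 X"
  shows "wt P \<alpha> (\<lambda>i l. E 1 X (pt i l))"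
proof -
  have d2: "dep 2 (E 1 X)" using dep_cap[of 2 X 1] d by simp
  have "prod4 (ract P) (\<lambda>i l. E 1 X (pt i l)) p = E 1 (\<lambda>f. ract P (X f) (p (f 4) (f 5)))"
  proof
    fix f
    have "prod4 (ract P) (\<lambda>i l. E 1 X (pt i l)) p f = ract P (E 1 X f) (p (f 2) (f 3))"
      by (simp add: prod4_def dep_pt[OF d2, unfolded One_nat_def])
    also have "\<dots> = E 1 (\<lambda>f. ract P (X f) (p (f 4) (f 5))) f"
      unfolding cl_cap[OF bimodule_cl(2)[OF P]] by (simp add: cap_def graft_def)
    finally show "prod4 (ract P) (\<lambda>i l. E 1 X (pt i l)) p f = E 1 (\<lambda>f. ract P (X f) (p (f 4) (f 5))) f" .
  qed
  also have "\<dots> = (\<lambda>f. \<alpha> *\<^sub>C E 1 (T 2 (T 0 (\<lambda>f. lact P (p (f 0) (f 1)) (X (\<lambda>n. f (n + 2)))))) f)"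
    using X by (simp only: wt4_def cap_scale)
  also have "\<dots> = (\<lambda>f. \<alpha> *\<^sub>C T 0 (E 3 (\<lambda>f. lact P (p (f 0) (f 1)) (X (\<lambda>n. f (n + 2))))) f)"
    by (simp only: E_T_T)
  also have "E 3 (\<lambda>f. lact P (p (f 0) (f 1)) (X (\<lambda>n. f (n + 2)))) = prod4 (lact P) p (\<lambda>i l. E 1 X (pt i l))"
  proof
    fix f :: "nat \<Rightarrow> 'n"
    have g: "(\<lambda>n. graft 3 i f (n + 2)) = graft 1 i (\<lambda>n. f (n + 2))" for i
      by (auto simp: graft_def fun_eq_iff intro!: arg_cong[where f = f])
    have h: "graft 3 i f 0 = f 0" "graft 3 i f 1 = f 1" for i by (simp_all add: graft_def)
    have "E 3 (\<lambda>f. lact P (p (f 0) (f 1)) (X (\<lambda>n. f (n + 2)))) f = lact P (p (f 0) (f 1)) (E 1 X (\<lambda>n. f (n + 2)))"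
      unfolding cl_cap[OF bimodule_cl(1)[OF P]] unfolding cap_def g h ..
    also have "\<dots> = prod4 (lact P) p (\<lambda>i l. E 1 X (pt i l)) f"
      using dep_pt[OF d2, of "\<lambda>n. f (n + 2)"] by (simp add: prod4_def numeral_eq_Suc)
    finally show "E 3 (\<lambda>f. lact P (p (f 0) (f 1)) (X (\<lambda>n. f (n + 2)))) f = prod4 (lact P) p (\<lambda>i l. E 1 X (pt i l)) f" .
  qed
  finally show ?thesis by (simp add: wt_def)
qed

text \<open>The braided matrix product, \<open>E\<^sub>2\<^sub>3 T\<close> applied to the product of two families. It occurs in the connection.\<close>
definition bprod where "bprod m A B i l = E 1 (T 0 (prod4 m A B)) (pt i l)"

lemma mprod_pt: "mprod m A B = (\<lambda>i l. E 1 (prod4 m A B) (pt i l))"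
  using cap_prod4[of m A B] by (simp add: fun_eq_iff pt_def)

lemma wt_mprod:
  assumes "bimodule P" "pairing M N P m" "wt M \<alpha> A" "wt N \<beta> B" 
  shows "wt P (\<alpha> * \<beta>) (mprod m A B)"
  unfolding mprod_pt by (rule wt_E[OF assms(1) wt4_prod4[OF assms(2-4)] dep_prod4])

lemma wt_bprod:
  assumes "bimodule P" "pairing M N P m" "wt M \<alpha> A" "wt N \<beta> B" 
  shows "wt P (\<alpha> * \<beta>) (bprod m A B)"
  unfolding bprod_def by (rule wt_E[OF assms(1) wt4_T[OF assms(1) wt4_prod4[OF assms(2-4)]] dep_T[OF dep_prod4]])

lemma wt_add:
  assumes "bimodule M" "wt M \<alpha> A" "wt M \<alpha> B"
  shows "wt M \<alpha> (\<lambda>i j. A i j + B i j)"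
proof -
  have "prod4 (ract M) (\<lambda>i j. A i j + B i j) p = (\<lambda>f. prod4 (ract M) A p f + prod4 (ract M) B p f)"
    by (simp add: fun_eq_iff prod4_def cl_add[OF bimodule_cl(2)[OF assms(1)]])
  moreover have "prod4 (lact M) p (\<lambda>i j. A i j + B i j) = (\<lambda>f. prod4 (lact M) p A f + prod4 (lact M) p B f)"
    by (simp add: fun_eq_iff prod4_def cl_add[OF bimodule_cl(1)[OF assms(1)]])
  ultimately show ?thesis using assms(2,3) by (simp add: wt_def T_add scaleC_add_right)
qed

lemma wt_scale:
  assumes "bimodule M" "wt M \<alpha> A"
  shows "wt M \<alpha> (\<lambda>i j. c *\<^sub>C A i j)"
proof -
  have "prod4 (ract M) (\<lambda>i j. c *\<^sub>C A i j) p = (\<lambda>f. c *\<^sub>C prod4 (ract M) A p f)"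
    by (simp add: fun_eq_iff prod4_def cl_scale[OF bimodule_cl(2)[OF assms(1)]])
  moreover have "prod4 (lact M) p (\<lambda>i j. c *\<^sub>C A i j) = (\<lambda>f. c *\<^sub>C prod4 (lact M) p A f)"
    by (simp add: fun_eq_iff prod4_def cl_scale[OF bimodule_cl(1)[OF assms(1)]])
  ultimately show ?thesis using assms(2) by (simp add: wt_def T_scale mult.commute)
qed

lemma wt_minus: "bimodule M \<Longrightarrow> wt M \<alpha> A \<Longrightarrow> wt M \<alpha> (\<lambda>i j. - A i j)"
  using wt_scale[of M \<alpha> A "-1"] by simp

lemma wt_diff: "bimodule M \<Longrightarrow> wt M \<alpha> A \<Longrightarrow> wt M \<alpha> B \<Longrightarrow> wt M \<alpha> (\<lambda>i j. A i j - B i j)"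
  using wt_add[of M \<alpha> A "\<lambda>i j. - B i j"] wt_minus[of M \<alpha> B] by simp

lemma swt_tr:
  assumes M: "bimodule M" and A: "wt M \<alpha> A"
  shows "swt M \<alpha> (tr \<kappa> A)"
  unfolding swt_def
proof (intro allI)
  fix i j
  have l: "E' 0 (prod4 (ract M) A p) f = ract M (tr \<kappa> A) (p (f 0) (f 1))" for f
    by (simp add: cap_def prod4_def graft_def tr_def cl_sum[OF bimodule_cl(2)[OF M]] cl_scale[OF bimodule_cl(2)[OF M]])
  have r: "E' 2 (prod4 (lact M) p A) f = lact M (p (f 0) (f 1)) (tr \<kappa> A)" for f
    by (simp add: cap_def prod4_def graft_def tr_def cl_sum[OF bimodule_cl(1)[OF M]] cl_scale[OF bimodule_cl(1)[OF M]])
  have "E' 0 (prod4 (ract M) A p) = (\<lambda>f. \<alpha> *\<^sub>C E' 0 (T 0 (prod4 (lact M) p A)) f)"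
    using A by (simp only: wt_def cap_scale)
  then have "E' 0 (prod4 (ract M) A p) (pt i j) = \<alpha> *\<^sub>C E' 2 (prod4 (lact M) p A) (pt i j)"
    by (simp add: E'_T)
  then show "ract M (tr \<kappa> A) (p i j) = \<alpha> *\<^sub>C lact M (p i j) (tr \<kappa> A)"
    unfolding l r by (simp add: pt_def)
qed

text \<open>Contracting the relation \<open>Z p = \<alpha> p Z\<close> replaces \<open>p\<close> by the nonzero scalar \<open>qm\<close> on both sides, so
that \<open>Z = \<alpha> Z\<close>.\<close>
lemma swt_eq_0:
  assumes M: "bimodule M" and Z: "swt M \<alpha> Z" and \<alpha>: "\<alpha> \<noteq> 1"
  shows "Z = 0"
proof -
  interpret bimodule M by fact
  have "ract M Z (tr \<kappa> p) = \<alpha> *\<^sub>C lact M (tr \<kappa> p) Z"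
    using Z unfolding swt_def tr_def
    by (simp add: cl_sum[OF bimodule_cl(3)[OF M]] cl_sum[OF bimodule_cl(4)[OF M]] lact_scaleC_left ract_scaleC_right
        scaleC_sum_right mult.commute)
  then have "(1 - \<alpha>) *\<^sub>C (qm *\<^sub>C Z) = 0"
    unfolding tr_p lact_scaleC_left ract_scaleC_right lact_one ract_one cvec.scale_left_diff_distrib by simp
  then show ?thesis using \<alpha> qm by simp
qed

lemma wt_p_swt:
  assumes M: "bimodule M" and Z: "swt M \<alpha> Z"
  shows "wt M \<alpha> (\<lambda>i j. lact M (p i j) Z)"
proof -
  interpret bimodule M by fact
  have "prod4 (ract M) (\<lambda>i j. lact M (p i j) Z) p = (\<lambda>f. \<alpha> *\<^sub>C lact M (prod4 (*) p p f) Z)"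
    using Z by (simp add: fun_eq_iff prod4_def lact_ract swt_def lact_scaleC_right lact_mult)
  also have "\<dots> = (\<lambda>f. \<alpha> *\<^sub>C lact M (T 0 (prod4 (*) p p) f) Z)"
    by (simp only: T_pp)
  also have "\<dots> = (\<lambda>f. \<alpha> *\<^sub>C T 0 (\<lambda>f. lact M (prod4 (*) p p f) Z) f)"
    by (simp only: cl_T[OF bimodule_cl(3)[OF M]])
  also have "(\<lambda>f. lact M (prod4 (*) p p f) Z) = prod4 (lact M) p (\<lambda>i j. lact M (p i j) Z)"
    by (simp add: prod4_def lact_mult fun_eq_iff)
  finally show ?thesis by (simp only: wt_def)
qed

lemma wt_swt:
  assumes m: "pairing M N P m" and A: "wt M \<alpha> A" and Z: "swt N 1 Z"
  shows "wt P \<alpha> (\<lambda>i j. m (A i j) Z)"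
proof -
  have "prod4 (ract P) (\<lambda>i j. m (A i j) Z) p = (\<lambda>f. m (prod4 (ract M) A p f) Z)"
    using Z by (simp add: fun_eq_iff prod4_def pairingD(3)[OF m] swt_def scaleC_one flip: pairingD(5)[OF m])
  also have "\<dots> = (\<lambda>f. \<alpha> *\<^sub>C m (T 0 (prod4 (lact M) p A) f) Z)"
    using A by (simp add: wt_def cl_scale[OF pairingD(2)[OF m]])
  also have "\<dots> = (\<lambda>f. \<alpha> *\<^sub>C T 0 (\<lambda>f. m (prod4 (lact M) p A f) Z) f)"
    by (simp only: cl_T[OF pairingD(2)[OF m]])
  also have "(\<lambda>f. m (prod4 (lact M) p A f) Z) = prod4 (lact P) p (\<lambda>i j. m (A i j) Z)"
    by (simp add: prod4_def pairingD(4)[OF m] fun_eq_iff)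
  finally show ?thesis by (simp only: wt_def)
qed

lemma wt_p: "wt reg 1 p"
  by (simp only: wt_def reg_simps T_pp scaleC_one)

text \<open>Families of different weights are linearly independent: a common family would satisfy \<open>T p G = 0\<close>, hence
\<open>p G = 0\<close> as \<open>T\<close> is invertible, and the q-trace of \<open>p\<close> is a nonzero scalar.\<close>
lemma wt_split:
  assumes M: "bimodule M" and G: "wt M \<alpha> G" and U: "wt M \<beta> U" and ab: "\<alpha> \<noteq> \<beta>"
    and sum: "\<And>i j. G i j + U i j = 0"
  shows "G i j = 0"
proof -
  interpret bimodule M by fact
  let ?g = "prod4 (lact M) p G"
  have U': "U = (\<lambda>i j. - G i j)" using sum by (simp add: fun_eq_iff add_eq_0_iff)
  have "wt M \<beta> G" using wt_minus[OF M U] by (simp add: U')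
  with G have "\<alpha> *\<^sub>C T 0 ?g f = \<beta> *\<^sub>C T 0 ?g f" for f unfolding wt_def by metis
  then have "(\<alpha> - \<beta>) *\<^sub>C T 0 ?g f = 0" for f by (simp add: cvec.scale_left_diff_distrib)
  then have "T 0 ?g = (\<lambda>_. 0)" using ab by (simp add: fun_eq_iff)
  from T_eq_0[OF this] have g: "?g f = 0" for f by simp
  have pG: "lact M (p k l) (G i j) = 0" for k l
    using g[of "\<lambda>n. if n = 0 then k else if n = 1 then l else if n = 2 then i else j"] by (simp add: prod4_def)
  have "lact M (tr \<kappa> p) (G i j) = 0"
    by (simp add: tr_def cl_sum[OF bimodule_cl(3)[OF M]] lact_scaleC_left pG)
  then show ?thesis using qm by (simp add: tr_p lact_scaleC_left lact_one)
qed

end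

section \<open>The curvature\<close>

lemma mprod_assoc:
  assumes "\<And>a b c. m1 (m2 a b) c = m3 a (m4 b c)" "\<And>c. cl (\<lambda>x. m1 x c)" "\<And>a. cl (m3 a)"
  shows "mprod m1 (mprod m2 A B) C = mprod m3 A (mprod m4 B (C :: 'n::finite \<Rightarrow> _))"
proof (intro ext)
  fix i l
  have "mprod m1 (mprod m2 A B) C i l = (\<Sum>j\<in>UNIV. \<Sum>k\<in>UNIV. m3 (A i k) (m4 (B k j) (C j l)))"
    by (simp add: mprod_def cl_sum[OF assms(2)] assms(1))
  also have "\<dots> = mprod m3 A (mprod m4 B C) i l"
    by (subst sum.swap) (simp add: mprod_def cl_sum[OF assms(3)])
  finally show "mprod m1 (mprod m2 A B) C i l = mprod m3 A (mprod m4 B C) i l" .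
qed

text \<open>The calculus, its two-forms and its connection in terms of the families \<open>dP\<close>, \<open>dbP\<close> of generating forms. The
scalars \<open>a\<close> and \<open>m'\<close> are \<open>q\<^sup>a\<close> and \<open>q\<^sup>-\<^sup>m\<close>; the spaces \<open>O1, OT, O2, O3\<close> are the one-forms, their tensor
square, the two-forms, and the target of the curvature; and \<open>L x\<close> is the map \<open>t \<mapsto> (\<and> \<otimes> id) (x \<otimes> t)\<close>.\<close>
locale calculus0 = projection_data R Rb D Di Q Qi \<kappa> z p qm
  for R Rb D Di Q Qi :: "complex^('n::finite \<times> 'n)^('n \<times> 'n)" and \<kappa> :: "'n \<Rightarrow> complex" and z :: complex
    and p :: "'n \<Rightarrow> 'n \<Rightarrow> 'b::complex_algebra_1" and qm :: complex +
  fixes O1 :: "('b, 'o::complex_vector) bimod" and d :: "'b \<Rightarrow> 'o" and dP dbP :: "'n \<Rightarrow> 'n \<Rightarrow> 'o" and a m' :: complex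
    and OT :: "('b, 't::complex_vector) bimod" and tens :: "'o \<Rightarrow> 'o \<Rightarrow> 't"
    and O2 :: "('b, 'w::complex_vector) bimod" and wedge :: "'t \<Rightarrow> 'w" and d2 :: "'o \<Rightarrow> 'w"
    and O3 :: "('b, 'u::complex_vector) bimod" and tens2 :: "'w \<Rightarrow> 'o \<Rightarrow> 'u"
    and nabla :: "'o \<Rightarrow> 't" and L :: "'o \<Rightarrow> 't \<Rightarrow> 'u"
  assumes O1: "bimodule O1" and OT: "bimodule OT" and O2: "bimodule O2" and O3: "bimodule O3"
    and a: "a \<noteq> 0" "a * a \<noteq> 1"
    and wt_dP: "wt O1 a dP" and wt_dbP: "wt O1 (inverse a) dbP"
    and dP_p: "mprod (ract O1) dP p = dP" and p_dP: "mprod (lact O1) p dP i j = 0"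
    and dbP_p: "mprod (ract O1) dbP p i j = 0" and p_dbP: "mprod (lact O1) p dbP = dbP"
    and d_mult: "d (b * c) = ract O1 (d b) c + lact O1 b (d c)"
    and d_p: "d (p i j) = dP i j + dbP i j"
    and gen_p: "\<And>S b. (\<And>x y. x \<in> S \<Longrightarrow> y \<in> S \<Longrightarrow> x + y \<in> S) \<Longrightarrow> (\<And>c x. x \<in> S \<Longrightarrow> c *\<^sub>C x \<in> S) \<Longrightarrow>
      (\<And>x y. x \<in> S \<Longrightarrow> y \<in> S \<Longrightarrow> x * y \<in> S) \<Longrightarrow> 1 \<in> S \<Longrightarrow> (\<And>i j. p i j \<in> S) \<Longrightarrow> b \<in> S"
    and gen_O1: "\<And>S x. (\<And>x y. x \<in> S \<Longrightarrow> y \<in> S \<Longrightarrow> x + y \<in> S) \<Longrightarrow> (\<And>b x. x \<in> S \<Longrightarrow> lact O1 b x \<in> S) \<Longrightarrow>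
      (\<And>i j. dP i j \<in> S) \<Longrightarrow> (\<And>i j. dbP i j \<in> S) \<Longrightarrow> x \<in> S"
    and tens: "pairing O1 O1 OT tens" and tens2: "pairing O2 O1 O3 tens2"
    and cl_wedge: "cl wedge" and wedge_lact: "wedge (lact OT b t) = lact O2 b (wedge t)"
    and wedge_ract: "wedge (ract OT t b) = ract O2 (wedge t) b"
    and cl_d2: "cl d2" and d2_d: "d2 (lact O1 b (d c)) = wedge (tens (d b) (d c))"
    and tens_span: "\<And>S t. (\<And>x y. x \<in> S \<Longrightarrow> y \<in> S \<Longrightarrow> x + y \<in> S) \<Longrightarrow> (\<And>x y. tens x y \<in> S) \<Longrightarrow> t \<in> S"
    and L: "cl (L x)" "L x (tens y z') = tens2 (wedge (tens x y)) z'"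
    and nabla: "cl nabla" "nabla (lact O1 b x) = tens (d b) x + lact OT b (nabla x)"
    and nabla_dP: "nabla (dP i j) = a *\<^sub>C bprod tens dbP dP i j - (a * m') *\<^sub>C lact OT (p i j) (tr \<kappa> (mprod tens dbP dP))"
    and nabla_dbP: "nabla (dbP i j) = mprod tens dP dbP i j - m' *\<^sub>C lact OT (p i j) (tr \<kappa> (mprod tens dP dbP))"

context calculus0 begin

abbreviation "la \<equiv> lact O1"
abbreviation "ra \<equiv> ract O1"

definition "w x y = wedge (tens x y)"

lemma w: "pairing O1 O1 O2 w"
  using pairingD[OF tens] cl_wedge unfolding pairing_def w_def
  by (simp add: cl_def wedge_lact wedge_ract)

lemma L_eqI:
  assumes "cl h" "cl k" "\<And>x y. h (tens x y) = k (tens x y)" shows "h t = k (t :: 't)"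
proof -
  have "t \<in> {t. h t = k t}"
    by (rule tens_span) (simp_all add: assms(3) cl_add[OF assms(1)] cl_add[OF assms(2)])
  then show ?thesis by simp
qed

lemma L_pairing: "pairing O1 OT O3 L"
proof -
  note p = pairingD[OF tens] pairingD[OF tens2] pairingD[OF w]
  have 1: "L (x + x') t = L x t + L x' t" for x x' t
    by (rule L_eqI) (simp_all add: cl_def cl_add[OF L(1)] cl_scale[OF L(1)] L(2) cl_add[OF p(2)] cl_add[OF cl_wedge] cl_add[OF p(7)] scaleC_add_right algebra_simps)
  have 2: "L (c *\<^sub>C x) t = c *\<^sub>C L x t" for c x t
    by (rule L_eqI[OF L(1)]) (simp_all add: cl_def cl_add[OF L(1)] cl_scale[OF L(1)] L(2) cl_scale[OF p(2)] cl_scale[OF cl_wedge] cl_scale[OF p(7)] scaleC_add_right mult.commute)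
  have 3: "L (ra x b) t = L x (lact OT b t)" for x b t
    by (rule L_eqI[OF L(1)]) (simp_all add: cl_def cl_add[OF bimodule_cl(1)[OF OT]] cl_scale[OF bimodule_cl(1)[OF OT]] cl_add[OF L(1)] cl_scale[OF L(1)] L(2) p(3) flip: p(4))
  have 4: "L (la b x) t = lact O3 b (L x t)" for x b t
    by (rule L_eqI[OF L(1)]) (simp_all add: cl_def cl_add[OF bimodule_cl(1)[OF O3]] cl_scale[OF bimodule_cl(1)[OF O3]] cl_add[OF L(1)] cl_scale[OF L(1)] L(2) p(4) p(9) wedge_lact)
  have 5: "L x (ract OT t b) = ract O3 (L x t) b" for x b t
    by (rule L_eqI) (simp_all add: cl_def cl_add[OF bimodule_cl(2)[OF OT]] cl_scale[OF bimodule_cl(2)[OF OT]] cl_add[OF bimodule_cl(2)[OF O3]] cl_scale[OF bimodule_cl(2)[OF O3]]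
        cl_add[OF L(1)] cl_scale[OF L(1)] L(2) p(10) flip: p(5))
  show ?thesis unfolding pairing_def using L(1) by (simp add: cl_def[of "\<lambda>x. L x _"] 1 2 3 4 5)
qed

lemma d_1: "d 1 = 0"
proof -
  interpret bimodule O1 by (rule O1)
  show ?thesis using d_mult[of 1 1] by (simp add: lact_one ract_one)
qed

lemma d2_closed: "d2 (d b) = 0"
proof -
  interpret bimodule O1 by (rule O1)
  show ?thesis using d2_d[of 1 b] by (simp add: lact_one d_1 cl_0[OF pairingD(2)[OF tens]] cl_0[OF cl_wedge])
qed

text \<open>This rests on \<open>p \<partial>p = 0\<close> and \<open>p \<partial>'p = \<partial>'p\<close>, where \<open>\<partial>'\<close> is the second part of the differential. It shows that
the forms \<open>b dc\<close> span, and gives the differentials of the generating forms.\<close>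
lemma dP_eq: "dP i l = d (p i l) - mprod la p (\<lambda>i j. d (p i j)) i l"
proof -
  have "mprod la p (\<lambda>i j. d (p i j)) i l = mprod la p dP i l + mprod la p dbP i l"
    by (simp add: mprod_def d_p cl_add[OF bimodule_cl(1)[OF O1]] sum.distrib)
  then show ?thesis by (simp add: p_dP p_dbP d_p)
qed

lemma O1_span:
  assumes add: "\<And>x y. x \<in> S \<Longrightarrow> y \<in> S \<Longrightarrow> x + y \<in> S" and d: "\<And>b c. la b (d c) \<in> S"
  shows "x \<in> S"
proof -
  interpret bimodule O1 by (rule O1)
  let ?S = "{x. \<forall>b. la b x \<in> S}"
  have z: "0 \<in> S" using d[of 0 0] by (simp add: cl_0[OF bimodule_cl(3)[OF O1]])
  have sum: "(\<Sum>j\<in>J. g j) \<in> S" if "\<And>j. g j \<in> S" for g and J :: "'n set"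
    by (induction J rule: infinite_finite_induct) (simp_all add: z add that)
  have P: "la b (dP i j) \<in> S" for b i j
  proof -
    have "la b (dP i j) = la b (d (p i j)) + (\<Sum>k\<in>UNIV. la (- (b * p i k)) (d (p k j)))"
      by (simp add: dP_eq mprod_def cl_diff[OF bimodule_cl(1)[OF O1]] cl_sum[OF bimodule_cl(1)[OF O1]]
          cl_minus[OF bimodule_cl(3)[OF O1]] lact_mult sum_negf)
    then show ?thesis using add d sum by simp
  qed
  have "x \<in> ?S"
  proof (rule gen_O1)
    fix i j
    show "dP i j \<in> ?S" using P by simp
    have "la b (dbP i j) = la b (d (p i j)) + la (- b) (dP i j)" for b
      by (simp add: d_p cl_add[OF bimodule_cl(1)[OF O1]] cl_minus[OF bimodule_cl(3)[OF O1]])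
    then show "dbP i j \<in> ?S" using add d P by simp
  qed (simp_all add: cl_add[OF bimodule_cl(1)[OF O1]] add flip: lact_mult)
  then show ?thesis using lact_one[of x] by (metis mem_Collect_eq)
qed

text \<open>Both Leibniz rules can be checked on forms \<open>b dc\<close>, where the differential is \<open>db \<and> dc\<close>.\<close>
lemma d2_lact: "d2 (la b x) = w (d b) x + lact O2 b (d2 x)"
proof -
  interpret bimodule O1 by (rule O1)
  note p = pairingD[OF w]
  have "x \<in> {x. d2 (la b x) = w (d b) x + lact O2 b (d2 x)}"
  proof (rule O1_span)
    fix c e
    have "d2 (la b (la c (d e))) = w (d (b * c)) (d e)" by (simp add: d2_d w_def flip: lact_mult)
    also have "\<dots> = w (d b) (la c (d e)) + lact O2 b (w (d c) (d e))"
      by (simp add: d_mult cl_add[OF p(2)] p(3,4))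
    finally show "la c (d e) \<in> {x. d2 (la b x) = w (d b) x + lact O2 b (d2 x)}" by (simp add: d2_d w_def)
  qed (simp add: cl_add[OF bimodule_cl(1)[OF O1]] cl_add[OF bimodule_cl(1)[OF O2]] cl_add[OF cl_d2] cl_add[OF p(1)])
  then show ?thesis by simp
qed

lemma d2_ract: "d2 (ra x b) = ract O2 (d2 x) b - w x (d b)"
proof -
  interpret bimodule O1 by (rule O1)
  note p = pairingD[OF w]
  have "x \<in> {x. d2 (ra x b) = ract O2 (d2 x) b - w x (d b)}"
  proof (rule O1_span)
    fix c e
    have "ra (la c (d e)) b = la c (d (e * b)) - la (c * e) (d b)"
      by (simp add: d_mult cl_add[OF bimodule_cl(1)[OF O1]] lact_mult lact_ract)
    then have "d2 (ra (la c (d e)) b) = w (d c) (d (e * b)) - w (d (c * e)) (d b)"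
      by (simp add: cl_diff[OF cl_d2] d2_d w_def)
    also have "\<dots> = ract O2 (w (d c) (d e)) b - w (la c (d e)) (d b)"
      by (simp add: d_mult cl_add[OF p(1)] cl_add[OF p(2)] p(3,5))
    finally show "la c (d e) \<in> {x. d2 (ra x b) = ract O2 (d2 x) b - w x (d b)}" by (simp add: d2_d w_def)
  qed (simp add: cl_add[OF bimodule_cl(2)[OF O1]] cl_add[OF bimodule_cl(2)[OF O2]] cl_add[OF cl_d2] cl_add[OF p(2)])
  then show ?thesis by simp
qed

end

text \<open>The map \<open>\<Theta> = d \<otimes> id - (\<and> \<otimes> id)(id \<otimes> \<nabla>)\<close>, whose composition with the connection is the curvature. It is well
defined on the tensor product over the algebra because the Leibniz rules of the differential and of the connection
contribute the same term \<open>x \<and> db \<otimes> \<eta>\<close>.\<close>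
locale calculus = calculus0 R Rb D Di Q Qi \<kappa> z p qm O1 d dP dbP a m' OT tens O2 wedge d2 O3 tens2 nabla L
  for R Rb D Di Q Qi :: "complex^('n::finite \<times> 'n)^('n \<times> 'n)" and \<kappa> :: "'n \<Rightarrow> complex" and z :: complex
    and p :: "'n \<Rightarrow> 'n \<Rightarrow> 'b::complex_algebra_1" and qm :: complex
    and O1 :: "('b, 'o::complex_vector) bimod" and d :: "'b \<Rightarrow> 'o" and dP dbP :: "'n \<Rightarrow> 'n \<Rightarrow> 'o" and a m' :: complex
    and OT :: "('b, 't::complex_vector) bimod" and tens :: "'o \<Rightarrow> 'o \<Rightarrow> 't"
    and O2 :: "('b, 'w::complex_vector) bimod" and wedge :: "'t \<Rightarrow> 'w" and d2 :: "'o \<Rightarrow> 'w"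
    and O3 :: "('b, 'u::complex_vector) bimod" and tens2 :: "'w \<Rightarrow> 'o \<Rightarrow> 'u"
    and nabla :: "'o \<Rightarrow> 't" and L :: "'o \<Rightarrow> 't \<Rightarrow> 'u" +
  fixes \<Theta> :: "'t \<Rightarrow> 'u"
  assumes \<Theta>: "cl \<Theta>" "\<Theta> (tens x y) = tens2 (d2 x) y - L x (nabla y)"
begin

lemma \<Theta>_lact: "\<Theta> (lact OT b t) = L (d b) t + lact O3 b (\<Theta> t)"
proof (rule L_eqI)
  note p = pairingD[OF tens] pairingD[OF tens2] pairingD[OF L_pairing]
  show "cl (\<lambda>t. \<Theta> (lact OT b t))"
    by (simp add: cl_def cl_add[OF bimodule_cl(1)[OF OT]] cl_scale[OF bimodule_cl(1)[OF OT]] cl_add[OF \<Theta>(1)] cl_scale[OF \<Theta>(1)])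
  show "cl (\<lambda>t. L (d b) t + lact O3 b (\<Theta> t))"
    by (simp add: cl_def cl_add[OF bimodule_cl(1)[OF O3]] cl_scale[OF bimodule_cl(1)[OF O3]] cl_add[OF \<Theta>(1)] cl_scale[OF \<Theta>(1)]
        cl_add[OF L(1)] cl_scale[OF L(1)] scaleC_add_right)
  fix x y
  have "\<Theta> (lact OT b (tens x y)) = tens2 (d2 (la b x)) y - L (la b x) (nabla y)"
    by (simp add: \<Theta>(2) flip: p(4))
  also have "\<dots> = tens2 (w (d b) x) y + lact O3 b (tens2 (d2 x) y) - lact O3 b (L x (nabla y))"
    by (simp add: d2_lact cl_add[OF p(7)] p(9) p(14))
  also have "\<dots> = L (d b) (tens x y) + lact O3 b (\<Theta> (tens x y))"
    by (simp add: \<Theta>(2) L(2) w_def cl_diff[OF bimodule_cl(1)[OF O3]])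
  finally show "\<Theta> (lact OT b (tens x y)) = L (d b) (tens x y) + lact O3 b (\<Theta> (tens x y))" .
qed

definition "Riem x = \<Theta> (nabla x)"

lemma cl_Riem: "cl Riem"
  by (simp add: cl_def Riem_def cl_add[OF \<Theta>(1)] cl_scale[OF \<Theta>(1)] cl_add[OF nabla(1)] cl_scale[OF nabla(1)])

lemma Riem_lact: "Riem (la b x) = lact O3 b (Riem x)"
proof -
  have "\<Theta> (tens (d b) x) = - L (d b) (nabla x)"
    by (simp add: \<Theta>(2) d2_closed cl_0[OF pairingD(2)[OF tens2]])
  then show ?thesis by (simp add: Riem_def nabla(2) cl_add[OF \<Theta>(1)] \<Theta>_lact)
qed

text \<open>Insert \<open>p\<close>, which acts as the identity on one side of the tensor sign and by zero on the other.\<close>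
lemma tens_dP_dP: "mprod tens dP dP i l = 0"
proof -
  have "mprod tens (mprod ra dP p) dP = mprod tens dP (mprod la p dP)"
    by (rule mprod_assoc) (rule pairingD[OF tens])+
  then have "mprod tens dP dP = mprod tens dP (mprod la p dP)" by (simp only: dP_p)
  then show ?thesis by (simp add: mprod_def[of tens] p_dP cl_0[OF pairingD(1)[OF tens]])
qed

lemma tens_dbP_dbP: "mprod tens dbP dbP i l = 0"
proof -
  have "mprod tens (mprod ra dbP p) dbP = mprod tens dbP (mprod la p dbP)"
    by (rule mprod_assoc) (rule pairingD[OF tens])+
  then have "mprod tens dbP dbP = mprod tens (mprod ra dbP p) dbP" by (simp only: p_dbP)
  then show ?thesis by (simp add: mprod_def[of tens] dbP_p cl_0[OF pairingD(2)[OF tens]])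
qed

text \<open>Apply the differential to \<open>\<partial>p = dp - p dp\<close>. Only mixed products of \<open>\<partial>p\<close> and \<open>\<partial>'p\<close> survive, so the
result has weight \<open>1\<close>.\<close>
lemma d2_dP: "d2 (dP i l) = - (mprod w dP dbP i l + mprod w dbP dP i l)"
proof -
  note p = pairingD[OF w]
  have w0: "mprod w dP dP i l = 0" "mprod w dbP dbP i l = 0"
    using tens_dP_dP[of i l] tens_dbP_dbP[of i l] unfolding mprod_def w_def
    by (simp_all add: cl_0[OF cl_wedge] flip: cl_sum[OF cl_wedge])
  have "d2 (dP i l) = - (\<Sum>k\<in>UNIV. w (d (p i k)) (d (p k l)))"
    by (simp add: dP_eq cl_diff[OF cl_d2] d2_closed mprod_def cl_sum[OF cl_d2] d2_d w_def)
  also have "(\<Sum>k\<in>UNIV. w (d (p i k)) (d (p k l))) = (mprod w dP dP i l + mprod w dbP dbP i l) + (mprod w dP dbP i l + mprod w dbP dP i l)"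
    by (simp add: mprod_def d_p cl_add[OF p(1)] cl_add[OF p(2)] sum.distrib algebra_simps)
  finally show ?thesis by (simp add: w0)
qed

lemma d2_dbP: "d2 (dbP i l) = mprod w dP dbP i l + mprod w dbP dP i l"
proof -
  have "d2 (dP i l) + d2 (dbP i l) = 0" using d2_closed[of "p i l"] by (simp add: d_p cl_add[OF cl_d2])
  then have "d2 (dbP i l) = - d2 (dP i l)" by (simp only: add_eq_0_iff)
  then show ?thesis by (simp add: d2_dP)
qed

lemma a_inv: "a * inverse a = 1" "inverse a * a = 1" using a by simp_all

lemma wt_d2: "wt O2 1 (\<lambda>i l. d2 (dP i l))" "wt O2 1 (\<lambda>i l. d2 (dbP i l))"
proof -
  have "wt O2 1 (mprod w dP dbP)" "wt O2 1 (mprod w dbP dP)"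
    using wt_mprod[OF O2 w wt_dP wt_dbP] wt_mprod[OF O2 w wt_dbP wt_dP] by (simp_all only: a_inv)
  then have s: "wt O2 1 (\<lambda>i l. mprod w dP dbP i l + mprod w dbP dP i l)" by (rule wt_add[OF O2])
  show "wt O2 1 (\<lambda>i l. d2 (dbP i l))" unfolding d2_dbP by (rule s)
  show "wt O2 1 (\<lambda>i l. d2 (dP i l))" unfolding d2_dP by (rule wt_minus[OF O2 s])
qed

abbreviation "gmp \<equiv> tr \<kappa> (mprod tens dbP dP)"
abbreviation "gpm \<equiv> tr \<kappa> (mprod tens dP dbP)"

lemma wt_tens: "wt OT 1 (mprod tens dbP dP)" "wt OT 1 (mprod tens dP dbP)" "wt OT 1 (bprod tens dbP dP)"
  using wt_mprod[OF OT tens wt_dP wt_dbP] wt_mprod[OF OT tens wt_dbP wt_dP] wt_bprod[OF OT tens wt_dbP wt_dP] by (simp_all only: a_inv)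

lemma swt_g: "swt OT 1 gmp" "swt OT 1 gpm"
  using swt_tr[OF OT] wt_tens by blast+

lemma wt_nabla: "wt OT 1 (\<lambda>i j. nabla (dP i j))" "wt OT 1 (\<lambda>i j. nabla (dbP i j))"
  unfolding nabla_dP nabla_dbP
  by (intro wt_diff wt_scale OT wt_tens wt_p_swt swt_g)+

lemma a_ne_1: "a \<noteq> 1" "inverse a \<noteq> 1" "a \<noteq> inverse a"
proof -
  show "a \<noteq> 1" "inverse a \<noteq> 1" using a by auto
  show "a \<noteq> inverse a" using a_inv(1) a(2) by auto
qed

lemma \<Theta>_mprod: "\<Theta> (mprod tens A B i l) = mprod tens2 (\<lambda>i j. d2 (A i j)) B i l - mprod L A (\<lambda>i j. nabla (B i j)) i l"
  by (simp add: mprod_def cl_sum[OF \<Theta>(1)] \<Theta>(2) sum_subtractf)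

lemma \<Theta>_bprod: "\<Theta> (bprod tens A B i l) = bprod tens2 (\<lambda>i j. d2 (A i j)) B i l - bprod L A (\<lambda>i j. nabla (B i j)) i l"
proof -
  let ?X = "prod4 tens2 (\<lambda>i j. d2 (A i j)) B" and ?Y = "prod4 L A (\<lambda>i j. nabla (B i j))"
  have "(\<lambda>f. \<Theta> (prod4 tens A B f)) = (\<lambda>f. ?X f + (-1) *\<^sub>C ?Y f)"
    by (simp add: prod4_def \<Theta>(2))
  then have "\<Theta> (bprod tens A B i l) = E 1 (T 0 (\<lambda>f. ?X f + (-1) *\<^sub>C ?Y f)) (pt i l)"
    unfolding bprod_def cl_cap[OF \<Theta>(1)] cl_T[OF \<Theta>(1)] by simp
  also have "\<dots> = E 1 (T 0 ?X) (pt i l) + (-1) *\<^sub>C E 1 (T 0 ?Y) (pt i l)"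
    unfolding T_add T_scale cap_add cap_scale ..
  finally show ?thesis by (simp add: bprod_def)
qed

text \<open>The map \<open>\<Theta>\<close> takes the two components of the metric to q-traces of families of weights \<open>a\<close> and
\<open>inverse a\<close>. As neither is \<open>1\<close>, both vanish.\<close>
lemma \<Theta>_g: "\<Theta> gmp = 0" "\<Theta> gpm = 0"
proof -
  have t: "\<Theta> (tr \<kappa> (mprod tens A B)) = tr \<kappa> (mprod tens2 (\<lambda>i j. d2 (A i j)) B) - tr \<kappa> (mprod L A (\<lambda>i j. nabla (B i j)))" for A B
    by (simp add: tr_def cl_sum[OF \<Theta>(1)] cl_scale[OF \<Theta>(1)] \<Theta>_mprod cvec.scale_right_diff_distrib sum_subtractf)
  note z = swt_eq_0[OF O3 swt_tr[OF O3]]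
  note wm = wt_mprod[OF O3 tens2 wt_d2(1) wt_dbP] wt_mprod[OF O3 tens2 wt_d2(2) wt_dP]
    wt_mprod[OF O3 L_pairing wt_dP wt_nabla(2)] wt_mprod[OF O3 L_pairing wt_dbP wt_nabla(1)]
  have "tr \<kappa> (mprod tens2 (\<lambda>i j. d2 (dbP i j)) dP) = 0" by (rule z[OF wm(2)]) (simp add: a_ne_1)
  moreover have "tr \<kappa> (mprod L dbP (\<lambda>i j. nabla (dP i j))) = 0" by (rule z[OF wm(4)]) (use a_ne_1 in simp)
  ultimately show "\<Theta> gmp = 0" by (simp only: t diff_self)
  have "tr \<kappa> (mprod tens2 (\<lambda>i j. d2 (dP i j)) dbP) = 0" by (rule z[OF wm(1)]) (use a_ne_1 in simp)
  moreover have "tr \<kappa> (mprod L dP (\<lambda>i j. nabla (dbP i j))) = 0" by (rule z[OF wm(3)]) (use a_ne_1 in simp)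
  ultimately show "\<Theta> gpm = 0" by (simp only: t diff_self)
qed

lemma \<Theta>_pg: "\<Theta> (lact OT (p i j) gmp) = L (dP i j) gmp + L (dbP i j) gmp"
  "\<Theta> (lact OT (p i j) gpm) = L (dP i j) gpm + L (dbP i j) gpm"
  by (simp_all add: \<Theta>_lact \<Theta>_g cl_0[OF bimodule_cl(1)[OF O3]] d_p cl_add[OF pairingD(2)[OF L_pairing]])

text \<open>In \<open>\<Theta>\<close> of the connection, the term \<open>\<partial>p \<and> \<partial>p \<otimes> \<partial>'p\<close> vanishes, and the terms with \<open>\<partial>p\<close>
and the metric cancel because \<open>\<partial>p p = \<partial>p\<close>. All that remains has the weight of \<open>\<partial>'p\<close>.\<close>
lemma Riem_dbP: "Riem (dbP i l) = mprod tens2 (\<lambda>i j. d2 (dP i j)) dbP i l - m' *\<^sub>C L (dbP i l) gpm"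
proof -
  note p = pairingD[OF L_pairing]
  have "mprod L dP (mprod tens dP dbP) = mprod tens2 (mprod w dP dP) dbP"
    by (rule mprod_assoc[symmetric]) (simp_all add: L w_def pairingD[OF tens2])
  moreover have "mprod w dP dP i l = 0" for i l
    using tens_dP_dP[of i l] unfolding mprod_def w_def by (simp add: cl_0[OF cl_wedge] flip: cl_sum[OF cl_wedge])
  ultimately have 1: "mprod L dP (mprod tens dP dbP) i l = 0"
    by (simp add: mprod_def[of tens2] cl_0[OF pairingD(2)[OF tens2]])
  have 2: "(\<Sum>j\<in>UNIV. L (dP i j) (lact OT (p j l) gpm)) = L (dP i l) gpm"
  proof -
    have "(\<Sum>j\<in>UNIV. L (dP i j) (lact OT (p j l) gpm)) = L (mprod ra dP p i l) gpm"
      by (simp add: mprod_def cl_sum[OF p(2)] p(3))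
    then show ?thesis by (simp only: dP_p)
  qed
  have "mprod L dP (\<lambda>i j. nabla (dbP i j)) i l = mprod L dP (mprod tens dP dbP) i l
      - m' *\<^sub>C (\<Sum>j\<in>UNIV. L (dP i j) (lact OT (p j l) gpm))"
    by (simp add: mprod_def[of L] nabla_dbP cl_diff[OF p(1)] cl_scale[OF p(1)] sum_subtractf scaleC_sum_right)
  then have "mprod L dP (\<lambda>i j. nabla (dbP i j)) i l = - (m' *\<^sub>C L (dP i l) gpm)"
    by (simp add: 1 2)
  then show ?thesis
    by (simp add: Riem_def nabla_dbP cl_diff[OF \<Theta>(1)] cl_scale[OF \<Theta>(1)] \<Theta>_mprod \<Theta>_pg scaleC_add_right)
qed

lemma wt_Riem_dbP: "wt O3 (inverse a) (\<lambda>i l. Riem (dbP i l))"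
  unfolding Riem_dbP
  using wt_mprod[OF O3 tens2 wt_d2(1) wt_dbP] wt_swt[OF L_pairing wt_dbP swt_g(2)]
  by (intro wt_diff wt_scale O3) simp_all

text \<open>The curvature of \<open>\<partial>p\<close> splits into a part of the weight of \<open>\<partial>p\<close> and a part of the weight of \<open>\<partial>'p\<close>.\<close>
definition "G i l = a *\<^sub>C bprod tens2 (\<lambda>i j. d2 (dbP i j)) dP i l - (a * m') *\<^sub>C L (dP i l) gmp"
definition "U i l = - (a *\<^sub>C bprod L dbP (\<lambda>i j. nabla (dP i j)) i l) - (a * m') *\<^sub>C L (dbP i l) gmp"

lemma Riem_dP: "Riem (dP i l) = G i l + U i l"
  by (simp add: Riem_def nabla_dP cl_diff[OF \<Theta>(1)] cl_scale[OF \<Theta>(1)] \<Theta>_bprod \<Theta>_pg scaleC_add_right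
      cvec.scale_right_diff_distrib G_def U_def)

lemma wt_G: "wt O3 a G"
  unfolding G_def[abs_def]
  using wt_bprod[OF O3 tens2 wt_d2(2) wt_dP] wt_swt[OF L_pairing wt_dP swt_g(1)]
  by (intro wt_diff wt_scale O3) simp_all

lemma wt_U: "wt O3 (inverse a) U"
  unfolding U_def[abs_def]
  using wt_bprod[OF O3 L_pairing wt_dbP wt_nabla(1)] wt_swt[OF L_pairing wt_dbP swt_g(1)]
  by (intro wt_diff wt_minus wt_scale O3) simp_all

lemma mprod_ract_p: "wt M \<alpha> A \<Longrightarrow> mprod (ract M) A p i l = \<alpha> *\<^sub>C bprod (lact M) p A i l"
  unfolding wt_def bprod_def mprod_pt by (simp add: cap_scale)

text \<open>Left linearity of the curvature forces the part of wrong weight to vanish. The relations \<open>\<partial>p = \<partial>p p = a E\<^sub>2\<^sub>3 T p \<partial>p\<close>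
give \<open>R(\<partial>p) = a E\<^sub>2\<^sub>3 T p R(\<partial>p)\<close>, hence by comparing weights \<open>U = a E\<^sub>2\<^sub>3 T p U\<close>. On the other hand
\<open>U p = inverse a E\<^sub>2\<^sub>3 T p U\<close> by the weight of \<open>U\<close>. So \<open>U p\<close> is \<open>U\<close> times the square of \<open>inverse a\<close>, which is
neither \<open>0\<close> nor \<open>1\<close>, and this is impossible for \<open>U \<noteq> 0\<close> as \<open>p\<close> is idempotent.\<close>
lemma U_eq_0: "U i l = 0"
proof -
  interpret bimodule O3 by (rule O3)
  note p = pairingD[OF pairing_lact[OF O3]]
  have Q: "Riem (dP i l) = a *\<^sub>C bprod (lact O3) p (\<lambda>i j. Riem (dP i j)) i l" for i l
  proof -
    have "Riem (dP i l) = Riem (a *\<^sub>C bprod la p dP i l)"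
      using mprod_ract_p[OF wt_dP] by (simp add: dP_p)
    also have "\<dots> = a *\<^sub>C bprod (lact O3) p (\<lambda>i j. Riem (dP i j)) i l"
      unfolding cl_scale[OF cl_Riem] bprod_def cl_cap[OF cl_Riem] cl_T[OF cl_Riem]
      by (simp add: prod4_def[abs_def] Riem_lact)
    finally show ?thesis .
  qed
  have add: "bprod (lact O3) p (\<lambda>i j. G i j + U i j) i l = bprod (lact O3) p G i l + bprod (lact O3) p U i l" for i l
  proof -
    have "prod4 (lact O3) p (\<lambda>i j. G i j + U i j) = (\<lambda>f. prod4 (lact O3) p G f + prod4 (lact O3) p U f)"
      by (simp add: prod4_def lact_add_right fun_eq_iff)
    then show ?thesis by (simp add: bprod_def T_add cap_add)
  qed
  have wG: "wt O3 a (\<lambda>i l. G i l - a *\<^sub>C bprod (lact O3) p G i l)"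
    using wt_bprod[OF O3 pairing_lact[OF O3] wt_p wt_G] by (intro wt_diff wt_scale O3 wt_G) simp
  have wU: "wt O3 (inverse a) (\<lambda>i l. U i l - a *\<^sub>C bprod (lact O3) p U i l)"
    using wt_bprod[OF O3 pairing_lact[OF O3] wt_p wt_U] by (intro wt_diff wt_scale O3 wt_U) simp
  \<comment> \<open>Comparing parts of equal weight.\<close>
  have U0: "U i l - a *\<^sub>C bprod (lact O3) p U i l = 0" for i l
  proof (rule wt_split[OF O3 wU wG])
    show "inverse a \<noteq> a" using a_ne_1 by simp
    show "U i j - a *\<^sub>C bprod (lact O3) p U i j + (G i j - a *\<^sub>C bprod (lact O3) p G i j) = 0" for i j
      using Q[of i j] unfolding Riem_dP add scaleC_add_right by (simp add: algebra_simps)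
  qed
  have U1: "bprod (lact O3) p U i l = inverse a *\<^sub>C U i l" for i l
  proof -
    have "U i l = a *\<^sub>C bprod (lact O3) p U i l" using U0[of i l] by (simp only: right_minus_eq)
    from arg_cong[OF this, of "\<lambda>x. inverse a *\<^sub>C x"] show ?thesis
      by (simp only: scaleC_scaleC a_inv scaleC_one)
  qed
  define c where "c = inverse a * inverse a"
  \<comment> \<open>The same braided product, now evaluated by the weight of \<open>U\<close>.\<close>
  have U2: "mprod (ract O3) U p = (\<lambda>i l. c *\<^sub>C U i l)"
    by (simp add: fun_eq_iff mprod_ract_p[OF wt_U] U1 c_def scaleC_scaleC)
  have "mprod (ract O3) (mprod (ract O3) U p) p = mprod (ract O3) U (mprod (*) p p)"
    by (rule mprod_assoc) (simp_all add: ract_mult bimodule_cl[OF O3])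
  then have "mprod (ract O3) (\<lambda>i l. c *\<^sub>C U i l) p i l = c *\<^sub>C U i l" by (simp only: p_p U2)
  moreover have "mprod (ract O3) (\<lambda>i l. c *\<^sub>C U i l) p i l = c *\<^sub>C mprod (ract O3) U p i l"
    by (simp add: mprod_def ract_scaleC_left scaleC_sum_right)
  ultimately have "(c * c - c) *\<^sub>C U i l = 0" by (simp add: U2 cvec.scale_left_diff_distrib)
  moreover have "c * c - c \<noteq> 0"
  proof -
    have "c \<noteq> 0" using a by (simp add: c_def)
    moreover have "c = inverse (a * a)" by (simp add: c_def)
    then have "c \<noteq> 1" using a by (metis inverse_1 inverse_inverse_eq)
    moreover have "c * c - c = c * (c - 1)" by (simp add: algebra_simps)
    ultimately have "c \<noteq> 0 \<and> c - 1 \<noteq> 0 \<and> c * c - c = c * (c - 1)" by simp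
    then show ?thesis by (simp only: mult_eq_0_iff) simp
  qed
  ultimately show ?thesis by simp
qed

lemma wt_Riem_dP: "wt O3 a (\<lambda>i l. Riem (dP i l))"
  using wt_G by (simp add: Riem_dP U_eq_0)

text \<open>Both sides are \<open>\<alpha> T p R(A)\<close>: one by the weight of \<open>A\<close> and left linearity, the other by the weight of \<open>R(A)\<close>.\<close>
lemma Riem_ract_family:
  assumes A: "wt O1 \<alpha> A" and RA: "wt O3 \<alpha> (\<lambda>i j. Riem (A i j))"
  shows "Riem (ra (A i j) (p k l)) = ract O3 (Riem (A i j)) (p k l)"
proof -
  have "(\<lambda>f. Riem (prod4 ra A p f)) = (\<lambda>f. \<alpha> *\<^sub>C T 0 (\<lambda>f. Riem (prod4 la p A f)) f)"
    using A by (simp add: wt_def cl_scale[OF cl_Riem] cl_T[OF cl_Riem])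
  also have "(\<lambda>f. Riem (prod4 la p A f)) = prod4 (lact O3) p (\<lambda>i j. Riem (A i j))"
    by (simp add: prod4_def Riem_lact fun_eq_iff)
  also have "(\<lambda>f. \<alpha> *\<^sub>C T 0 (prod4 (lact O3) p (\<lambda>i j. Riem (A i j))) f) = prod4 (ract O3) (\<lambda>i j. Riem (A i j)) p"
    using RA by (simp add: wt_def)
  finally have "Riem (prod4 ra A p f) = prod4 (ract O3) (\<lambda>i j. Riem (A i j)) p f" for f by (rule fun_cong)
  from this[of "\<lambda>n. if n = 0 then i else if n = 1 then j else if n = 2 then k else l"]
  show ?thesis by (simp add: prod4_def)
qed

theorem Riem_ract: "Riem (ra x b) = ract O3 (Riem x) b"
proof -
  interpret M: bimodule O1 by (rule O1)
  interpret N: bimodule O3 by (rule O3)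
  have pp: "x \<in> {x. \<forall>k l. Riem (ra x (p k l)) = ract O3 (Riem x) (p k l)}" for x
  proof (rule gen_O1)
    fix i j
    show "dP i j \<in> {x. \<forall>k l. Riem (ra x (p k l)) = ract O3 (Riem x) (p k l)}"
      using Riem_ract_family[OF wt_dP wt_Riem_dP] by simp
    show "dbP i j \<in> {x. \<forall>k l. Riem (ra x (p k l)) = ract O3 (Riem x) (p k l)}"
      using Riem_ract_family[OF wt_dbP wt_Riem_dbP] by simp
  qed (simp_all add: M.ract_add_left N.ract_add_left cl_add[OF cl_Riem] M.lact_ract N.lact_ract Riem_lact)
  have "b \<in> {b. \<forall>x. Riem (ra x b) = ract O3 (Riem x) b}"
    by (rule gen_p) (use pp in \<open>simp_all add: M.ract_add_right N.ract_add_right cl_add[OF cl_Riem] cl_scale[OF cl_Riem]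
      M.ract_scaleC_right N.ract_scaleC_right M.ract_mult N.ract_mult M.ract_one N.ract_one\<close>)
  then show ?thesis by simp
qed

end

section \<open>Presentations\<close>

lemma lookup_scaleC: "Poly_Mapping.lookup (c *\<^sub>C f) k = c *\<^sub>C Poly_Mapping.lookup f k"
  by (simp add: scaleC_poly_mapping_def Poly_Mapping.map.rep_eq when_def)

lemma keys_scaleC: "Poly_Mapping.keys (c *\<^sub>C f) \<subseteq> Poly_Mapping.keys f"
proof
  fix k assume "k \<in> Poly_Mapping.keys (c *\<^sub>C f)"
  then have "c *\<^sub>C Poly_Mapping.lookup f k \<noteq> 0" by (simp only: in_keys_iff lookup_scaleC not_False_eq_True)
  then show "k \<in> Poly_Mapping.keys f" by (auto simp: in_keys_iff)
qed

lemma eval_free_superset: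
  assumes "finite A" "Poly_Mapping.keys f \<subseteq> A"
  shows "eval_free \<phi> f = (\<Sum>w\<in>A. Poly_Mapping.lookup f w *\<^sub>C prod_list (map \<phi> (letters w)))"
  unfolding eval_free_def by (rule sum.mono_neutral_left) (use assms in \<open>auto simp: in_keys_iff\<close>)

lemma cl_eval_free: "cl (eval_free \<phi>)" for \<phi> :: "'g \<Rightarrow> 'b::complex_algebra_1"
  unfolding cl_def
proof (intro conjI allI)
  fix f g :: "'g free_algebra"
  let ?A = "Poly_Mapping.keys f \<union> Poly_Mapping.keys g"
  have A: "finite ?A" by simp
  show "eval_free \<phi> (f + g) = eval_free \<phi> f + eval_free \<phi> g"
    using eval_free_superset[OF A Poly_Mapping.keys_add, of \<phi>] eval_free_superset[OF A, of f \<phi>] eval_free_superset[OF A, of g \<phi>]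
    by (simp add: lookup_add scaleC_add_left sum.distrib)
next
  fix c f
  show "eval_free \<phi> (c *\<^sub>C f) = c *\<^sub>C eval_free \<phi> f"
    using eval_free_superset[OF finite_keys keys_scaleC, of \<phi> c f] eval_free_superset[of "Poly_Mapping.keys f" f \<phi>]
    by (simp add: lookup_scaleC scaleC_sum_right scaleC_complex_def)
qed

lemma eval_free_single: "eval_free \<phi> (Poly_Mapping.single w c) = c *\<^sub>C prod_list (map \<phi> (letters w))"
  using eval_free_superset[of "{w}" "Poly_Mapping.single w c" \<phi>] by (simp add: lookup_single)

lemma eval_free_gens:
  "eval_free \<phi> (free_gen g) = \<phi> g" "eval_free \<phi> (free_gen g * free_gen h) = \<phi> g * \<phi> h" "eval_free \<phi> 1 = 1"
  unfolding free_gen_def mult_single single_one[symmetric]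
  by (simp_all add: eval_free_single plus_word_def zero_word_def scaleC_one)

lemma eval_free_module_superset:
  assumes "\<And>x. act 0 x = 0" "finite A" "Poly_Mapping.keys f \<subseteq> A"
  shows "eval_free_module act \<phi> f = (\<Sum>g\<in>A. act (Poly_Mapping.lookup f g) (\<phi> g))"
  unfolding eval_free_module_def by (rule sum.mono_neutral_left) (use assms in \<open>auto simp: in_keys_iff\<close>)

lemma eval_free_module_single:
  assumes "\<And>x. act 0 x = 0"
  shows "eval_free_module act \<phi> (Poly_Mapping.single g b) = act b (\<phi> g)"
  using eval_free_module_superset[of act "{g}" "Poly_Mapping.single g b" \<phi>, OF assms] by (simp add: lookup_single)

lemma cl_eval_free_module:
  fixes act :: "'b::{complex_vector, ring_1} \<Rightarrow> 'm::complex_vector \<Rightarrow> 'm" and \<phi> :: "'g \<Rightarrow> 'm"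
  assumes act: "\<And>x. cl (\<lambda>b. act b x)"
  shows "cl (eval_free_module act \<phi>)"
  unfolding cl_def
proof (intro conjI allI)
  have a0: "\<And>x. act 0 x = 0" by (rule cl_0[OF act])
  fix f g :: "'g \<Rightarrow>\<^sub>0 'b"
  let ?A = "Poly_Mapping.keys f \<union> Poly_Mapping.keys g"
  have A: "finite ?A" by simp
  show "eval_free_module act \<phi> (f + g) = eval_free_module act \<phi> f + eval_free_module act \<phi> g"
    using eval_free_module_superset[where act = act, OF a0 A Poly_Mapping.keys_add, of \<phi>] eval_free_module_superset[where act = act, OF a0 A, of f \<phi>] eval_free_module_superset[where act = act, OF a0 A, of g \<phi>]
    by (simp only: lookup_add cl_add[OF act] sum.distrib Un_upper1 Un_upper2)
next
  have a0: "\<And>x. act 0 x = 0" by (rule cl_0[OF act])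
  fix c f
  show "eval_free_module act \<phi> (c *\<^sub>C f) = c *\<^sub>C eval_free_module act \<phi> f"
  proof -
    have "eval_free_module act \<phi> (c *\<^sub>C f) = (\<Sum>g\<in>Poly_Mapping.keys f. act (Poly_Mapping.lookup (c *\<^sub>C f) g) (\<phi> g))"
      by (rule eval_free_module_superset[where act = act, OF a0 finite_keys keys_scaleC])
    also have "\<dots> = (\<Sum>g\<in>Poly_Mapping.keys f. c *\<^sub>C act (Poly_Mapping.lookup f g) (\<phi> g))"
      by (simp only: lookup_scaleC cl_scale[OF act])
    finally show ?thesis by (simp only: eval_free_module_def scaleC_sum_right)
  qed
qed

lemma quotient_relation: "is_quotient f (P hull Rel) \<Longrightarrow> x \<in> Rel \<Longrightarrow> f x = 0"
proof -
  assume "is_quotient f (P hull Rel)" and x: "x \<in> Rel"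
  then have "{x. f x = 0} = P hull Rel" by (simp only: is_quotient_def)
  then show "f x = 0" using hull_inc[OF x, of P] by (simp only: set_eq_iff mem_Collect_eq)
qed

lemma free_lact_single: "free_lact b (Poly_Mapping.single g 1) = Poly_Mapping.single g b"
  by (rule poly_mapping_eqI) (auto simp: free_lact_def Poly_Mapping.map.rep_eq lookup_single when_def)

section \<open>Families indexed by lists\<close>

text \<open>Passing from families indexed by lists to functions of legs.\<close>
definition ev4 :: "('n list \<Rightarrow> 'm) \<Rightarrow> (nat \<Rightarrow> 'n) \<Rightarrow> 'm" where "ev4 x f = x [f 0, f 1, f 2, f 3]"

lemma ev4_leg: "ev4 (leg 1 A x) = on_legs 0 A (ev4 x)" "ev4 (leg 2 A x) = on_legs 1 A (ev4 x)" "ev4 (leg 3 A x) = on_legs 2 A (ev4 x)"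
  by (simp_all add: ev4_def leg_def on_legs_def fun_eq_iff sum_UNIV_prod numeral_eq_Suc)

lemma ev4_fprod: "ev4 (fprod m (fam A) (fam B)) = prod4 m A B"
  by (simp add: ev4_def fprod_def fam_def prod4_def fun_eq_iff numeral_eq_Suc)

lemma ev4_S: "ev4 (S123 R D x) = on_legs 1 D (on_legs 0 R (on_legs 1 (matrix_inv D) (ev4 x)))"
  by (simp only: S123_def o_apply ev4_leg)

lemma ev4_St: "ev4 (St234 D Q x) = on_legs 1 D (on_legs 2 (matrix_inv Q) (on_legs 1 (matrix_inv D) (ev4 x)))"
  by (simp only: St234_def o_apply ev4_leg)

lemma ev4_relation:
  assumes h: "cl h" and y: "\<And>I. length I = 4 \<Longrightarrow> y I = h (x I)"
    and rel: "\<And>I. length I = 4 \<Longrightarrow> h (F x I - c *\<^sub>C x I) = 0"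
    and F: "ev4 (F x) = on_legs 1 A (on_legs k B (on_legs 1 C (ev4 x)))"
  shows "on_legs 1 A (on_legs k B (on_legs 1 C (ev4 y))) = (\<lambda>f. c *\<^sub>C ev4 y f)"
proof
  fix f
  have e: "ev4 y = (\<lambda>f. h (ev4 x f))" by (simp add: ev4_def fun_eq_iff y)
  have "on_legs 1 A (on_legs k B (on_legs 1 C (ev4 y))) f = h (ev4 (F x) f)"
    unfolding F e cl_on_legs[OF h] ..
  also have "\<dots> = h (c *\<^sub>C ev4 x f)"
    using rel[of "[f 0, f 1, f 2, f 3]"] by (simp add: ev4_def cl_diff[OF h])
  also have "\<dots> = c *\<^sub>C ev4 y f" by (simp add: e cl_scale[OF h])
  finally show "on_legs 1 A (on_legs k B (on_legs 1 C (ev4 y))) f = c *\<^sub>C ev4 y f" .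
qed

lemma contr'_1: "contr' r q wt 1 x [] = (\<Sum>i\<in>UNIV. qc q (wform r (wt i) (two_rho r)) *\<^sub>C x [i, i])"
  by (simp add: contr'_def)

lemma contr_2: "contr 2 x [i, j] = cap (\<lambda>_. 1) 1 (ev4 x) (pt i j)"
  by (simp add: contr_def cap_def ev4_def graft_def pt_def scaleC_one numeral_eq_Suc)

context braiding_data begin

text \<open>A cap of type \<open>E'\<close> slides through \<open>S\<close>, where the remaining crossing is a curl on it. So on eigentensors of
\<open>S\<close> the contractions \<open>E\<^sub>2\<^sub>3\<close> and \<open>E'\<^sub>1\<^sub>2\<close> are proportional; this turns the relations \<open>S p x = c p x\<close> into
matrix products.\<close>
lemma E_of_S:
  assumes "on_legs 1 D (on_legs 0 R (on_legs 1 Di x)) = (\<lambda>f. c *\<^sub>C x f)"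
  shows "E 1 x f = (z * c) *\<^sub>C E' 0 x f"
proof -
  have "E' 0 (on_legs (Suc 0) D (on_legs 0 R (on_legs 1 Di x))) = E' (Suc 0) (on_legs 1 Di x)" by (rule E'_over)
  then have "(\<lambda>f. c *\<^sub>C E' 0 x f) = (\<lambda>f. inverse z *\<^sub>C E 1 x f)"
    using assms by (simp add: cap_scale E'_Di)
  then have "c *\<^sub>C E' 0 x f = inverse z *\<^sub>C E 1 x f" by (rule fun_cong)
  from arg_cong[OF this, of "\<lambda>u. z *\<^sub>C u"] show ?thesis using z_nonzero by (simp add: scaleC_scaleC scaleC_one)
qed

text \<open>On eigentensors of \<open>S~\<close>, the contraction \<open>E\<^sub>2\<^sub>3\<close> is determined by \<open>E'\<^sub>3\<^sub>4\<close> in the same way; this is how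
\<open>p \<partial>p = 0\<close> follows from the vanishing q-trace of \<open>\<partial>p\<close>.\<close>
lemma E_of_St:
  assumes St: "on_legs 1 D (on_legs 2 Qi (on_legs 1 Di x)) = (\<lambda>f. c *\<^sub>C x f)" and c: "c \<noteq> 0"
    and E': "E' 2 x = (\<lambda>_. 0)"
  shows "E 1 x f = 0"
proof -
  let ?y = "on_legs 1 Di x"
  have "on_legs 1 Di (on_legs 1 D (on_legs 2 Qi ?y)) = on_legs 1 Di (\<lambda>f. c *\<^sub>C x f)" by (simp only: St)
  then have y: "on_legs 2 Qi ?y = (\<lambda>f. c *\<^sub>C ?y f)" by (simp only: cancel on_legs_scale)
  have "E' 1 (on_legs 2 Qi ?y) = E' 2 (on_legs 1 D ?y)" using E'_slide_Qi[of 1 ?y] by (simp add: numeral_2_eq_2)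
  also have "\<dots> = (\<lambda>_. 0)" by (simp only: cancel E')
  finally have "(\<lambda>f. c *\<^sub>C E' 1 ?y f) = (\<lambda>_. 0)" by (simp only: y cap_scale)
  then have "c *\<^sub>C E' 1 ?y f = 0" by (rule fun_cong)
  then show ?thesis using c z_nonzero by (simp add: E'_Di)
qed

lemma T_of_S_St:
  assumes "on_legs 1 D (on_legs 0 R (on_legs 1 Di x)) = (\<lambda>f. c *\<^sub>C x f)"
    "on_legs 1 D (on_legs 2 Qi (on_legs 1 Di x)) = (\<lambda>f. c' *\<^sub>C x f)" "c * c' = 1"
  shows "T 0 x = x"
proof -
  have "T 0 x = on_legs 1 D (on_legs 0 R (on_legs 1 Di (on_legs 1 D (on_legs 2 Qi (on_legs 1 Di x)))))"
    by (simp add: T_def cancel numeral_2_eq_2)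
  also have "\<dots> = (\<lambda>f. c' *\<^sub>C c *\<^sub>C x f)" unfolding assms(2) on_legs_scale assms(1) ..
  also have "\<dots> = x" using assms(3) by (simp add: scaleC_scaleC mult.commute scaleC_one)
  finally show ?thesis .
qed

end

lemma ev4_T:
  assumes "braiding_data R Rb D (matrix_inv D) Q (matrix_inv Q) \<kappa> z"
  shows "ev4 (T1234 R D Q x) = braiding_data.T R D (matrix_inv D) (matrix_inv Q) 0 (ev4 x)"
proof -
  interpret braiding_data R Rb D "matrix_inv D" Q "matrix_inv Q" \<kappa> z by fact
  show ?thesis by (simp add: T1234_def ev4_S ev4_St T_def cancel numeral_2_eq_2)
qed

section \<open>Tensor products\<close>

lemma span_finite_sum:
  assumes "\<And>x y. x \<in> S \<Longrightarrow> y \<in> S \<Longrightarrow> x + y \<in> S" "0 \<in> S" "\<And>i. i \<in> I \<Longrightarrow> g i \<in> S"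
  shows "(\<Sum>i\<in>I. g i) \<in> S"
  using assms(3) by (induction I rule: infinite_finite_induct) (simp_all add: assms(1,2))

lemma tensor_product_facts:
  fixes M :: "('b::complex_algebra_1, 'm::complex_vector) bimod" and N :: "('b, 'n::complex_vector) bimod"
    and T :: "('b, 't::complex_vector) bimod"
  assumes T: "is_tensor_product M N T tens"
  shows "bimodule T" "pairing M N T tens"
    and "\<And>S t. (\<And>x y. x \<in> S \<Longrightarrow> y \<in> S \<Longrightarrow> x + y \<in> S) \<Longrightarrow> (\<And>x y. tens x y \<in> S) \<Longrightarrow> t \<in> S"
    and "\<And>\<beta> :: 'm \<Rightarrow> 'n \<Rightarrow> 'u::complex_vector. (\<And>x. cl (\<beta> x)) \<Longrightarrow> (\<And>y. cl (\<lambda>x. \<beta> x y)) \<Longrightarrow>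
      (\<And>x b y. \<beta> (ract M x b) y = \<beta> x (lact N b y)) \<Longrightarrow>
      cl (tensor_lift tens \<beta>) \<and> (\<forall>x y. tensor_lift tens \<beta> (tens x y) = \<beta> x y)"
proof -
  let ?ev = "eval_free_module scaleC (\<lambda>z. tens (fst z) (snd z))"
  have sc: "cl (\<lambda>b::complex. b *\<^sub>C x)" for x :: "'z::complex_vector"
    by (simp add: cl_def scaleC_add_left scaleC_complex_def)
  have cl_ev: "cl ?ev" by (rule cl_eval_free_module[OF sc])
  have single: "eval_free_module scaleC (\<lambda>z. m (fst z) (snd z)) (Poly_Mapping.single (x, y) 1) = m x y"
    for m :: "_ \<Rightarrow> _ \<Rightarrow> 'z::complex_vector" and x y
    by (subst eval_free_module_single) (simp_all add: scaleC_one)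
  have quot: "is_quotient ?ev (cvec.subspace hull tensor_relators M N)" and surj: "surj ?ev"
    using T by (auto simp: is_tensor_product_def is_quotient_def)
  have rel: "?ev f = 0" if "f \<in> tensor_relators M N" for f
    by (rule quotient_relation[OF quot that])
  note ev = cl_diff[OF cl_ev] cl_add[OF cl_ev] cl_scale[OF cl_ev] single
  show bT: "bimodule T" using T by (simp add: is_tensor_product_def)
  have add1: "tens (x + x') y = tens x y + tens x' y" for x x' y
  proof -
    have "?ev (Poly_Mapping.single (x + x', y) 1 - Poly_Mapping.single (x, y) 1 - Poly_Mapping.single (x', y) 1) = 0"
      by (rule rel) (unfold tensor_relators_def Let_def, blast)
    then show ?thesis by (simp add: ev algebra_simps)
  qed
  have add2: "tens x (y + y') = tens x y + tens x y'" for x y y'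
  proof -
    have "?ev (Poly_Mapping.single (x, y + y') 1 - Poly_Mapping.single (x, y) 1 - Poly_Mapping.single (x, y') 1) = 0"
      by (rule rel) (unfold tensor_relators_def Let_def, blast)
    then show ?thesis by (simp add: ev algebra_simps)
  qed
  have scale1: "tens (c *\<^sub>C x) y = c *\<^sub>C tens x y" for c x y
  proof -
    have "?ev (Poly_Mapping.single (c *\<^sub>C x, y) 1 - c *\<^sub>C Poly_Mapping.single (x, y) 1) = 0"
      by (rule rel) (unfold tensor_relators_def Let_def, blast)
    then show ?thesis by (simp add: ev)
  qed
  have scale2: "tens x (c *\<^sub>C y) = c *\<^sub>C tens x y" for c x y
  proof -
    have "?ev (Poly_Mapping.single (x, c *\<^sub>C y) 1 - c *\<^sub>C Poly_Mapping.single (x, y) 1) = 0"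
      by (rule rel) (unfold tensor_relators_def Let_def, blast)
    then show ?thesis by (simp add: ev)
  qed
  have bal: "tens (ract M x b) y = tens x (lact N b y)" for x b y
  proof -
    have "?ev (Poly_Mapping.single (ract M x b, y) 1 - Poly_Mapping.single (x, lact N b y) 1) = 0"
      by (rule rel) (unfold tensor_relators_def Let_def, blast)
    then show ?thesis by (simp add: ev)
  qed
  show "pairing M N T tens"
    unfolding pairing_def cl_def using add1 add2 scale1 scale2 bal T by (simp add: is_tensor_product_def)
  show span: "t \<in> S" if S: "\<And>x y. x \<in> S \<Longrightarrow> y \<in> S \<Longrightarrow> x + y \<in> S" "\<And>x y. tens x y \<in> S" for S t
  proof -
    obtain f where t: "t = ?ev f" using surj by (rule surjE)
    have "tens (0 *\<^sub>C 0) 0 \<in> S" by (rule S(2))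
    then have "0 \<in> S" using scale1[of 0 0 0] by simp
    then show "t \<in> S" unfolding t eval_free_module_def scale1[symmetric] by (intro span_finite_sum S)
  qed
  fix \<beta> :: "'m \<Rightarrow> 'n \<Rightarrow> 'u"
  assume \<beta>: "\<And>x. cl (\<beta> x)" "\<And>y. cl (\<lambda>x. \<beta> x y)" "\<And>x b y. \<beta> (ract M x b) y = \<beta> x (lact N b y)"
  let ?g = "eval_free_module scaleC (\<lambda>z. \<beta> (fst z) (snd z))"
  have cl_g: "cl ?g" by (rule cl_eval_free_module[OF sc])
  note g = cl_diff[OF cl_g] cl_add[OF cl_g] cl_scale[OF cl_g] single
  have "cvec.subspace hull tensor_relators M N \<subseteq> {f. ?g f = 0}"
  proof (rule hull_minimal)
    show "tensor_relators M N \<subseteq> {f. ?g f = 0}"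
      unfolding tensor_relators_def Let_def
      by (auto simp: g cl_add[OF \<beta>(1)] cl_add[OF \<beta>(2)] cl_scale[OF \<beta>(1)] cl_scale[OF \<beta>(2)] \<beta>(3))
    show "cvec.subspace {f. ?g f = 0}"
      unfolding cvec.subspace_def by (simp add: cl_0[OF cl_g] cl_add[OF cl_g] cl_scale[OF cl_g])
  qed
  then have ker: "?g f = 0" if "?ev f = 0" for f
    using quot that by (auto simp: is_quotient_def)
  define h where "h t = ?g (inv ?ev t)" for t
  have h: "h (?ev f) = ?g f" for f
  proof -
    have "?ev (inv ?ev (?ev f) - f) = 0" by (simp add: cl_diff[OF cl_ev] surj_f_inv_f[OF surj])
    from ker[OF this] show ?thesis by (simp add: h_def cl_diff[OF cl_g])
  qed
  have ex: "\<exists>f. t = ?ev f" for t using surj by (rule surjD)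
  have cl_h: "cl h"
    unfolding cl_def
  proof (intro conjI allI)
    fix x y
    obtain f f' where f: "x = ?ev f" "y = ?ev f'" using ex by metis
    show "h (x + y) = h x + h y" unfolding f cl_add[OF cl_ev, symmetric] h by (rule cl_add[OF cl_g])
  next
    fix c x
    obtain f where f: "x = ?ev f" using ex by metis
    show "h (c *\<^sub>C x) = c *\<^sub>C h x" unfolding f cl_scale[OF cl_ev, symmetric] h by (rule cl_scale[OF cl_g])
  qed
  have h_tens: "h (tens x y) = \<beta> x y" for x y
    using h[of "Poly_Mapping.single (x, y) 1"] by (simp only: single)
  have "tensor_lift tens \<beta> = h"
    unfolding tensor_lift_def clinear_iff
  proof (rule the_equality)
    show "cl h \<and> (\<forall>x y. h (tens x y) = \<beta> x y)" using cl_h h_tens by simp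
    fix k assume k: "cl k \<and> (\<forall>x y. k (tens x y) = \<beta> x y)"
    show "k = h"
    proof
      fix t
      have "t \<in> {t. k t = h t}"
        by (rule span) (use k cl_h h_tens in \<open>simp_all add: cl_add\<close>)
      then show "k t = h t" by simp
    qed
  qed
  then show "cl (tensor_lift tens \<beta>) \<and> (\<forall>x y. tensor_lift tens \<beta> (tens x y) = \<beta> x y)"
    using cl_h h_tens by simp
qed

section \<open>The calculus on quantum projective space\<close>

lemma cap_prod4_left: "(\<And>y. cl (\<lambda>x. m x y)) \<Longrightarrow> cap \<kappa> 0 (prod4 m A B) f = m (tr \<kappa> A) (B (f 0) (f 1))"
  by (simp add: cap_def prod4_def graft_def tr_def cl_sum[of "\<lambda>x. m x _"] cl_scale[of "\<lambda>x. m x _"])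

lemma cap_prod4_right: "(\<And>x. cl (m x)) \<Longrightarrow> cap \<kappa> 2 (prod4 m A B) f = m (A (f 0) (f 1)) (tr \<kappa> B)"
  by (simp add: cap_def prod4_def graft_def tr_def cl_sum cl_scale)

lemma cl_mprod:
  assumes "cl h" "\<And>x y. h (m x y) = m' (g x) (k y)"
  shows "h (mprod m A B i l) = mprod m' (\<lambda>i j. g (A i j)) (\<lambda>i j. k (B i j)) i l"
  by (simp add: mprod_def cl_sum[OF assms(1)] assms(2))

text \<open>What the presentations of the two parts of the calculus say about the families of generators: they are eigentensors of
\<open>S\<close> or \<open>S~\<close> after multiplication by \<open>p\<close>, have zero q-trace, and generate.\<close>
lemma left_module_relations:
  fixes p :: "'n::finite \<Rightarrow> 'n \<Rightarrow> 'b::complex_algebra_1" and M :: "('b, 'm::complex_vector) bimod"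
    and F :: "('n list \<Rightarrow> ('n \<times> 'n \<Rightarrow>\<^sub>0 'b)) \<Rightarrow> 'n list \<Rightarrow> ('n \<times> 'n \<Rightarrow>\<^sub>0 'b)"
  assumes M: "bimodule M" and pres: "left_module_presentation (lact M) (\<lambda>(i, j). A i j) Rel"
    and Rel: "Rel = (let e = fam (\<lambda>i j. Poly_Mapping.single (i, j) 1); pe = fprod free_lact (fam p) e in
      {F pe I - c *\<^sub>C pe I | I. length I = 4} \<union> {contr' r q wt 1 e []})"
    and F: "\<And>x. ev4 (F x) = on_legs 1 X (on_legs k Y (on_legs 1 Z (ev4 x)))"
  shows "on_legs 1 X (on_legs k Y (on_legs 1 Z (prod4 (lact M) p A))) = (\<lambda>f. c *\<^sub>C prod4 (lact M) p A f)"
    and "tr (\<lambda>b. qc q (wform r (wt b) (two_rho r))) A = 0"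
    and "\<And>S x. (\<And>x y. x \<in> S \<Longrightarrow> y \<in> S \<Longrightarrow> x + y \<in> S) \<Longrightarrow> (\<And>b x. x \<in> S \<Longrightarrow> lact M b x \<in> S) \<Longrightarrow>
      (\<And>i j. A i j \<in> S) \<Longrightarrow> x \<in> S"
proof -
  interpret bimodule M by fact
  let ?em = "eval_free_module (lact M) (\<lambda>(i, j). A i j)"
  let ?e = "fam (\<lambda>i j. Poly_Mapping.single (i, j) (1::'b))"
  let ?pe = "fprod free_lact (fam p) ?e"
  have quot: "is_quotient ?em (left_submodule free_lact hull Rel)" using pres by (simp only: left_module_presentation_def)
  have cl_em: "cl ?em" by (rule cl_eval_free_module[OF bimodule_cl(3)[OF M]])
  have a0: "lact M 0 x = 0" for x by (rule cl_0[OF bimodule_cl(3)[OF M]])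
  note single = eval_free_module_single[where act = "lact M", OF a0]
  have "on_legs 1 X (on_legs k Y (on_legs 1 Z (ev4 (fprod (lact M) (fam p) (fam A))))) = (\<lambda>f. c *\<^sub>C ev4 (fprod (lact M) (fam p) (fam A)) f)"
  proof (rule ev4_relation[where x = ?pe and F = F, OF cl_em _ _ F])
    fix I :: "'n list"
    show "fprod (lact M) (fam p) (fam A) I = ?em (?pe I)"
      by (simp only: fprod_def fam_def free_lact_single single prod.case)
    assume I: "length I = 4"
    show "?em (F ?pe I - c *\<^sub>C ?pe I) = 0"
      by (rule quotient_relation[OF quot]) (use I in \<open>unfold Rel Let_def, blast\<close>)
  qed
  then show "on_legs 1 X (on_legs k Y (on_legs 1 Z (prod4 (lact M) p A))) = (\<lambda>f. c *\<^sub>C prod4 (lact M) p A f)"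
    by (simp only: ev4_fprod)
  have "?em (contr' r q wt 1 ?e []) = 0"
    by (rule quotient_relation[OF quot]) (unfold Rel Let_def, blast)
  then show "tr (\<lambda>b. qc q (wform r (wt b) (two_rho r))) A = 0"
    unfolding contr'_1 cl_sum[OF cl_em] cl_scale[OF cl_em] by (simp add: fam_def single lact_one tr_def)
  fix S x
  assume S: "\<And>x y. x \<in> S \<Longrightarrow> y \<in> S \<Longrightarrow> x + y \<in> S" "\<And>b x. x \<in> S \<Longrightarrow> lact M b x \<in> S" "\<And>i j. A i j \<in> S"
  have "surj ?em" using quot by (simp only: is_quotient_def)
  then obtain f where x: "x = ?em f" by (rule surjE)
  have "lact M 0 (A i i) \<in> S" for i by (intro S)
  then have z: "0 \<in> S" by (simp only: a0)
  show "x \<in> S" unfolding x eval_free_module_def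
  proof (rule span_finite_sum[OF S(1) z])
    fix g assume "g \<in> Poly_Mapping.keys f"
    show "lact M (Poly_Mapping.lookup f g) (case g of (i, j) \<Rightarrow> A i j) \<in> S"
      by (cases g) (simp add: S)
  qed
qed

lemma direct_sum_simps:
  "lact (direct_sum M N) b x = (lact M b (fst x), lact N b (snd x))"
  "ract (direct_sum M N) x b = (ract M (fst x) b, ract N (snd x) b)"
  by (simp_all add: direct_sum_def)

lemma scaleC_prod: "c *\<^sub>C x = (c *\<^sub>C fst x, c *\<^sub>C snd x)"
  by (simp add: scaleC_prod_def)

lemma bimodule_direct_sum:
  assumes "bimodule M" "bimodule N" shows "bimodule (direct_sum M N)"
proof -
  interpret M: bimodule M by fact
  interpret N: bimodule N by fact
  show ?thesis
    by standard (simp_all add: direct_sum_simps scaleC_prod M.lact_add_left N.lact_add_left M.lact_add_right N.lact_add_right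
      M.lact_scaleC_left N.lact_scaleC_left M.lact_scaleC_right N.lact_scaleC_right M.lact_mult N.lact_mult M.lact_one N.lact_one
      M.ract_add_left N.ract_add_left M.ract_add_right N.ract_add_right
      M.ract_scaleC_left N.ract_scaleC_left M.ract_scaleC_right N.ract_scaleC_right M.ract_mult N.ract_mult M.ract_one N.ract_one
      M.lact_ract N.lact_ract)
qed

lemma (in projection_data) wt_embed:
  assumes h: "cl h" "\<And>b x. h (lact M b x) = lact N b (h x)" "\<And>b x. h (ract M x b) = ract N (h x) b"
    and A: "wt M \<alpha> A"
  shows "wt N \<alpha> (\<lambda>i j. h (A i j))"
proof -
  have "prod4 (ract N) (\<lambda>i j. h (A i j)) p = (\<lambda>f. h (prod4 (ract M) A p f))"
    by (simp add: prod4_def h fun_eq_iff)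
  also have "\<dots> = (\<lambda>f. \<alpha> *\<^sub>C T 0 (\<lambda>f. h (prod4 (lact M) p A f)) f)"
    using A by (simp add: wt_def cl_scale[OF h(1)] cl_T[OF h(1)])
  also have "(\<lambda>f. h (prod4 (lact M) p A f)) = prod4 (lact N) p (\<lambda>i j. h (A i j))"
    by (simp add: prod4_def h fun_eq_iff)
  finally show ?thesis by (simp only: wt_def)
qed

theorem theorem5p5:
  fixes r s :: nat and q :: real
    and V :: "('n::finite) rep" and wt :: "'n \<Rightarrow> weight"
    and Rvv Rvd Rdd :: "complex^('n \<times> 'n)^('n \<times> 'n)"
    and p :: "'n \<Rightarrow> 'n \<Rightarrow> 'b::complex_algebra_1"
    and Omega_plus :: "('b, 'x::complex_vector) bimod"
    and Omega_minus :: "('b, 'y::complex_vector) bimod"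
    and del :: "'b \<Rightarrow> 'x" and delbar :: "'b \<Rightarrow> 'y"
    and OmegaOmega :: "('b, 't::complex_vector) bimod"
    and tens :: "'x \<times> 'y \<Rightarrow> 'x \<times> 'y \<Rightarrow> 't"
    and Omega2 :: "('b, 'w::complex_vector) bimod"
    and wedge :: "'t \<Rightarrow> 'w" and d2 :: "'x \<times> 'y \<Rightarrow> 'w"
    and Omega2Omega :: "('b, 'u::complex_vector) bimod"
    and tens2 :: "'w \<Rightarrow> 'x \<times> 'y \<Rightarrow> 'u"
    and nabla :: "'x \<times> 'y \<Rightarrow> 't"
  assumes "1 \<le> r" and "CARD('n) = r + 1" and "0 < q" and "q < 1" and "s \<in> {1, r}"
    and "simple_module r q V (omega r s)"
    and "weight_basis r q V wt"
    and "is_braiding r q V V Rvv"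
    and "is_braiding r q V (dual_rep V) Rvd"
    and "is_braiding r q (dual_rep V) (dual_rep V) Rdd"
    and "projective_space_algebra r s q wt Rvv Rvd Rdd p"
    and "hk_calculus r s q wt Rvv Rvd Rdd p Omega_plus Omega_minus del delbar"
    and "is_tensor_product (direct_sum Omega_plus Omega_minus) (direct_sum Omega_plus Omega_minus)
      OmegaOmega tens"
    and "universal_two_forms (direct_sum Omega_plus Omega_minus) (total_diff del delbar)
      OmegaOmega tens Omega2 wedge d2"
    and "is_tensor_product Omega2 (direct_sum Omega_plus Omega_minus) Omega2Omega tens2"
    and "levi_civita r s q wt Rvv Rvd Rdd p Omega_plus Omega_minus del delbar OmegaOmega tens nabla"
  shows "bimodule_map (direct_sum Omega_plus Omega_minus) Omega2Omega
    (riemann tens wedge d2 tens2 nabla)"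
proof -
  let ?w = "const_w r s" and ?m = "const_m r s" and ?a = "const_a r s"
  define \<kappa> where "\<kappa> = (\<lambda>b. qc q (wform r (wt b) (two_rho r)))"
  define z where "z = qc q (- (?w + ?m))"
  have data: "braiding_data Rvv (matrix_inv Rvv) Rvd (matrix_inv Rvd) Rdd (matrix_inv Rdd) \<kappa> z"
    unfolding \<kappa>_def z_def by (rule braidings_of_vector_module[OF assms(1-10)])
  interpret B: braiding_data Rvv "matrix_inv Rvv" Rvd "matrix_inv Rvd" Rdd "matrix_inv Rdd" \<kappa> z by (rule data)
  have qq: "qc q x * qc q (- x) = 1" for x using assms(3) by (simp add: qc_simps(2)) (simp add: qc_def)
  have zwm: "z * qc q ?w * qc q ?m = 1"
    unfolding z_def qc_simps(2) using assms(3) by (simp add: qc_def)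

  let ?\<phi> = "\<lambda>(i, j). p i j"
  let ?ef = "eval_free ?\<phi>"
  let ?Rel = "algebra_relators r s q wt Rvv Rvd Rdd"
  let ?g = "fam (\<lambda>i j. free_gen (i, j))"
  let ?gg = "fprod (*) ?g ?g"
  have quot: "is_quotient ?ef (two_sided_ideal hull ?Rel)"
    using assms(11) by (simp only: projective_space_algebra_def algebra_presentation_def)
  have gg: "fprod (*) (fam p) (fam p) I = ?ef (?gg I)" for I
    by (simp only: fprod_def fam_def eval_free_gens prod.case)
  have "on_legs 1 Rvd (on_legs 0 Rvv (on_legs 1 (matrix_inv Rvd) (ev4 (fprod (*) (fam p) (fam p)))))
      = (\<lambda>f. qc q ?w *\<^sub>C ev4 (fprod (*) (fam p) (fam p)) f)"
    by (rule ev4_relation[where x = ?gg and F = "S123 Rvv Rvd", OF cl_eval_free gg _ ev4_S],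
        rule quotient_relation[OF quot], unfold algebra_relators_def Let_def, blast)
  then have Spp: "on_legs 1 Rvd (on_legs 0 Rvv (on_legs 1 (matrix_inv Rvd) (prod4 (*) p p))) = (\<lambda>f. qc q ?w *\<^sub>C prod4 (*) p p f)"
    by (simp only: ev4_fprod)
  have "on_legs 1 Rvd (on_legs 2 (matrix_inv Rdd) (on_legs 1 (matrix_inv Rvd) (ev4 (fprod (*) (fam p) (fam p)))))
      = (\<lambda>f. qc q (- ?w) *\<^sub>C ev4 (fprod (*) (fam p) (fam p)) f)"
    by (rule ev4_relation[where x = ?gg and F = "St234 Rvd Rdd", OF cl_eval_free gg _ ev4_St],
        rule quotient_relation[OF quot], unfold algebra_relators_def Let_def, blast)
  then have Stpp: "on_legs 1 Rvd (on_legs 2 (matrix_inv Rdd) (on_legs 1 (matrix_inv Rvd) (prod4 (*) p p))) = (\<lambda>f. qc q (- ?w) *\<^sub>C prod4 (*) p p f)"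
    by (simp only: ev4_fprod)
  have "?ef (contr' r q wt 1 ?g [] - qc q ?m *\<^sub>C 1) = 0"
    by (rule quotient_relation[OF quot], unfold algebra_relators_def Let_def, blast)
  then have tr_p: "tr \<kappa> p = qc q ?m *\<^sub>C 1"
    unfolding contr'_1 cl_diff[OF cl_eval_free] cl_sum[OF cl_eval_free] cl_scale[OF cl_eval_free]
    by (simp add: fam_def eval_free_gens tr_def \<kappa>_def)
  have T_pp: "B.T 0 (prod4 (*) p p) = prod4 (*) p p"
    by (rule B.T_of_S_St[OF Spp Stpp qq])
  \<comment> \<open>On eigentensors of \<open>S\<close> for \<open>q\<^sup>w\<close>, the matrix product with \<open>p\<close> is the identity: it is the q-trace of \<open>p\<close>, up to the inverse scalar.\<close>
  have matrix_product: "mprod m p A = A"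
    if S: "on_legs 1 Rvd (on_legs 0 Rvv (on_legs 1 (matrix_inv Rvd) (prod4 m p A))) = (\<lambda>f. qc q ?w *\<^sub>C prod4 m p A f)"
      and m: "\<And>x. cl (\<lambda>b. m b x)" "\<And>x. m 1 x = x" for m :: "'b \<Rightarrow> 'z::complex_vector \<Rightarrow> 'z" and A
  proof (intro ext)
    fix i l
    have "mprod m p A i l = cap (\<lambda>_. 1) 1 (prod4 m p A) (pt i l)" by (simp only: cap_prod4) (simp add: pt_def)
    also have "\<dots> = (z * qc q ?w) *\<^sub>C cap \<kappa> 0 (prod4 m p A) (pt i l)" by (rule B.E_of_S[OF S])
    also have "\<dots> = (z * qc q ?w) *\<^sub>C m (qc q ?m *\<^sub>C 1) (A i l)"
      by (subst cap_prod4_left[OF m(1)]) (simp add: tr_p pt_def)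
    also have "\<dots> = (z * qc q ?w * qc q ?m) *\<^sub>C A i l" by (simp only: cl_scale[OF m(1)] m(2) scaleC_scaleC)
    finally show "mprod m p A i l = A i l" by (simp only: zwm scaleC_one)
  qed
  have p_p: "mprod (*) p p = p"
    by (rule matrix_product[OF Spp]) (use bimodule_cl(3)[OF bimodule_reg] in \<open>simp_all add: reg_simps\<close>)
  interpret P: projection_data Rvv "matrix_inv Rvv" Rvd "matrix_inv Rvd" Rdd "matrix_inv Rdd" \<kappa> z p "qc q ?m"
    by (intro projection_data.intro data projection_data_axioms.intro T_pp tr_p p_p qc_pos assms(3))

  note hk = assms(12)[unfolded hk_calculus_def]
  have Op: "bimodule Omega_plus" and Om: "bimodule Omega_minus" using hk by blast+
  have der: "derivation Omega_plus del" "derivation Omega_minus delbar" using hk by blast+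
  let ?dp = "\<lambda>i j. del (p i j)" and ?dbp = "\<lambda>i j. delbar (p i j)"
  have pres: "left_module_presentation (lact Omega_plus) (\<lambda>(i, j). del (p i j)) (del_relators r s q wt Rvd Rdd p)"
    "left_module_presentation (lact Omega_minus) (\<lambda>(i, j). delbar (p i j)) (delbar_relators r s q wt Rvv Rvd p)"
    using hk by blast+
  note plus = left_module_relations[OF Op pres(1) del_relators_def ev4_St, folded \<kappa>_def]
  note minus = left_module_relations[OF Om pres(2) delbar_relators_def ev4_S, folded \<kappa>_def]
  have wt_plus: "P.wt Omega_plus (qc q ?a) ?dp" and wt_minus: "P.wt Omega_minus (qc q (- ?a)) ?dbp"
  proof -
    have "prod4 (ract Omega_plus) ?dp p f = qc q ?a *\<^sub>C B.T 0 (prod4 (lact Omega_plus) p ?dp) f" for f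
    proof -
      have "fprod (ract Omega_plus) (fam ?dp) (fam p) [f 0, f 1, f 2, f 3]
          = qc q ?a *\<^sub>C T1234 Rvv Rvd Rdd (fprod (lact Omega_plus) (fam p) (fam ?dp)) [f 0, f 1, f 2, f 3]"
        using hk by simp
      then have "ev4 (fprod (ract Omega_plus) (fam ?dp) (fam p)) f
          = qc q ?a *\<^sub>C ev4 (T1234 Rvv Rvd Rdd (fprod (lact Omega_plus) (fam p) (fam ?dp))) f"
        by (simp only: ev4_def)
      then show ?thesis by (simp only: ev4_fprod ev4_T[OF data])
    qed
    then show "P.wt Omega_plus (qc q ?a) ?dp" by (simp only: P.wt_def fun_eq_iff) simp
    have "prod4 (ract Omega_minus) ?dbp p f = qc q (- ?a) *\<^sub>C B.T 0 (prod4 (lact Omega_minus) p ?dbp) f" for f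
    proof -
      have "fprod (ract Omega_minus) (fam ?dbp) (fam p) [f 0, f 1, f 2, f 3]
          = qc q (- ?a) *\<^sub>C T1234 Rvv Rvd Rdd (fprod (lact Omega_minus) (fam p) (fam ?dbp)) [f 0, f 1, f 2, f 3]"
        using hk by simp
      then have "ev4 (fprod (ract Omega_minus) (fam ?dbp) (fam p)) f
          = qc q (- ?a) *\<^sub>C ev4 (T1234 Rvv Rvd Rdd (fprod (lact Omega_minus) (fam p) (fam ?dbp))) f"
        by (simp only: ev4_def)
      then show ?thesis by (simp only: ev4_fprod ev4_T[OF data])
    qed
    then show "P.wt Omega_minus (qc q (- ?a)) ?dbp" by (simp only: P.wt_def fun_eq_iff) simp
  qed
  have p_dp: "mprod (lact Omega_plus) p ?dp i l = 0" for i l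
  proof -
    have "cap \<kappa> 2 (prod4 (lact Omega_plus) p ?dp) = (\<lambda>_. 0)"
      by (simp add: fun_eq_iff cap_prod4_right[OF bimodule_cl(1)[OF Op]] plus(2) cl_0[OF bimodule_cl(1)[OF Op]])
    from B.E_of_St[OF plus(1) qc_pos[OF assms(3)] this, of "pt i l"] show ?thesis
      by (simp only: cap_prod4) (simp add: pt_def)
  qed
  have p_dbp: "mprod (lact Omega_minus) p ?dbp = ?dbp"
    by (rule matrix_product[OF minus(1)]) (use bimodule_cl(3)[OF Om] bimodule.lact_one[OF Om] in simp_all)
  \<comment> \<open>Differentiating \<open>p p = p\<close> turns a matrix product with \<open>p\<close> on the left into one on the right.\<close>
  have leibniz: "D (p i l) = mprod (ract M) (\<lambda>i j. D (p i j)) p i l + mprod (lact M) p (\<lambda>i j. D (p i j)) i l"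
    if "derivation M D" for M :: "('b, 'z::complex_vector) bimod" and D i l
  proof -
    have D: "cl D" "\<And>a b. D (a * b) = ract M (D a) b + lact M a (D b)"
      using that by (simp_all add: derivation_def clinear_iff)
    have "D (p i l) = D (mprod (*) p p i l)" by (simp only: p_p)
    then show ?thesis by (simp add: mprod_def cl_sum[OF D(1)] D(2) sum.distrib)
  qed
  have dp_p: "mprod (ract Omega_plus) ?dp p i l = ?dp i l" for i l
    using leibniz[OF der(1), of i l] by (simp only: p_dp add_0_right)
  have dbp_p: "mprod (ract Omega_minus) ?dbp p i l = 0" for i l
    using leibniz[OF der(2), of i l] by (simp only: p_dbp) simp

  let ?O = "direct_sum Omega_plus Omega_minus"
  let ?h = "\<lambda>x. (x, 0::'y)" and ?k = "\<lambda>y. (0::'x, y)"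
  have O1: "bimodule ?O" by (rule bimodule_direct_sum[OF Op Om])
  have h: "cl ?h" "\<And>b x. ?h (lact Omega_plus b x) = lact ?O b (?h x)" "\<And>b x. ?h (ract Omega_plus x b) = ract ?O (?h x) b"
    by (simp_all add: cl_def scaleC_prod direct_sum_simps cl_0[OF bimodule_cl(1)[OF Om]] cl_0[OF bimodule_cl(2)[OF Om]])
  have k: "cl ?k" "\<And>b x. ?k (lact Omega_minus b x) = lact ?O b (?k x)" "\<And>b x. ?k (ract Omega_minus x b) = ract ?O (?k x) b"
    by (simp_all add: cl_def scaleC_prod direct_sum_simps cl_0[OF bimodule_cl(1)[OF Op]] cl_0[OF bimodule_cl(2)[OF Op]])
  define dP where "dP = (\<lambda>i j. ?h (del (p i j)))"
  define dbP where "dbP = (\<lambda>i j. ?k (delbar (p i j)))"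
  let ?d = "total_diff del delbar"
  have inv_a: "inverse (qc q ?a) = qc q (- ?a)" by (simp add: qc_simps(3) inverse_eq_divide)

  note tens_facts = tensor_product_facts[OF assms(13)]
  note tens2_facts = tensor_product_facts[OF assms(15)]
  note u2 = assms(14)[unfolded universal_two_forms_def bimodule_map_def clinear_iff]
  have O2: "bimodule Omega2" using u2 by blast
  have wedge: "cl wedge" "\<And>b t. wedge (lact OmegaOmega b t) = lact Omega2 b (wedge t)"
      "\<And>t b. wedge (ract OmegaOmega t b) = ract Omega2 (wedge t) b"
    and d2: "cl d2" "\<And>a b. d2 (lact ?O a (?d b)) = wedge (tens (?d a) (?d b))"
    using u2 by blast+
  note tp = pairingD[OF tens_facts(2)] and tp2 = pairingD[OF tens2_facts(2)]
  \<comment> \<open>The map \<open>t \<mapsto> (\<and> \<otimes> id) (x \<otimes> t)\<close> as it occurs in the Riemann tensor.\<close>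
  define L where "L x t = tensor_lift tens (\<lambda>y z. tens2 (wedge (tens x y)) z) t" for x t
  have L: "cl (L x) \<and> (\<forall>y z. L x (tens y z) = tens2 (wedge (tens x y)) z)" for x
    unfolding L_def[abs_def]
  proof (rule tens_facts(4))
    show "cl (tens2 (wedge (tens x y)))" for y by (rule tp2(1))
    show "cl (\<lambda>y. tens2 (wedge (tens x y)) z)" for z
      by (simp add: cl_def cl_add[OF tp(1)] cl_add[OF wedge(1)] cl_add[OF tp2(2)] cl_scale[OF tp(1)] cl_scale[OF wedge(1)] cl_scale[OF tp2(2)])
    show "tens2 (wedge (tens x (ract ?O y b))) z = tens2 (wedge (tens x y)) (lact ?O b z)" for y b z
      by (simp only: tp(5) wedge(3) tp2(3))
  qed

  note lc = assms(16)[unfolded levi_civita_def Let_def clinear_iff]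
  have nabla: "cl nabla" "\<And>b x. nabla (lact ?O b x) = tens (?d b) x + lact OmegaOmega b (nabla x)"
    using lc by blast+
  have dPf: "fam (\<lambda>i j. (del (p i j), 0::'y)) = fam dP" "fam (\<lambda>i j. (0::'x, delbar (p i j))) = fam dbP"
    by (simp_all only: dP_def dbP_def)
  have g: "metric_mp r q wt tens (fam dP) (fam dbP) = tr \<kappa> (mprod tens dbP dP)"
    "metric_pm r q wt tens (fam dP) (fam dbP) = tr \<kappa> (mprod tens dP dbP)"
    unfolding metric_mp_def metric_pm_def contr'_1 contr_2 ev4_fprod cap_prod4
    by (simp_all add: tr_def \<kappa>_def pt_def)
  have b: "contr 2 (T1234 Rvv Rvd Rdd (fprod tens (fam dbP) (fam dP))) [i, j] = P.bprod tens dbP dP i j" for i j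
    unfolding contr_2 ev4_T[OF data] ev4_fprod P.bprod_def ..
  have c: "contr 2 (fprod tens (fam dP) (fam dbP)) [i, j] = mprod tens dP dbP i j" for i j
    unfolding contr_2 ev4_fprod cap_prod4 by (simp add: pt_def)
  have f2: "fam A [i, j] = A i j" for A :: "'n \<Rightarrow> 'n \<Rightarrow> 'z" and i j by (simp add: fam_def)
  have nabla_dP: "nabla (dP i j) = qc q ?a *\<^sub>C P.bprod tens dbP dP i j
      - (qc q ?a * qc q (- ?m)) *\<^sub>C lact OmegaOmega (p i j) (tr \<kappa> (mprod tens dbP dP))" for i j
    using lc unfolding dPf g b c f2 by blast
  have nabla_dbP: "nabla (dbP i j) = mprod tens dP dbP i j
      - qc q (- ?m) *\<^sub>C lact OmegaOmega (p i j) (tr \<kappa> (mprod tens dP dbP))" for i j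
    using lc unfolding dPf g b c f2 by blast

  interpret C: calculus0 Rvv "matrix_inv Rvv" Rvd "matrix_inv Rvd" Rdd "matrix_inv Rdd" \<kappa> z p "qc q ?m"
    ?O ?d dP dbP "qc q ?a" "qc q (- ?m)" OmegaOmega tens Omega2 wedge d2 Omega2Omega tens2 nabla L
  proof (intro calculus0.intro calculus0_axioms.intro P.projection_data_axioms)
    show "bimodule ?O" "bimodule OmegaOmega" "bimodule Omega2" "bimodule Omega2Omega"
      by (fact O1 tens_facts(1) O2 tens2_facts(1))+
    show "qc q ?a \<noteq> 0" by (rule qc_pos[OF assms(3)])
    have a2: "?a = 2" by (rule const_a_eq[OF assms(5,1)])
    have "q powr 4 < 1" using power_strict_decreasing[of 0 4 q] assms(3,4) by simp
    then show "qc q ?a * qc q ?a \<noteq> 1" unfolding qc_simps(2) unfolding a2 qc_def by (simp add: of_real_eq_1_iff)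
    show "P.wt ?O (qc q ?a) dP" unfolding dP_def by (rule P.wt_embed[OF h wt_plus])
    show "P.wt ?O (inverse (qc q ?a)) dbP" unfolding dbP_def inv_a by (rule P.wt_embed[OF k wt_minus])
    have e: "mprod (ract ?O) dP p i l = ?h (mprod (ract Omega_plus) ?dp p i l)"
        "mprod (lact ?O) p dP i l = ?h (mprod (lact Omega_plus) p ?dp i l)"
        "mprod (ract ?O) dbP p i l = ?k (mprod (ract Omega_minus) ?dbp p i l)"
        "mprod (lact ?O) p dbP i l = ?k (mprod (lact Omega_minus) p ?dbp i l)" for i l
      unfolding dP_def dbP_def
      by (rule cl_mprod[OF h(1), of "ract Omega_plus" "ract ?O" ?h "\<lambda>b. b", OF h(3), symmetric]
          cl_mprod[OF h(1), of "lact Omega_plus" "lact ?O" "\<lambda>b. b" ?h, OF h(2), symmetric]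
          cl_mprod[OF k(1), of "ract Omega_minus" "ract ?O" ?k "\<lambda>b. b", OF k(3), symmetric]
          cl_mprod[OF k(1), of "lact Omega_minus" "lact ?O" "\<lambda>b. b" ?k, OF k(2), symmetric])+
    show "mprod (ract ?O) dP p = dP"
      by (intro ext, unfold e dp_p) (simp only: dP_def)
    show "mprod (lact ?O) p dP i j = 0" for i j
      unfolding e p_dp zero_prod_def by (rule refl)
    show "mprod (ract ?O) dbP p i j = 0" for i j
      unfolding e dbp_p zero_prod_def by (rule refl)
    show "mprod (lact ?O) p dbP = dbP"
      by (intro ext, unfold e p_dbp) (simp only: dbP_def)
    show "?d (b * c) = ract ?O (?d b) c + lact ?O b (?d c)" for b c
      using der by (simp add: total_diff_def direct_sum_simps derivation_def)
    show "?d (p i j) = dP i j + dbP i j" for i j by (simp add: total_diff_def dP_def dbP_def)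
    show "b \<in> S" if S: "\<And>x y. x \<in> S \<Longrightarrow> y \<in> S \<Longrightarrow> x + y \<in> S" "\<And>c x. x \<in> S \<Longrightarrow> c *\<^sub>C x \<in> S"
      "\<And>x y. x \<in> S \<Longrightarrow> y \<in> S \<Longrightarrow> x * y \<in> S" "1 \<in> S" "\<And>i j. p i j \<in> S" for S b
    proof -
      have "surj ?ef" using quot by (simp only: is_quotient_def)
      then obtain f where b: "b = ?ef f" by (rule surjE)
      have "0 *\<^sub>C 1 \<in> S" by (intro S)
      then have z: "0 \<in> S" by simp
      have "prod_list (map ?\<phi> l) \<in> S" for l by (induction l) (auto intro: S split: prod.split)
      then show ?thesis unfolding b eval_free_def by (intro span_finite_sum[OF S(1) z] S(2))
    qed
    show "x \<in> S" if S: "\<And>x y. x \<in> S \<Longrightarrow> y \<in> S \<Longrightarrow> x + y \<in> S" "\<And>b x. x \<in> S \<Longrightarrow> lact ?O b x \<in> S"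
      "\<And>i j. dP i j \<in> S" "\<And>i j. dbP i j \<in> S" for S x
    proof -
      have "fst x \<in> {x. ?h x \<in> S}"
      proof (rule plus(3))
        show "x + y \<in> {x. ?h x \<in> S}" if "x \<in> {x. ?h x \<in> S}" "y \<in> {x. ?h x \<in> S}" for x y
          using S(1)[of "?h x" "?h y"] that by simp
        show "lact Omega_plus b x \<in> {x. ?h x \<in> S}" if "x \<in> {x. ?h x \<in> S}" for b x
          using S(2)[of "?h x" b] that unfolding h(2)[symmetric] by simp
        show "?dp i j \<in> {x. ?h x \<in> S}" for i j using S(3)[of i j] by (simp add: dP_def)
      qed
      moreover have "snd x \<in> {x. ?k x \<in> S}"
      proof (rule minus(3))
        show "x + y \<in> {x. ?k x \<in> S}" if "x \<in> {x. ?k x \<in> S}" "y \<in> {x. ?k x \<in> S}" for x y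
          using S(1)[of "?k x" "?k y"] that by simp
        show "lact Omega_minus b x \<in> {x. ?k x \<in> S}" if "x \<in> {x. ?k x \<in> S}" for b x
          using S(2)[of "?k x" b] that unfolding k(2)[symmetric] by simp
        show "?dbp i j \<in> {x. ?k x \<in> S}" for i j using S(4)[of i j] by (simp add: dbP_def)
      qed
      ultimately show ?thesis using S(1)[of "?h (fst x)" "?k (snd x)"] by simp
    qed
    show "pairing ?O ?O OmegaOmega tens" "pairing Omega2 ?O Omega2Omega tens2" by (fact tens_facts(2) tens2_facts(2))+
    show "cl wedge" "cl d2" "cl nabla" by (fact wedge(1) d2(1) nabla(1))+
    show "wedge (lact OmegaOmega b t) = lact Omega2 b (wedge t)" "wedge (ract OmegaOmega t b) = ract Omega2 (wedge t) b" for b t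
      by (fact wedge(2) wedge(3))+
    show "d2 (lact ?O b (?d c)) = wedge (tens (?d b) (?d c))" for b c by (rule d2(2))
    show "t \<in> S" if "\<And>x y. x \<in> S \<Longrightarrow> y \<in> S \<Longrightarrow> x + y \<in> S" "\<And>x y. tens x y \<in> S" for S t
      by (rule tens_facts(3)[OF that])
    show "cl (L x)" "L x (tens y z') = tens2 (wedge (tens x y)) z'" for x y z' using L by blast+
    show "nabla (lact ?O b x) = tens (?d b) x + lact OmegaOmega b (nabla x)" for b x by (rule nabla(2))
    show "nabla (dP i j) = qc q ?a *\<^sub>C P.bprod tens dbP dP i j
      - (qc q ?a * qc q (- ?m)) *\<^sub>C lact OmegaOmega (p i j) (tr \<kappa> (mprod tens dbP dP))" for i j by (rule nabla_dP)
    show "nabla (dbP i j) = mprod tens dP dbP i j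
      - qc q (- ?m) *\<^sub>C lact OmegaOmega (p i j) (tr \<kappa> (mprod tens dP dbP))" for i j by (rule nabla_dbP)
  qed

  define \<Theta> where "\<Theta> t = tensor_lift tens (\<lambda>x \<eta>. tens2 (d2 x) \<eta> - L x (nabla \<eta>)) t" for t
  note lp = pairingD[OF C.L_pairing]
  have \<Theta>: "cl \<Theta> \<and> (\<forall>x y. \<Theta> (tens x y) = tens2 (d2 x) y - L x (nabla y))"
    unfolding \<Theta>_def[abs_def]
  proof (rule tens_facts(4))
    show "cl (\<lambda>\<eta>. tens2 (d2 x) \<eta> - L x (nabla \<eta>))" for x
      by (simp add: cl_def cl_add[OF tp2(1)] cl_add[OF nabla(1)] cl_add[OF lp(1)] cl_scale[OF tp2(1)] cl_scale[OF nabla(1)]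
          cl_scale[OF lp(1)] cvec.scale_right_diff_distrib)
    show "cl (\<lambda>x. tens2 (d2 x) \<eta> - L x (nabla \<eta>))" for \<eta>
      by (simp add: cl_def cl_add[OF tp2(2)] cl_add[OF d2(1)] cl_add[OF lp(2)] cl_scale[OF tp2(2)] cl_scale[OF d2(1)]
          cl_scale[OF lp(2)] cvec.scale_right_diff_distrib)
    show "tens2 (d2 (ract ?O x b)) \<eta> - L (ract ?O x b) (nabla \<eta>) = tens2 (d2 x) (lact ?O b \<eta>) - L x (nabla (lact ?O b \<eta>))" for x b \<eta>
    proof -
      have "L x (tens (?d b) \<eta>) = tens2 (C.w x (?d b)) \<eta>" unfolding C.w_def using L by blast
      then show ?thesis
        by (simp add: C.d2_ract cl_diff[OF tp2(2)] tp2(3) lp(3) nabla(2) cl_add[OF lp(1)])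
    qed
  qed
  interpret C: calculus Rvv "matrix_inv Rvv" Rvd "matrix_inv Rvd" Rdd "matrix_inv Rdd" \<kappa> z p "qc q ?m"
    ?O ?d dP dbP "qc q ?a" "qc q (- ?m)" OmegaOmega tens Omega2 wedge d2 Omega2Omega tens2 nabla L \<Theta>
    by unfold_locales (use \<Theta> in blast)+
  have "riemann tens wedge d2 tens2 nabla = C.Riem"
    by (intro ext) (simp only: riemann_def C.Riem_def \<Theta>_def L_def)
  then show ?thesis
    unfolding bimodule_map_def clinear_iff using C.cl_Riem C.Riem_lact C.Riem_ract by simp
qed

end
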